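(* Let $k$ be a field, $\mathcal{T}$ a Krull-Schmidt, $k$-linear, Hom-finite triangulated category, $T$ a basic silting object of $\mathcal{T}$ and $U$ a presilting object of $\mathcal{T}$ with $T\geq U$. If there exist only finitely many basic silting objects $V$ of $\mathcal{T}$ (up to isomorphism) satisfying $T\geq V\geq U$, then $U$ is a partial silting object.
   Context: Hom-finite means $\dim_k\operatorname{Hom}_{\mathcal{T}}(X,Y)<\infty$ for all objects $X,Y$. $\operatorname{thick} T$ is the smallest thick subcategory of $\mathcal{T}$ containing $T$. An object is basic if its endomorphism algebra is basic. An object $T$ of $\mathcal{T}$ is presilting if $\operatorname{Hom}_{\mathcal{T}}(T,T[i])=0$ for all $i>0$; it is silting if it is presilting and $\mathcal{T}=\operatorname{thick} T$; it is partial silting if it is a direct summand of a silting object. For objects $M,N$ of $\mathcal{T}$, $M\geq N$ means $\operatorname{Hom}_{\mathcal{T}}(M,N[i])=0$ for all $i>0$. *)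

theory Defs
  imports "Jordan_Normal_Form.Missing_VectorSpace"
begin

section \<open>Linear categories\<close>

text \<open>
  All elements of the type \<^typ>\<open>'o\<close> are objects.  The space of morphisms from \<open>X\<close> to \<open>Y\<close> is
  the module \<open>HOM C X Y\<close> over a field \<open>K\<close>; the ring multiplication and the unit that the record
  type \<^typ>\<open>('k, 'm) module\<close> also carries are never used.  Composition is written in the
  functional order: \<open>g \<cdot> f\<close> is \<open>f\<close> followed by \<open>g\<close>.  The Hom-sets are not required to be disjoint.
\<close>

record ('k, 'o, 'm) linear_category_data =
  HOM :: "'o \<Rightarrow> 'o \<Rightarrow> ('k, 'm) module"
  comp :: "'m \<Rightarrow> 'm \<Rightarrow> 'm"  (infixl \<open>\<cdot>\<index>\<close> 70)
  ident :: "'o \<Rightarrow> 'm"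

abbreviation mor :: "('k, 'o, 'm, 'z) linear_category_data_scheme \<Rightarrow> 'o \<Rightarrow> 'o \<Rightarrow> 'm set"
  where "mor C X Y \<equiv> carrier (HOM C X Y)"

abbreviation zero_mor :: "('k, 'o, 'm, 'z) linear_category_data_scheme \<Rightarrow> 'o \<Rightarrow> 'o \<Rightarrow> 'm"
  where "zero_mor C X Y \<equiv> \<zero>\<^bsub>HOM C X Y\<^esub>"

definition zero_object :: "('k, 'o, 'm, 'z) linear_category_data_scheme \<Rightarrow> 'o \<Rightarrow> bool"
  where "zero_object C Z \<longleftrightarrow>
    (\<forall>X. mor C X Z = {zero_mor C X Z} \<and> mor C Z X = {zero_mor C Z X})"

definition iso_mor :: "('k, 'o, 'm, 'z) linear_category_data_scheme \<Rightarrow> 'o \<Rightarrow> 'o \<Rightarrow> 'm \<Rightarrow> bool"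
  where "iso_mor C X Y f \<longleftrightarrow>
    f \<in> mor C X Y \<and> (\<exists>g \<in> mor C Y X. g \<cdot>\<^bsub>C\<^esub> f = ident C X \<and> f \<cdot>\<^bsub>C\<^esub> g = ident C Y)"

definition isomorphic :: "('k, 'o, 'm, 'z) linear_category_data_scheme \<Rightarrow> 'o \<Rightarrow> 'o \<Rightarrow> bool"
  where "isomorphic C X Y \<longleftrightarrow> (\<exists>f. iso_mor C X Y f)"

definition iso_class :: "('k, 'o, 'm, 'z) linear_category_data_scheme \<Rightarrow> 'o \<Rightarrow> 'o set"
  where "iso_class C X = {Y. isomorphic C X Y}"

text \<open>\<open>biproduct C X Y Z\<close> says that \<open>X\<close> is a direct sum of \<open>Y\<close> and \<open>Z\<close>.\<close>

definition biproduct ::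
    "('k, 'o, 'm, 'z) linear_category_data_scheme \<Rightarrow> 'o \<Rightarrow> 'o \<Rightarrow> 'o \<Rightarrow> bool"
  where "biproduct C X Y Z \<longleftrightarrow>
    (\<exists>i \<in> mor C Y X. \<exists>j \<in> mor C Z X. \<exists>p \<in> mor C X Y. \<exists>q \<in> mor C X Z.
      p \<cdot>\<^bsub>C\<^esub> i = ident C Y \<and> q \<cdot>\<^bsub>C\<^esub> j = ident C Z \<and>
      q \<cdot>\<^bsub>C\<^esub> i = zero_mor C Y Z \<and> p \<cdot>\<^bsub>C\<^esub> j = zero_mor C Z Y \<and>
      (i \<cdot>\<^bsub>C\<^esub> p) \<oplus>\<^bsub>HOM C X X\<^esub> (j \<cdot>\<^bsub>C\<^esub> q) = ident C X)"

definition direct_summand :: "('k, 'o, 'm, 'z) linear_category_data_scheme \<Rightarrow> 'o \<Rightarrow> 'o \<Rightarrow> bool"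
  where "direct_summand C Y X \<longleftrightarrow> (\<exists>Z. biproduct C X Y Z)"

text \<open>\<open>direct_sum C X Y n\<close> says that \<open>X\<close> is a direct sum of \<open>Y 0, \<dots>, Y (n - 1)\<close>.\<close>

definition direct_sum ::
    "('k, 'o, 'm, 'z) linear_category_data_scheme \<Rightarrow> 'o \<Rightarrow> (nat \<Rightarrow> 'o) \<Rightarrow> nat \<Rightarrow> bool"
  where "direct_sum C X Y n \<longleftrightarrow>
    (\<exists>i p. (\<forall>a<n. i a \<in> mor C (Y a) X \<and> p a \<in> mor C X (Y a)) \<and>
      (\<forall>a<n. \<forall>b<n. p a \<cdot>\<^bsub>C\<^esub> i b = (if a = b then ident C (Y a) else zero_mor C (Y b) (Y a))) \<and>
      (\<Oplus>\<^bsub>HOM C X X\<^esub> a\<in>{..<n}. i a \<cdot>\<^bsub>C\<^esub> p a) = ident C X)"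

locale linear_category =
  fixes K :: "'k ring" and C :: "('k, 'o, 'm, 'z) linear_category_data_scheme" (structure)
  assumes hom_vectorspace: "vectorspace K (HOM C X Y)"
    and ident_closed: "ident C X \<in> mor C X X"
    and precomp_linear:
      "f \<in> mor C X Y \<Longrightarrow> (\<lambda>g. g \<cdot> f) \<in> module_hom K (HOM C Y Z) (HOM C X Z)"
    and postcomp_linear:
      "g \<in> mor C Y Z \<Longrightarrow> (\<lambda>f. g \<cdot> f) \<in> module_hom K (HOM C X Y) (HOM C X Z)"
    and ident_left: "f \<in> mor C X Y \<Longrightarrow> ident C Y \<cdot> f = f"
    and ident_right: "f \<in> mor C X Y \<Longrightarrow> f \<cdot> ident C X = f"
    and comp_assoc:
      "\<lbrakk>f \<in> mor C W X; g \<in> mor C X Y; h \<in> mor C Y Z\<rbrakk> \<Longrightarrow> (h \<cdot> g) \<cdot> f = h \<cdot> (g \<cdot> f)"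

locale additive_linear_category = linear_category +
  assumes ex_zero_object: "\<exists>Z. zero_object C Z"
    and ex_biproduct: "\<exists>X. biproduct C X Y Z"

definition hom_finite :: "'k ring \<Rightarrow> ('k, 'o, 'm, 'z) linear_category_data_scheme \<Rightarrow> bool"
  where "hom_finite K C \<longleftrightarrow> (\<forall>X Y. vectorspace.fin_dim K (HOM C X Y))"

definition End_ring :: "('k, 'o, 'm, 'z) linear_category_data_scheme \<Rightarrow> 'o \<Rightarrow> 'm ring"
  where "End_ring C X = \<lparr>carrier = mor C X X, mult = comp C, one = ident C X,
    zero = zero_mor C X X, add = add (HOM C X X)\<rparr>"

text \<open>The rings are not assumed to be commutative.\<close>

definition local_ring :: "('a, 'b) ring_scheme \<Rightarrow> bool"
  where "local_ring R \<longleftrightarrow> ring R \<and> \<one>\<^bsub>R\<^esub> \<noteq> \<zero>\<^bsub>R\<^esub> \<and>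
    (\<forall>a \<in> carrier R - Units R. \<forall>b \<in> carrier R - Units R. a \<oplus>\<^bsub>R\<^esub> b \<notin> Units R)"

definition krull_schmidt :: "('k, 'o, 'm, 'z) linear_category_data_scheme \<Rightarrow> bool"
  where "krull_schmidt C \<longleftrightarrow>
    (\<forall>X. \<exists>n Y. direct_sum C X Y n \<and> (\<forall>a<n. local_ring (End_ring C (Y a))))"


section \<open>Basic algebras\<close>

definition idempotent :: "('a, 'b) ring_scheme \<Rightarrow> 'a \<Rightarrow> bool"
  where "idempotent A e \<longleftrightarrow> e \<in> carrier A \<and> e \<otimes>\<^bsub>A\<^esub> e = e"

definition orthogonal_elements :: "('a, 'b) ring_scheme \<Rightarrow> 'a \<Rightarrow> 'a \<Rightarrow> bool"
  where "orthogonal_elements A e f \<longleftrightarrow> e \<otimes>\<^bsub>A\<^esub> f = \<zero>\<^bsub>A\<^esub> \<and> f \<otimes>\<^bsub>A\<^esub> e = \<zero>\<^bsub>A\<^esub>"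

definition primitive_idempotent :: "('a, 'b) ring_scheme \<Rightarrow> 'a \<Rightarrow> bool"
  where "primitive_idempotent A e \<longleftrightarrow> idempotent A e \<and> e \<noteq> \<zero>\<^bsub>A\<^esub> \<and>
    (\<forall>f g. idempotent A f \<and> idempotent A g \<and> orthogonal_elements A f g \<and> e = f \<oplus>\<^bsub>A\<^esub> g
      \<longrightarrow> f = \<zero>\<^bsub>A\<^esub> \<or> g = \<zero>\<^bsub>A\<^esub>)"

definition complete_primitive_orthogonal_idempotents ::
    "('a, 'b) ring_scheme \<Rightarrow> (nat \<Rightarrow> 'a) \<Rightarrow> nat \<Rightarrow> bool"
  where "complete_primitive_orthogonal_idempotents A e n \<longleftrightarrow>
    (\<forall>i<n. primitive_idempotent A (e i)) \<and>
    (\<forall>i<n. \<forall>j<n. i \<noteq> j \<longrightarrow> orthogonal_elements A (e i) (e j)) \<and>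
    (\<Oplus>\<^bsub>A\<^esub> i\<in>{..<n}. e i) = \<one>\<^bsub>A\<^esub>"

definition principal_right_ideal :: "('a, 'b) ring_scheme \<Rightarrow> 'a \<Rightarrow> 'a set"
  where "principal_right_ideal A e = {e \<otimes>\<^bsub>A\<^esub> a | a. a \<in> carrier A}"

text \<open>
  Isomorphism of right ideals as right \<open>A\<close>-modules.  When \<open>A\<close> is a unital \<open>K\<close>-algebra such a map
  is automatically \<open>K\<close>-linear, since scalars act through \<open>A\<close>.
\<close>

definition right_ideals_isomorphic :: "('a, 'b) ring_scheme \<Rightarrow> 'a set \<Rightarrow> 'a set \<Rightarrow> bool"
  where "right_ideals_isomorphic A I J \<longleftrightarrow>
    (\<exists>\<phi>. bij_betw \<phi> I J \<and>
      (\<forall>x\<in>I. \<forall>y\<in>I. \<phi> (x \<oplus>\<^bsub>A\<^esub> y) = \<phi> x \<oplus>\<^bsub>A\<^esub> \<phi> y) \<and>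
      (\<forall>x\<in>I. \<forall>a\<in>carrier A. \<phi> (x \<otimes>\<^bsub>A\<^esub> a) = \<phi> x \<otimes>\<^bsub>A\<^esub> a))"

text \<open>
  A finite-dimensional algebra is basic if the indecomposable projective modules occurring in a
  decomposition of its regular module are pairwise non-isomorphic.  The zero algebra is basic (\<open>n = 0\<close>).
\<close>

definition basic_algebra :: "('a, 'b) ring_scheme \<Rightarrow> bool"
  where "basic_algebra A \<longleftrightarrow>
    (\<exists>n e. complete_primitive_orthogonal_idempotents A e n \<and>
      (\<forall>i<n. \<forall>j<n. i \<noteq> j \<longrightarrow>
        \<not> right_ideals_isomorphic A (principal_right_ideal A (e i)) (principal_right_ideal A (e j))))"

definition basic :: "('k, 'o, 'm, 'z) linear_category_data_scheme \<Rightarrow> 'o \<Rightarrow> bool"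
  where "basic C X \<longleftrightarrow> basic_algebra (End_ring C X)"


section \<open>Triangulated categories\<close>

text \<open>
  \<open>dtri C X Y Z f g h\<close> says that \<open>X \<rightarrow> Y \<rightarrow> Z \<rightarrow> X[1]\<close>, with morphisms \<open>f\<close>, \<open>g\<close> and \<open>h\<close>,
  is a distinguished triangle.
\<close>

record ('k, 'o, 'm) triangulated_data = "('k, 'o, 'm) linear_category_data" +
  shift_ob :: "'o \<Rightarrow> 'o"
  shift_mor :: "'m \<Rightarrow> 'm"
  dtri :: "'o \<Rightarrow> 'o \<Rightarrow> 'o \<Rightarrow> 'm \<Rightarrow> 'm \<Rightarrow> 'm \<Rightarrow> bool"

text \<open>
  The shift is only required to be an autoequivalence (not an automorphism); this is the more
  general of the two usual conventions.
\<close>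

locale triangulated_category = additive_linear_category K C
  for K :: "'k ring" and C :: "('k, 'o, 'm, 'z) triangulated_data_scheme" (structure) +
  assumes shift_linear:
      "shift_mor C \<in> module_hom K (HOM C X Y) (HOM C (shift_ob C X) (shift_ob C Y))"
    and shift_ident: "shift_mor C (ident C X) = ident C (shift_ob C X)"
    and shift_comp:
      "\<lbrakk>f \<in> mor C X Y; g \<in> mor C Y Z\<rbrakk> \<Longrightarrow>
        shift_mor C (g \<cdot> f) = shift_mor C g \<cdot> shift_mor C f"
    and shift_fully_faithful:
      "bij_betw (shift_mor C) (mor C X Y) (mor C (shift_ob C X) (shift_ob C Y))"
    and shift_essentially_surjective: "\<exists>X. isomorphic C (shift_ob C X) Y"
    and dtri_closed:
      "dtri C X Y Z f g h \<Longrightarrow>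
        f \<in> mor C X Y \<and> g \<in> mor C Y Z \<and> h \<in> mor C Z (shift_ob C X)"
    and TR1_iso:
      "\<lbrakk>dtri C X Y Z f g h;
        f' \<in> mor C X' Y'; g' \<in> mor C Y' Z'; h' \<in> mor C Z' (shift_ob C X');
        iso_mor C X X' u; iso_mor C Y Y' v; iso_mor C Z Z' w;
        v \<cdot> f = f' \<cdot> u; w \<cdot> g = g' \<cdot> v; shift_mor C u \<cdot> h = h' \<cdot> w\<rbrakk> \<Longrightarrow>
        dtri C X' Y' Z' f' g' h'"
    and TR1_ident:
      "zero_object C Z \<Longrightarrow>
        dtri C X X Z (ident C X) (zero_mor C X Z) (zero_mor C Z (shift_ob C X))"
    and TR1_cone: "f \<in> mor C X Y \<Longrightarrow> \<exists>Z g h. dtri C X Y Z f g h"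
    and TR2:
      "\<lbrakk>f \<in> mor C X Y; g \<in> mor C Y Z; h \<in> mor C Z (shift_ob C X)\<rbrakk> \<Longrightarrow>
        dtri C X Y Z f g h \<longleftrightarrow>
        dtri C Y Z (shift_ob C X) g h (\<ominus>\<^bsub>HOM C (shift_ob C X) (shift_ob C Y)\<^esub> shift_mor C f)"
    and TR3:
      "\<lbrakk>dtri C X Y Z f g h; dtri C X' Y' Z' f' g' h';
        u \<in> mor C X X'; v \<in> mor C Y Y'; v \<cdot> f = f' \<cdot> u\<rbrakk> \<Longrightarrow>
        \<exists>w \<in> mor C Z Z'. w \<cdot> g = g' \<cdot> v \<and> shift_mor C u \<cdot> h = h' \<cdot> w"
    and TR4:
      "\<lbrakk>f \<in> mor C X Y; g \<in> mor C Y Z;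
        dtri C X Y Z' f i i'; dtri C Y Z X' g j j'; dtri C X Z Y' (g \<cdot> f) k k'\<rbrakk> \<Longrightarrow>
        \<exists>u \<in> mor C Z' Y'. \<exists>v \<in> mor C Y' X'.
          dtri C Z' Y' X' u v (shift_mor C i \<cdot> j') \<and>
          u \<cdot> i = k \<cdot> g \<and> k' \<cdot> u = i' \<and> v \<cdot> k = j \<and> j' \<cdot> v = shift_mor C f \<cdot> k'"

text \<open>A full subcategory is given by its set of objects.\<close>

definition thick_subcategory :: "('k, 'o, 'm, 'z) triangulated_data_scheme \<Rightarrow> 'o set \<Rightarrow> bool"
  where "thick_subcategory C S \<longleftrightarrow>
    (\<forall>Z. zero_object C Z \<longrightarrow> Z \<in> S) \<and>
    (\<forall>X Y. X \<in> S \<and> isomorphic C X Y \<longrightarrow> Y \<in> S) \<and>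
    (\<forall>X. shift_ob C X \<in> S \<longleftrightarrow> X \<in> S) \<and>
    (\<forall>X Y Z f g h. dtri C X Y Z f g h \<and> X \<in> S \<and> Y \<in> S \<longrightarrow> Z \<in> S) \<and>
    (\<forall>X Y. X \<in> S \<and> direct_summand C Y X \<longrightarrow> Y \<in> S)"

definition thick :: "('k, 'o, 'm, 'z) triangulated_data_scheme \<Rightarrow> 'o \<Rightarrow> 'o set"
  where "thick C T = \<Inter> {S. thick_subcategory C S \<and> T \<in> S}"


section \<open>Silting objects\<close>

definition silting_ge :: "('k, 'o, 'm, 'z) triangulated_data_scheme \<Rightarrow> 'o \<Rightarrow> 'o \<Rightarrow> bool"
  where "silting_ge C M N \<longleftrightarrow>
    (\<forall>i>0. mor C M ((shift_ob C ^^ i) N) = {zero_mor C M ((shift_ob C ^^ i) N)})"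

definition presilting :: "('k, 'o, 'm, 'z) triangulated_data_scheme \<Rightarrow> 'o \<Rightarrow> bool"
  where "presilting C T \<longleftrightarrow>
    (\<forall>i>0. mor C T ((shift_ob C ^^ i) T) = {zero_mor C T ((shift_ob C ^^ i) T)})"

definition silting :: "('k, 'o, 'm, 'z) triangulated_data_scheme \<Rightarrow> 'o \<Rightarrow> bool"
  where "silting C T \<longleftrightarrow> presilting C T \<and> thick C T = UNIV"

definition partial_silting :: "('k, 'o, 'm, 'z) triangulated_data_scheme \<Rightarrow> 'o \<Rightarrow> bool"
  where "partial_silting C U \<longleftrightarrow> (\<exists>T. silting C T \<and> direct_summand C U T)"

end

theory Submission
  imports Defs
begin


text \<open>
  For a silting object \<open>V\<close> let \<open>below V\<close> be the class of all \<open>Z\<close> with \<open>V \<ge> Z\<close>. The theorem follows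
  from two facts about silting objects \<open>V \<ge> U\<close>.

  If also \<open>U \<ge> V\<close>, then \<open>V \<oplus> U\<close> is silting, so \<open>U\<close> is partial silting (\<open>partial_siltingI\<close>).

  If \<open>U \<ge> V\<close> fails, there is a silting object \<open>W \<ge> U\<close> with \<open>below W\<close> strictly smaller than \<open>below V\<close>
  (\<open>strict_mutation\<close>). Passing to one summand from each isomorphism class makes \<open>W\<close> basic without
  changing \<open>below W\<close>. As \<open>below W\<close> depends only on the isomorphism class of \<open>W\<close>, finiteness gives a
  basic \<open>V\<close> between \<open>T\<close> and \<open>U\<close> with minimal \<open>below V\<close>, and the first fact applies to it.
  Comparing the classes \<open>below V\<close> makes chains of mutations descend without the transitivity of \<open>\<ge>\<close>.

  For the second fact, write \<open>V\<close> again as \<open>T\<close>, a direct sum of objects with local endomorphism rings, and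
  let \<open>f : A \<rightarrow> U\<close> be a minimal right approximation of \<open>U\<close> by direct sums of summands of \<open>T\<close>. Let
  \<open>T \<rightarrow> B\<close> be a left approximation by direct sums of summands of \<open>A\<close>, with cone \<open>E\<close>. Long exact
  sequences show that \<open>W = A \<oplus> E\<close> is silting, that \<open>below W \<subseteq> below T\<close> and that \<open>W \<ge> U\<close>
  (\<open>mutation\<close>). If \<open>W \<ge> T\<close>, the triangle splits, \<open>T\<close> is a retract of \<open>B\<close>, and every indecomposable
  summand of \<open>T\<close> occurs in \<open>A\<close>.

  It remains to see that this forces \<open>U \<ge> T\<close> (\<open>ge_T_if_all_summands_occur\<close>). Because \<open>T\<close> generates,
  \<open>Hom(U, Z[i]) = 0\<close> for all \<open>Z\<close> in \<open>below T\<close> once \<open>i > N\<close>. Suppose this holds for \<open>i > n\<close>, where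
  \<open>n > 0\<close>. A morphism \<open>U \<rightarrow> Y[n]\<close> with \<open>Y\<close> a summand of \<open>T\<close>, hence of \<open>A\<close>, becomes zero in \<open>U[n]\<close>, as
  \<open>U\<close> is presilting; so it comes from the cocone \<open>U'\<close> of \<open>f\<close>, and from there it lifts to an
  approximation of \<open>U'\<close>. As \<open>f\<close> is minimal, this writes it as a radical morphism between summands of
  \<open>T\<close> applied to morphisms \<open>U \<rightarrow> Y'[n]\<close> (\<open>radical_factorization\<close>). Thus the functor
  \<open>Hom(U, -[n])\<close> on the summands of \<open>T\<close> equals its own radical and vanishes by Nakayama's lemma
  (\<open>nakayama\<close>); then \<open>Hom(U, Z[n]) = 0\<close> for all \<open>Z\<close> in \<open>below T\<close>. Descending to \<open>n = 1\<close> gives \<open>U \<ge> T\<close>.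

  Minimal approximations and Nakayama's lemma both come from one statement on functors from a linear
  category to finite-dimensional vector spaces: in a minimal generating set, no relation has an
  invertible coefficient (\<open>ex_minimal_generating\<close>).
\<close>

section \<open>Hom groups, retracts and biproducts\<close>

lemma additive_map_finsum:
  assumes "abelian_group G" "abelian_group H"
    and closed: "\<And>x. x \<in> carrier G \<Longrightarrow> \<phi> x \<in> carrier H"
    and add: "\<And>x y. x \<in> carrier G \<Longrightarrow> y \<in> carrier G \<Longrightarrow> \<phi> (x \<oplus>\<^bsub>G\<^esub> y) = \<phi> x \<oplus>\<^bsub>H\<^esub> \<phi> y"
    and zero: "\<phi> \<zero>\<^bsub>G\<^esub> = \<zero>\<^bsub>H\<^esub>"
    and f: "f \<in> I \<rightarrow> carrier G"
  shows "\<phi> (\<Oplus>\<^bsub>G\<^esub>i\<in>I. f i) = (\<Oplus>\<^bsub>H\<^esub>i\<in>I. \<phi> (f i))"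
proof -
  interpret G: abelian_group G by fact
  interpret H: abelian_group H by fact
  show ?thesis using f
  proof (induction I rule: infinite_finite_induct)
    case (infinite A)
    then show ?case by (simp add: zero)
  next
    case empty
    then show ?case by (simp add: zero)
  next
    case (insert a A)
    then have fa: "f a \<in> carrier G" "f \<in> A \<rightarrow> carrier G" by auto
    then have "(\<lambda>i. \<phi> (f i)) \<in> A \<rightarrow> carrier H" using closed by blast
    then show ?case using insert fa closed
      by (simp add: G.finsum_insert H.finsum_insert add G.finsum_closed)
  qed
qed

definition Hom_zero :: "('k, 'o, 'm, 'z) linear_category_data_scheme \<Rightarrow> 'o \<Rightarrow> 'o \<Rightarrow> bool"
  where "Hom_zero C X Y \<longleftrightarrow> mor C X Y = {zero_mor C X Y}"

text \<open>A direct summand whose complement need not exist; the vanishing of Hom groups passes to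
  retracts.\<close>

definition retract :: "('k, 'o, 'm, 'z) linear_category_data_scheme \<Rightarrow> 'o \<Rightarrow> 'o \<Rightarrow> bool"
  where "retract C Y X \<longleftrightarrow> (\<exists>s \<in> mor C Y X. \<exists>r \<in> mor C X Y. r \<cdot>\<^bsub>C\<^esub> s = ident C Y)"

text \<open>A direct sum together with its structure morphisms. Arbitrary finite index sets make it possible
  to drop or select summands.\<close>

definition sum_diagram :: "('k, 'o, 'm, 'z) linear_category_data_scheme \<Rightarrow> 'i set \<Rightarrow> 'o \<Rightarrow>
    ('i \<Rightarrow> 'o) \<Rightarrow> ('i \<Rightarrow> 'm) \<Rightarrow> ('i \<Rightarrow> 'm) \<Rightarrow> bool"
  where "sum_diagram C I X Z i p \<longleftrightarrow> finite I \<and>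
    (\<forall>a\<in>I. i a \<in> mor C (Z a) X \<and> p a \<in> mor C X (Z a)) \<and>
    (\<forall>a\<in>I. \<forall>b\<in>I. p a \<cdot>\<^bsub>C\<^esub> i b = (if a = b then ident C (Z a) else zero_mor C (Z b) (Z a))) \<and>
    (\<Oplus>\<^bsub>HOM C X X\<^esub> a\<in>I. i a \<cdot>\<^bsub>C\<^esub> p a) = ident C X"

context linear_category
begin

lemma hom_abelian_group: "abelian_group (HOM C X Y)"
proof -
  interpret vectorspace K "HOM C X Y" by (rule hom_vectorspace)
  show ?thesis by unfold_locales
qed

sublocale hom: abelian_group "HOM C X Y" for X Y
  by (rule hom_abelian_group)

lemma comp_closed: "f \<in> mor C X Y \<Longrightarrow> g \<in> mor C Y Z \<Longrightarrow> g \<cdot> f \<in> mor C X Z"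
  using module_hom_closed[OF precomp_linear, of f X Y Z] by blast

lemma comp_add_left:
  "f \<in> mor C X Y \<Longrightarrow> g \<in> mor C Y Z \<Longrightarrow> g' \<in> mor C Y Z \<Longrightarrow>
    (g \<oplus>\<^bsub>HOM C Y Z\<^esub> g') \<cdot> f = g \<cdot> f \<oplus>\<^bsub>HOM C X Z\<^esub> g' \<cdot> f"
  using module_hom_add[OF precomp_linear, of f X Y g Z g'] by blast

lemma comp_add_right:
  "f \<in> mor C X Y \<Longrightarrow> f' \<in> mor C X Y \<Longrightarrow> g \<in> mor C Y Z \<Longrightarrow>
    g \<cdot> (f \<oplus>\<^bsub>HOM C X Y\<^esub> f') = g \<cdot> f \<oplus>\<^bsub>HOM C X Z\<^esub> g \<cdot> f'"
  using module_hom_add[OF postcomp_linear, of g Y Z f X f'] by blast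

lemma comp_zero_left:
  assumes "f \<in> mor C X Y" shows "zero_mor C Y Z \<cdot> f = zero_mor C X Z"
  using comp_add_left[OF assms, of "zero_mor C Y Z" Z "zero_mor C Y Z"]
    comp_closed[OF assms hom.zero_closed, of Z]
  by (metis hom.add.l_cancel_one' hom.l_zero hom.zero_closed)

lemma comp_zero_right:
  assumes "g \<in> mor C Y Z" shows "g \<cdot> zero_mor C X Y = zero_mor C X Z"
  using comp_add_right[of "zero_mor C X Y" X Y "zero_mor C X Y" g Z]
    comp_closed[OF hom.zero_closed assms, of X] assms
  by (metis hom.add.l_cancel_one' hom.l_zero hom.zero_closed)

lemma comp_minus_left:
  assumes "f \<in> mor C X Y" "g \<in> mor C Y Z"
  shows "(\<ominus>\<^bsub>HOM C Y Z\<^esub> g) \<cdot> f = \<ominus>\<^bsub>HOM C X Z\<^esub> (g \<cdot> f)"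
  using assms comp_add_left[of f X Y "\<ominus>\<^bsub>HOM C Y Z\<^esub> g" Z g]
  by (metis comp_closed comp_zero_left hom.a_inv_closed hom.l_neg hom.minus_equality)

lemma comp_minus_right:
  assumes "f \<in> mor C X Y" "g \<in> mor C Y Z"
  shows "g \<cdot> (\<ominus>\<^bsub>HOM C X Y\<^esub> f) = \<ominus>\<^bsub>HOM C X Z\<^esub> (g \<cdot> f)"
  using assms comp_add_right[of "\<ominus>\<^bsub>HOM C X Y\<^esub> f" X Y f g Z]
  by (metis comp_closed comp_zero_right hom.a_inv_closed hom.l_neg hom.minus_equality)

lemma comp_finsum_left:
  assumes "f \<in> mor C X Y" "\<And>a. a \<in> I \<Longrightarrow> g a \<in> mor C Y Z"
  shows "(\<Oplus>\<^bsub>HOM C Y Z\<^esub> a\<in>I. g a) \<cdot> f = (\<Oplus>\<^bsub>HOM C X Z\<^esub> a\<in>I. g a \<cdot> f)"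
  by (rule additive_map_finsum[OF hom_abelian_group hom_abelian_group,
        of _ _ "\<lambda>g. g \<cdot> f"])
    (use assms comp_closed comp_add_left comp_zero_left in auto)

lemma comp_finsum_right:
  assumes "g \<in> mor C Y Z" "\<And>a. a \<in> I \<Longrightarrow> f a \<in> mor C X Y"
  shows "g \<cdot> (\<Oplus>\<^bsub>HOM C X Y\<^esub> a\<in>I. f a) = (\<Oplus>\<^bsub>HOM C X Z\<^esub> a\<in>I. g \<cdot> f a)"
  by (rule additive_map_finsum[OF hom_abelian_group hom_abelian_group,
        of _ _ "\<lambda>f. g \<cdot> f"])
    (use assms comp_closed comp_add_right comp_zero_right in auto)

lemma Hom_zeroI: "(\<And>f. f \<in> mor C X Y \<Longrightarrow> f = zero_mor C X Y) \<Longrightarrow> Hom_zero C X Y"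
  unfolding Hom_zero_def using hom.zero_closed by blast

lemma Hom_zeroD: "Hom_zero C X Y \<Longrightarrow> f \<in> mor C X Y \<Longrightarrow> f = zero_mor C X Y"
  unfolding Hom_zero_def by blast

lemma retractE:
  assumes "retract C Y X"
  obtains s r where "s \<in> mor C Y X" "r \<in> mor C X Y" "r \<cdot> s = ident C Y"
  using assms unfolding retract_def by blast

lemma Hom_zero_retract_left:
  assumes "retract C Y X" "Hom_zero C X Z" shows "Hom_zero C Y Z"
proof (rule Hom_zeroI)
  fix f assume f: "f \<in> mor C Y Z"
  obtain s r where sr: "s \<in> mor C Y X" "r \<in> mor C X Y" "r \<cdot> s = ident C Y"
    using assms(1) by (rule retractE)
  have "f = (f \<cdot> r) \<cdot> s" using sr f by (metis comp_assoc ident_right)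
  also have "f \<cdot> r = zero_mor C X Z" using assms(2) comp_closed[OF sr(2) f] by (rule Hom_zeroD)
  finally show "f = zero_mor C Y Z" using comp_zero_left[OF sr(1)] by simp
qed

lemma Hom_zero_retract_right:
  assumes "retract C Y X" "Hom_zero C Z X" shows "Hom_zero C Z Y"
proof (rule Hom_zeroI)
  fix f assume f: "f \<in> mor C Z Y"
  obtain s r where sr: "s \<in> mor C Y X" "r \<in> mor C X Y" "r \<cdot> s = ident C Y"
    using assms(1) by (rule retractE)
  have "f = r \<cdot> (s \<cdot> f)" using sr f by (metis comp_assoc ident_left)
  also have "s \<cdot> f = zero_mor C Z X" using assms(2) comp_closed[OF f sr(1)] by (rule Hom_zeroD)
  finally show "f = zero_mor C Z Y" using comp_zero_right[OF sr(2)] by simp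
qed

lemma iso_morE:
  assumes "iso_mor C X Y f"
  obtains g where "f \<in> mor C X Y" "g \<in> mor C Y X" "g \<cdot> f = ident C X" "f \<cdot> g = ident C Y"
  using assms unfolding iso_mor_def by blast

lemma comp_cancel_middle:
  assumes "f \<in> mor C W X" "g \<in> mor C X Y" "g' \<in> mor C Y X" "h \<in> mor C X Z"
    and "g' \<cdot> g = ident C X"
  shows "(h \<cdot> g') \<cdot> (g \<cdot> f) = h \<cdot> f"
  using assms comp_assoc[OF comp_closed[OF assms(1,2)] assms(3,4)] comp_assoc[OF assms(1-3)]
  by (simp add: ident_left)

lemma iso_mor_comp:
  assumes "iso_mor C X Y f" "iso_mor C Y Z g" shows "iso_mor C X Z (g \<cdot> f)"
proof -
  obtain f' where f: "f \<in> mor C X Y" "f' \<in> mor C Y X" "f' \<cdot> f = ident C X" "f \<cdot> f' = ident C Y"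
    using assms(1) by (rule iso_morE)
  obtain g' where g: "g \<in> mor C Y Z" "g' \<in> mor C Z Y" "g' \<cdot> g = ident C Y" "g \<cdot> g' = ident C Z"
    using assms(2) by (rule iso_morE)
  have "(f' \<cdot> g') \<cdot> (g \<cdot> f) = ident C X"
    using comp_cancel_middle[OF f(1) g(1,2) f(2) g(3)] f(3) by simp
  moreover have "(g \<cdot> f) \<cdot> (f' \<cdot> g') = ident C Z"
    using comp_cancel_middle[OF g(2) f(2,1) g(1) f(4)] g(4) by simp
  ultimately show ?thesis
    unfolding iso_mor_def using comp_closed[OF f(1) g(1)] comp_closed[OF g(2) f(2)] by blast
qed

lemma iso_mor_ident: "iso_mor C X X (ident C X)"
  unfolding iso_mor_def using ident_closed[of X] ident_left[OF ident_closed[of X]] by blast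

lemma isomorphic_refl: "isomorphic C X X"
  unfolding isomorphic_def using iso_mor_ident by blast

lemma isomorphic_sym: "isomorphic C X Y \<Longrightarrow> isomorphic C Y X"
  unfolding isomorphic_def iso_mor_def by blast

lemma isomorphic_trans: "isomorphic C X Y \<Longrightarrow> isomorphic C Y Z \<Longrightarrow> isomorphic C X Z"
  unfolding isomorphic_def using iso_mor_comp by blast

lemma isomorphic_retract: "isomorphic C X Y \<Longrightarrow> retract C X Y"
  unfolding isomorphic_def iso_mor_def retract_def by blast

lemma biproduct_retract:
  assumes "biproduct C X Y Z" shows "retract C Y X" "retract C Z X"
  using assms unfolding biproduct_def retract_def by blast+

lemma biproduct_commute:
  assumes "biproduct C X Y Z" shows "biproduct C X Z Y"
proof -
  obtain i j p q where *: "i \<in> mor C Y X" "j \<in> mor C Z X" "p \<in> mor C X Y" "q \<in> mor C X Z"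
    "p \<cdot> i = ident C Y" "q \<cdot> j = ident C Z" "q \<cdot> i = zero_mor C Y Z" "p \<cdot> j = zero_mor C Z Y"
    "(i \<cdot> p) \<oplus>\<^bsub>HOM C X X\<^esub> (j \<cdot> q) = ident C X"
    using assms unfolding biproduct_def by blast
  have "(j \<cdot> q) \<oplus>\<^bsub>HOM C X X\<^esub> (i \<cdot> p) = ident C X"
    using * by (metis comp_closed hom.a_comm)
  then show ?thesis unfolding biproduct_def using * by blast
qed

lemma Hom_zero_biproduct_left:
  assumes "biproduct C X Y Z" "Hom_zero C Y W" "Hom_zero C Z W" shows "Hom_zero C X W"
proof (rule Hom_zeroI)
  fix f assume f: "f \<in> mor C X W"
  obtain i j p q where *: "i \<in> mor C Y X" "j \<in> mor C Z X" "p \<in> mor C X Y" "q \<in> mor C X Z"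
    "(i \<cdot> p) \<oplus>\<^bsub>HOM C X X\<^esub> (j \<cdot> q) = ident C X"
    using assms unfolding biproduct_def by blast
  have "f = f \<cdot> ((i \<cdot> p) \<oplus>\<^bsub>HOM C X X\<^esub> (j \<cdot> q))" using * f by (simp add: ident_right)
  also have "\<dots> = (f \<cdot> i) \<cdot> p \<oplus>\<^bsub>HOM C X W\<^esub> (f \<cdot> j) \<cdot> q"
    by (simp add: comp_add_right[OF comp_closed[OF *(3,1)] comp_closed[OF *(4,2)] f]
        comp_assoc[OF *(3,1) f] comp_assoc[OF *(4,2) f])
  also have "f \<cdot> i = zero_mor C Y W" using assms f * by (blast intro: Hom_zeroD comp_closed)
  also have "f \<cdot> j = zero_mor C Z W" using assms f * by (blast intro: Hom_zeroD comp_closed)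
  finally show "f = zero_mor C X W" using * by (simp add: comp_zero_left)
qed

lemma Hom_zero_biproduct_right:
  assumes "biproduct C X Y Z" "Hom_zero C W Y" "Hom_zero C W Z" shows "Hom_zero C W X"
proof (rule Hom_zeroI)
  fix f assume f: "f \<in> mor C W X"
  obtain i j p q where *: "i \<in> mor C Y X" "j \<in> mor C Z X" "p \<in> mor C X Y" "q \<in> mor C X Z"
    "(i \<cdot> p) \<oplus>\<^bsub>HOM C X X\<^esub> (j \<cdot> q) = ident C X"
    using assms unfolding biproduct_def by blast
  have "f = ((i \<cdot> p) \<oplus>\<^bsub>HOM C X X\<^esub> (j \<cdot> q)) \<cdot> f" using * f by (simp add: ident_left)
  also have "\<dots> = i \<cdot> (p \<cdot> f) \<oplus>\<^bsub>HOM C W X\<^esub> j \<cdot> (q \<cdot> f)"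
    by (simp add: comp_add_left[OF f comp_closed[OF *(3,1)] comp_closed[OF *(4,2)]]
        comp_assoc[OF f *(3,1)] comp_assoc[OF f *(4,2)])
  also have "p \<cdot> f = zero_mor C W Y" using assms f * by (blast intro: Hom_zeroD comp_closed)
  also have "q \<cdot> f = zero_mor C W Z" using assms f * by (blast intro: Hom_zeroD comp_closed)
  finally show "f = zero_mor C W X" using * by (simp add: comp_zero_right)
qed

end

section \<open>Finite direct sums\<close>

context linear_category
begin

lemma direct_sum_diagram:
  assumes "direct_sum C X Y n" obtains i p where "sum_diagram C {..<n} X Y i p"
proof -
  obtain i p where "(\<forall>a<n. i a \<in> mor C (Y a) X \<and> p a \<in> mor C X (Y a)) \<and>
      (\<forall>a<n. \<forall>b<n. p a \<cdot>\<^bsub>C\<^esub> i b = (if a = b then ident C (Y a) else zero_mor C (Y b) (Y a))) \<and>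
      (\<Oplus>\<^bsub>HOM C X X\<^esub> a\<in>{..<n}. i a \<cdot>\<^bsub>C\<^esub> p a) = ident C X"
    using assms unfolding direct_sum_def by blast
  then have "sum_diagram C {..<n} X Y i p" unfolding sum_diagram_def by simp
  then show thesis by (rule that)
qed

lemma sum_diagramD:
  assumes "sum_diagram C I X Z i p"
  shows "finite I" "a \<in> I \<Longrightarrow> i a \<in> mor C (Z a) X" "a \<in> I \<Longrightarrow> p a \<in> mor C X (Z a)"
    "a \<in> I \<Longrightarrow> p a \<cdot> i a = ident C (Z a)"
    "a \<in> I \<Longrightarrow> b \<in> I \<Longrightarrow> a \<noteq> b \<Longrightarrow> p a \<cdot> i b = zero_mor C (Z b) (Z a)"
    "(\<Oplus>\<^bsub>HOM C X X\<^esub> a\<in>I. i a \<cdot> p a) = ident C X"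
  using assms unfolding sum_diagram_def by auto

lemma sum_diagram_retract: "sum_diagram C I X Z i p \<Longrightarrow> a \<in> I \<Longrightarrow> retract C (Z a) X"
  unfolding retract_def by (meson sum_diagramD)

lemma sum_diagram_expand_to:
  assumes "sum_diagram C I X Z i p" "f \<in> mor C W X"
  shows "f = (\<Oplus>\<^bsub>HOM C W X\<^esub> a\<in>I. i a \<cdot> (p a \<cdot> f))"
proof -
  note D = sum_diagramD[OF assms(1)]
  have "f = (\<Oplus>\<^bsub>HOM C X X\<^esub> a\<in>I. i a \<cdot> p a) \<cdot> f" using D(6) assms(2) by (simp add: ident_left)
  also have "\<dots> = (\<Oplus>\<^bsub>HOM C W X\<^esub> a\<in>I. (i a \<cdot> p a) \<cdot> f)"
    by (rule comp_finsum_left[OF assms(2) comp_closed[OF D(3,2)]])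
  also have "\<dots> = (\<Oplus>\<^bsub>HOM C W X\<^esub> a\<in>I. i a \<cdot> (p a \<cdot> f))"
    using comp_assoc[OF assms(2) D(3,2)] comp_closed[OF comp_closed[OF assms(2) D(3)] D(2)]
    by (intro hom.finsum_cong') auto
  finally show ?thesis .
qed

lemma sum_diagram_expand_from:
  assumes "sum_diagram C I X Z i p" "f \<in> mor C X W"
  shows "f = (\<Oplus>\<^bsub>HOM C X W\<^esub> a\<in>I. (f \<cdot> i a) \<cdot> p a)"
proof -
  note D = sum_diagramD[OF assms(1)]
  have "f = f \<cdot> (\<Oplus>\<^bsub>HOM C X X\<^esub> a\<in>I. i a \<cdot> p a)" using D(6) assms(2) by (simp add: ident_right)
  also have "\<dots> = (\<Oplus>\<^bsub>HOM C X W\<^esub> a\<in>I. f \<cdot> (i a \<cdot> p a))"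
    by (rule comp_finsum_right[OF assms(2) comp_closed[OF D(3,2)]])
  also have "\<dots> = (\<Oplus>\<^bsub>HOM C X W\<^esub> a\<in>I. (f \<cdot> i a) \<cdot> p a)"
    using comp_assoc[OF D(3,2) assms(2)] comp_closed[OF D(3) comp_closed[OF D(2) assms(2)]]
    by (intro hom.finsum_cong') auto
  finally show ?thesis .
qed

lemma Hom_zero_sum_left:
  assumes "sum_diagram C I X Z i p" "\<And>a. a \<in> I \<Longrightarrow> Hom_zero C (Z a) W"
  shows "Hom_zero C X W"
proof (rule Hom_zeroI)
  fix f assume f: "f \<in> mor C X W"
  note D = sum_diagramD[OF assms(1)]
  have "f = (\<Oplus>\<^bsub>HOM C X W\<^esub> a\<in>I. (f \<cdot> i a) \<cdot> p a)"
    by (rule sum_diagram_expand_from[OF assms(1) f])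
  also have "\<dots> = (\<Oplus>\<^bsub>HOM C X W\<^esub> a\<in>I. zero_mor C X W)"
  proof (rule hom.finsum_cong')
    fix a assume a: "a \<in> I"
    have "f \<cdot> i a = zero_mor C (Z a) W"
      by (rule Hom_zeroD[OF assms(2)[OF a] comp_closed[OF D(2)[OF a] f]])
    then show "(f \<cdot> i a) \<cdot> p a = zero_mor C X W" using comp_zero_left[OF D(3)[OF a]] by simp
  qed auto
  finally show "f = zero_mor C X W" by simp
qed

lemma Hom_zero_sum_right:
  assumes "sum_diagram C I X Z i p" "\<And>a. a \<in> I \<Longrightarrow> Hom_zero C W (Z a)"
  shows "Hom_zero C W X"
proof (rule Hom_zeroI)
  fix f assume f: "f \<in> mor C W X"
  note D = sum_diagramD[OF assms(1)]
  have "f = (\<Oplus>\<^bsub>HOM C W X\<^esub> a\<in>I. i a \<cdot> (p a \<cdot> f))"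
    by (rule sum_diagram_expand_to[OF assms(1) f])
  also have "\<dots> = (\<Oplus>\<^bsub>HOM C W X\<^esub> a\<in>I. zero_mor C W X)"
  proof (rule hom.finsum_cong')
    fix a assume a: "a \<in> I"
    have "p a \<cdot> f = zero_mor C W (Z a)"
      by (rule Hom_zeroD[OF assms(2)[OF a] comp_closed[OF f D(3)[OF a]]])
    then show "i a \<cdot> (p a \<cdot> f) = zero_mor C W X" using comp_zero_right[OF D(2)[OF a]] by simp
  qed auto
  finally show "f = zero_mor C W X" by simp
qed

lemma sum_diagram_copair:
  assumes S: "sum_diagram C I X Z i p" and g: "\<And>a. a \<in> I \<Longrightarrow> g a \<in> mor C (Z a) W"
  obtains f where "f \<in> mor C X W" "\<And>a. a \<in> I \<Longrightarrow> f \<cdot> i a = g a"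
proof -
  note D = sum_diagramD[OF S]
  define f where "f = (\<Oplus>\<^bsub>HOM C X W\<^esub> a\<in>I. g a \<cdot> p a)"
  have gp: "a \<in> I \<Longrightarrow> g a \<cdot> p a \<in> mor C X W" for a by (rule comp_closed[OF D(3) g])
  have "f \<in> mor C X W" unfolding f_def using gp by (intro hom.finsum_closed) auto
  moreover have "f \<cdot> i b = g b" if b: "b \<in> I" for b
  proof -
    have "f \<cdot> i b = (\<Oplus>\<^bsub>HOM C (Z b) W\<^esub> a\<in>I. (g a \<cdot> p a) \<cdot> i b)"
      unfolding f_def using D b gp by (intro comp_finsum_left) auto
    also have "\<dots> = (\<Oplus>\<^bsub>HOM C (Z b) W\<^esub> a\<in>I. if b = a then g b else zero_mor C (Z b) W)"
    proof (rule hom.finsum_cong')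
      fix a assume a: "a \<in> I"
      have "(g a \<cdot> p a) \<cdot> i b = g a \<cdot> (p a \<cdot> i b)"
        using D a b g by (intro comp_assoc) auto
      also have "\<dots> = (if b = a then g b else zero_mor C (Z b) W)"
        using D(4)[OF b] D(5)[OF a b] g[OF a] g[OF b] comp_zero_right ident_right by auto
      finally show "(g a \<cdot> p a) \<cdot> i b = (if b = a then g b else zero_mor C (Z b) W)" .
    qed (use g b in auto)
    also have "\<dots> = g b"
      using hom.add.finprod_singleton[OF b D(1), of "\<lambda>_. g b" "Z b" W] g[OF b] by simp
    finally show ?thesis .
  qed
  ultimately show thesis by (rule that)
qed

lemma sum_diagram_pair:
  assumes S: "sum_diagram C I X Z i p" and g: "\<And>a. a \<in> I \<Longrightarrow> g a \<in> mor C W (Z a)"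
  obtains f where "f \<in> mor C W X" "\<And>a. a \<in> I \<Longrightarrow> p a \<cdot> f = g a"
proof -
  note D = sum_diagramD[OF S]
  define f where "f = (\<Oplus>\<^bsub>HOM C W X\<^esub> a\<in>I. i a \<cdot> g a)"
  have gp: "a \<in> I \<Longrightarrow> i a \<cdot> g a \<in> mor C W X" for a by (rule comp_closed[OF g D(2)])
  have "f \<in> mor C W X" unfolding f_def using gp by (intro hom.finsum_closed) auto
  moreover have "p b \<cdot> f = g b" if b: "b \<in> I" for b
  proof -
    have "p b \<cdot> f = (\<Oplus>\<^bsub>HOM C W (Z b)\<^esub> a\<in>I. p b \<cdot> (i a \<cdot> g a))"
      unfolding f_def using D b gp by (intro comp_finsum_right) auto
    also have "\<dots> = (\<Oplus>\<^bsub>HOM C W (Z b)\<^esub> a\<in>I. if b = a then g b else zero_mor C W (Z b))"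
    proof (rule hom.finsum_cong')
      fix a assume a: "a \<in> I"
      have "p b \<cdot> (i a \<cdot> g a) = (p b \<cdot> i a) \<cdot> g a"
        using D a b g by (intro comp_assoc[symmetric]) auto
      also have "\<dots> = (if b = a then g b else zero_mor C W (Z b))"
        using D(4)[OF b] D(5)[OF b a] g[OF a] g[OF b] comp_zero_left ident_left by auto
      finally show "p b \<cdot> (i a \<cdot> g a) = (if b = a then g b else zero_mor C W (Z b))" .
    qed (use g b in auto)
    also have "\<dots> = g b"
      using hom.add.finprod_singleton[OF b D(1), of "\<lambda>_. g b" W "Z b"] g[OF b] by simp
    finally show ?thesis .
  qed
  ultimately show thesis by (rule that)
qed

lemma sum_diagram_eq_from:
  assumes S: "sum_diagram C I X Z i p" and "f \<in> mor C X W" "g \<in> mor C X W"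
    and "\<And>a. a \<in> I \<Longrightarrow> f \<cdot> i a = g \<cdot> i a"
  shows "f = g"
proof -
  note D = sum_diagramD[OF S]
  have "(\<Oplus>\<^bsub>HOM C X W\<^esub> a\<in>I. (f \<cdot> i a) \<cdot> p a) = (\<Oplus>\<^bsub>HOM C X W\<^esub> a\<in>I. (g \<cdot> i a) \<cdot> p a)"
    using assms(4) comp_closed[OF D(3) comp_closed[OF D(2) assms(3)]]
    by (intro hom.finsum_cong') auto
  then show ?thesis
    unfolding sum_diagram_expand_from[OF S assms(2), symmetric] sum_diagram_expand_from[OF S assms(3), symmetric] .
qed

lemma sum_diagram_eq_to:
  assumes S: "sum_diagram C I X Z i p" and "f \<in> mor C W X" "g \<in> mor C W X"
    and "\<And>a. a \<in> I \<Longrightarrow> p a \<cdot> f = p a \<cdot> g"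
  shows "f = g"
proof -
  note D = sum_diagramD[OF S]
  have "(\<Oplus>\<^bsub>HOM C W X\<^esub> a\<in>I. i a \<cdot> (p a \<cdot> f)) = (\<Oplus>\<^bsub>HOM C W X\<^esub> a\<in>I. i a \<cdot> (p a \<cdot> g))"
    using assms(4) comp_closed[OF comp_closed[OF assms(3) D(3)] D(2)]
    by (intro hom.finsum_cong') auto
  then show ?thesis
    unfolding sum_diagram_expand_to[OF S assms(2), symmetric] sum_diagram_expand_to[OF S assms(3), symmetric] .
qed

lemma sum_diagram_unique:
  assumes S: "sum_diagram C I X Z i p" and S': "sum_diagram C I X' Z i' p'"
  shows "isomorphic C X X'"
proof -
  note D = sum_diagramD[OF S] and D' = sum_diagramD[OF S']
  obtain f where f: "f \<in> mor C X X'" "\<And>a. a \<in> I \<Longrightarrow> f \<cdot> i a = i' a"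
    using sum_diagram_copair[OF S, of i' X'] D' by blast
  obtain g where g: "g \<in> mor C X' X" "\<And>a. a \<in> I \<Longrightarrow> g \<cdot> i' a = i a"
    using sum_diagram_copair[OF S', of i X] D by blast
  have "g \<cdot> f = ident C X"
  proof (rule sum_diagram_eq_from[OF S comp_closed[OF f(1) g(1)] ident_closed])
    fix a assume a: "a \<in> I"
    show "(g \<cdot> f) \<cdot> i a = ident C X \<cdot> i a"
      using comp_assoc[OF D(2)[OF a] f(1) g(1)] f(2)[OF a] g(2)[OF a] ident_left[OF D(2)[OF a]] by simp
  qed
  moreover have "f \<cdot> g = ident C X'"
  proof (rule sum_diagram_eq_from[OF S' comp_closed[OF g(1) f(1)] ident_closed])
    fix a assume a: "a \<in> I"
    show "(f \<cdot> g) \<cdot> i' a = ident C X' \<cdot> i' a"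
      using comp_assoc[OF D'(2)[OF a] g(1) f(1)] f(2)[OF a] g(2)[OF a] ident_left[OF D'(2)[OF a]] by simp
  qed
  ultimately show ?thesis unfolding isomorphic_def iso_mor_def using f g by blast
qed

end

context linear_category
begin

lemma sum_diagram_insert:
  assumes S: "sum_diagram C I X Z i p" and W: "biproduct C W (Z b) X" and b: "b \<notin> I"
  shows "\<exists>i' p'. sum_diagram C (insert b I) W Z i' p'"
proof -
  note D = sum_diagramD[OF S]
  from W obtain j k q r where *: "j \<in> mor C (Z b) W" "k \<in> mor C X W" "q \<in> mor C W (Z b)" "r \<in> mor C W X"
    "q \<cdot> j = ident C (Z b)" "r \<cdot> k = ident C X" "r \<cdot> j = zero_mor C (Z b) X" "q \<cdot> k = zero_mor C X (Z b)"
    "(j \<cdot> q) \<oplus>\<^bsub>HOM C W W\<^esub> (k \<cdot> r) = ident C W"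
    unfolding biproduct_def by blast
  define i' where "i' a = (if a = b then j else k \<cdot> i a)" for a
  define p' where "p' a = (if a = b then q else p a \<cdot> r)" for a
  have nb: "a \<in> I \<Longrightarrow> a \<noteq> b" for a using b by auto
  have cl: "i' a \<in> mor C (Z a) W" "p' a \<in> mor C W (Z a)" if "a \<in> insert b I" for a
    using that nb *(1,3) comp_closed[OF D(2) *(2)] comp_closed[OF *(4) D(3)]
    by (auto simp: i'_def p'_def)
  have pi: "p' a \<cdot> i' c = (if a = c then ident C (Z a) else zero_mor C (Z c) (Z a))"
    if ac: "a \<in> insert b I" "c \<in> insert b I" for a c
  proof (cases "a = b")
    case a: True
    show ?thesis
    proof (cases "c = b")
      case False
      then have c: "c \<in> I" using ac by auto
      have "q \<cdot> (k \<cdot> i c) = (q \<cdot> k) \<cdot> i c"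
        using comp_assoc[OF D(2)[OF c] *(2,3)] by simp
      also have "\<dots> = zero_mor C (Z c) (Z b)" using * comp_zero_left[OF D(2)[OF c]] by simp
      finally show ?thesis using a False by (simp add: i'_def p'_def)
    qed (use a * in \<open>simp add: i'_def p'_def\<close>)
  next
    case False
    then have a: "a \<in> I" using ac by auto
    show ?thesis
    proof (cases "c = b")
      case True
      have "(p a \<cdot> r) \<cdot> j = p a \<cdot> (r \<cdot> j)" by (rule comp_assoc[OF *(1,4) D(3)[OF a]])
      also have "\<dots> = zero_mor C (Z b) (Z a)" using * comp_zero_right[OF D(3)[OF a]] by simp
      finally show ?thesis using a False True by (simp add: i'_def p'_def)
    next
      case cb: False
      then have c: "c \<in> I" using ac by auto
      have "(p a \<cdot> r) \<cdot> (k \<cdot> i c) = p a \<cdot> (r \<cdot> (k \<cdot> i c))"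
        by (rule comp_assoc[OF comp_closed[OF D(2)[OF c] *(2)] *(4) D(3)[OF a]])
      also have "r \<cdot> (k \<cdot> i c) = i c"
        using comp_assoc[OF D(2)[OF c] *(2,4)] *(6) ident_left[OF D(2)[OF c]] by simp
      finally show ?thesis using a c False cb D(4)[OF a] D(5)[OF a c] by (auto simp: i'_def p'_def)
    qed
  qed
  have "(\<Oplus>\<^bsub>HOM C W W\<^esub> a\<in>insert b I. i' a \<cdot> p' a)
      = i' b \<cdot> p' b \<oplus>\<^bsub>HOM C W W\<^esub> (\<Oplus>\<^bsub>HOM C W W\<^esub> a\<in>I. i' a \<cdot> p' a)"
    using D(1) b cl comp_closed[OF cl(2) cl(1)] by (intro hom.finsum_insert) auto
  also have "(\<Oplus>\<^bsub>HOM C W W\<^esub> a\<in>I. i' a \<cdot> p' a) = (\<Oplus>\<^bsub>HOM C W W\<^esub> a\<in>I. k \<cdot> (i a \<cdot> (p a \<cdot> r)))"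
  proof (rule hom.finsum_cong')
    fix a assume a: "a \<in> I"
    have "(k \<cdot> i a) \<cdot> (p a \<cdot> r) = k \<cdot> (i a \<cdot> (p a \<cdot> r))"
      by (rule comp_assoc[OF comp_closed[OF *(4) D(3)[OF a]] D(2)[OF a] *(2)])
    then show "i' a \<cdot> p' a = k \<cdot> (i a \<cdot> (p a \<cdot> r))" using nb[OF a] by (simp add: i'_def p'_def)
  qed (use comp_closed[OF comp_closed[OF comp_closed[OF *(4) D(3)] D(2)] *(2)] in auto)
  also have "\<dots> = k \<cdot> (\<Oplus>\<^bsub>HOM C W X\<^esub> a\<in>I. i a \<cdot> (p a \<cdot> r))"
    by (rule comp_finsum_right[OF *(2) comp_closed[OF comp_closed[OF *(4) D(3)] D(2)], symmetric])
  also have "(\<Oplus>\<^bsub>HOM C W X\<^esub> a\<in>I. i a \<cdot> (p a \<cdot> r)) = r"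
    by (rule sum_diagram_expand_to[OF S *(4), symmetric])
  finally have "(\<Oplus>\<^bsub>HOM C W W\<^esub> a\<in>insert b I. i' a \<cdot> p' a) = ident C W"
    using * by (simp add: i'_def p'_def)
  then have "sum_diagram C (insert b I) W Z i' p'"
    unfolding sum_diagram_def using cl pi D(1) by simp
  then show ?thesis by blast
qed

end

context additive_linear_category
begin

text \<open>Membership in a class of objects closed under biproducts is carried along, because direct
  sums of members of a thick subcategory are formed here.\<close>

lemma ex_sum_diagram:
  assumes "finite I" and zero: "\<And>Z. zero_object C Z \<Longrightarrow> Z \<in> S"
    and bip: "\<And>X Y Z. biproduct C X Y Z \<Longrightarrow> Y \<in> S \<Longrightarrow> Z \<in> S \<Longrightarrow> X \<in> S"
    and "\<And>a. a \<in> I \<Longrightarrow> Z a \<in> S"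
  shows "\<exists>X\<in>S. \<exists>i p. sum_diagram C I X Z i p"
  using assms(1,4)
proof (induction I)
  case empty
  obtain X where X: "zero_object C X" using ex_zero_object by blast
  then have "mor C X X = {zero_mor C X X}" unfolding zero_object_def by simp
  then have "ident C X = zero_mor C X X" using ident_closed[of X] by simp
  then have "sum_diagram C {} X Z undefined undefined" unfolding sum_diagram_def by simp
  then show ?case using zero[OF X] by blast
next
  case (insert b I)
  have "\<exists>X\<in>S. \<exists>i p. sum_diagram C I X Z i p" by (rule insert.IH) (simp add: insert.prems)
  then obtain X i p where X: "X \<in> S" and S: "sum_diagram C I X Z i p" by blast
  obtain W where W: "biproduct C W (Z b) X" using ex_biproduct by blast
  have "W \<in> S" using bip[OF W] X insert.prems by simp
  then show ?case using sum_diagram_insert[OF S W insert.hyps(2)] by blast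
qed

lemma ex_sum: "finite I \<Longrightarrow> \<exists>X i p. sum_diagram C I X Z i p"
  using ex_sum_diagram[of I UNIV Z] by auto

lemma sum_diagram_direct_summand:
  assumes S: "sum_diagram C I X Z i p" and b: "b \<in> I"
  obtains X' where "isomorphic C X X'" "direct_summand C (Z b) X'"
proof -
  obtain W j q where W: "sum_diagram C (I - {b}) W Z j q"
    using ex_sum[of "I - {b}"] sum_diagramD(1)[OF S] by blast
  obtain X' where X': "biproduct C X' (Z b) W" using ex_biproduct by blast
  obtain j' q' where "sum_diagram C (insert b (I - {b})) X' Z j' q'"
    using sum_diagram_insert[OF W X'] by blast
  moreover have "insert b (I - {b}) = I" using b by blast
  ultimately have "isomorphic C X X'" using sum_diagram_unique[OF S] by simp
  then show thesis using that X' unfolding direct_summand_def by blast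
qed

end


section \<open>Local objects\<close>

context linear_category
begin

lemma End_ring_simps:
  "carrier (End_ring C X) = mor C X X" "mult (End_ring C X) = comp C"
  "one (End_ring C X) = ident C X" "zero (End_ring C X) = zero_mor C X X"
  "add (End_ring C X) = add (HOM C X X)"
  by (simp_all add: End_ring_def)

lemma End_ring_Units: "a \<in> Units (End_ring C X) \<longleftrightarrow> iso_mor C X X a"
  unfolding Units_def iso_mor_def End_ring_simps by blast

lemma local_ident_nonzero: "local_ring (End_ring C Y) \<Longrightarrow> ident C Y \<noteq> zero_mor C Y Y"
  unfolding local_ring_def End_ring_simps by blast

lemma local_noniso_add:
  assumes "local_ring (End_ring C Y)" "a \<in> mor C Y Y" "b \<in> mor C Y Y"
    "\<not> iso_mor C Y Y a" "\<not> iso_mor C Y Y b"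
  shows "\<not> iso_mor C Y Y (a \<oplus>\<^bsub>HOM C Y Y\<^esub> b)"
  using assms unfolding local_ring_def End_ring_simps by (simp add: End_ring_Units)

lemma local_zero_noniso:
  assumes "local_ring (End_ring C Y)" shows "\<not> iso_mor C Y Y (zero_mor C Y Y)"
proof
  assume "iso_mor C Y Y (zero_mor C Y Y)"
  then obtain g where "g \<in> mor C Y Y" "g \<cdot> zero_mor C Y Y = ident C Y" by (rule iso_morE)
  then show False using local_ident_nonzero[OF assms] comp_zero_right[of g Y Y Y] by simp
qed

lemma local_noniso_finsum:
  assumes "local_ring (End_ring C Y)"
    and "\<And>a. a \<in> I \<Longrightarrow> f a \<in> mor C Y Y" "\<And>a. a \<in> I \<Longrightarrow> \<not> iso_mor C Y Y (f a)"
  shows "\<not> iso_mor C Y Y (\<Oplus>\<^bsub>HOM C Y Y\<^esub> a\<in>I. f a)"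
  using assms(2,3)
proof (induction I rule: infinite_finite_induct)
  case (infinite A)
  then show ?case using local_zero_noniso[OF assms(1)] by simp
next
  case empty
  then show ?case using local_zero_noniso[OF assms(1)] by simp
next
  case (insert a A)
  have "(\<Oplus>\<^bsub>HOM C Y Y\<^esub> a\<in>insert a A. f a) = f a \<oplus>\<^bsub>HOM C Y Y\<^esub> (\<Oplus>\<^bsub>HOM C Y Y\<^esub> a\<in>A. f a)"
    using insert.hyps insert.prems(1) by (intro hom.finsum_insert) auto
  moreover have "(\<Oplus>\<^bsub>HOM C Y Y\<^esub> a\<in>A. f a) \<in> mor C Y Y"
    using insert.prems(1) by (intro hom.finsum_closed) auto
  ultimately show ?case using local_noniso_add[OF assms(1)] insert by simp
qed

lemma local_idempotent:
  assumes "local_ring (End_ring C Y)" and e: "e \<in> mor C Y Y" "e \<cdot> e = e"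
  shows "e = ident C Y \<or> e = zero_mor C Y Y"
proof -
  define d where "d = ident C Y \<oplus>\<^bsub>HOM C Y Y\<^esub> (\<ominus>\<^bsub>HOM C Y Y\<^esub> e)"
  have d: "d \<in> mor C Y Y" unfolding d_def using ident_closed e by simp
  have "e \<oplus>\<^bsub>HOM C Y Y\<^esub> d = ident C Y"
    unfolding d_def using e(1) ident_closed[of Y]
    by (metis hom.a_inv_closed hom.a_lcomm hom.r_neg hom.r_zero)
  then consider "iso_mor C Y Y e" | "iso_mor C Y Y d"
    using local_noniso_add[OF assms(1) e(1) d] iso_mor_ident[of Y] by auto
  then show ?thesis
  proof cases
    case 1
    then obtain u where u: "u \<in> mor C Y Y" "u \<cdot> e = ident C Y" by (rule iso_morE)
    have "e = (u \<cdot> e) \<cdot> e" using u e by (simp add: ident_left)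
    also have "\<dots> = u \<cdot> e" using comp_assoc[OF e(1) e(1) u(1)] e(2) by simp
    finally show ?thesis using u by simp
  next
    case 2
    then obtain u where u: "u \<in> mor C Y Y" "u \<cdot> d = ident C Y" by (rule iso_morE)
    have "d \<cdot> e = e \<oplus>\<^bsub>HOM C Y Y\<^esub> (\<ominus>\<^bsub>HOM C Y Y\<^esub> e)"
      unfolding d_def using e ident_closed[of Y]
      by (simp add: comp_add_left[of e Y Y _ Y] comp_minus_left[OF e(1) e(1)] ident_left)
    then have de: "d \<cdot> e = zero_mor C Y Y" using e by (simp add: hom.r_neg)
    have "e = (u \<cdot> d) \<cdot> e" using u e by (simp add: ident_left)
    also have "\<dots> = zero_mor C Y Y" using comp_assoc[OF e(1) d u(1)] de comp_zero_right[OF u(1)] by simp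
    finally show ?thesis by simp
  qed
qed

text \<open>The idempotent \<open>s \<cdot> r\<close> of the local endomorphism ring of \<open>Z\<close> cannot vanish, since then
  \<open>ident C Y = r \<cdot> (s \<cdot> r) \<cdot> s\<close> would vanish too.\<close>

lemma split_mono_local_iso:
  assumes Y: "local_ring (End_ring C Y)" and Z: "local_ring (End_ring C Z)"
    and s: "s \<in> mor C Y Z" and r: "r \<in> mor C Z Y" and rs: "r \<cdot> s = ident C Y"
  shows "iso_mor C Y Z s" "iso_mor C Z Y r"
proof -
  have sr: "s \<cdot> r \<in> mor C Z Z" by (rule comp_closed[OF r s])
  have *: "(s \<cdot> r) \<cdot> s = s" using comp_assoc[OF s r s] rs ident_right[OF s] by simp
  have "(s \<cdot> r) \<cdot> (s \<cdot> r) = s \<cdot> r" using comp_assoc[OF r s sr] * by simp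
  then have "s \<cdot> r = ident C Z \<or> s \<cdot> r = zero_mor C Z Z" by (rule local_idempotent[OF Z sr])
  moreover have False if "s \<cdot> r = zero_mor C Z Z"
  proof -
    have "s = zero_mor C Y Z" using * that comp_zero_left[OF s] by simp
    then have "ident C Y = zero_mor C Y Y" using rs comp_zero_right[OF r] by simp
    then show False using local_ident_nonzero[OF Y] by simp
  qed
  ultimately have "s \<cdot> r = ident C Z" by blast
  then show "iso_mor C Y Z s" "iso_mor C Z Y r" unfolding iso_mor_def using s r rs by blast+
qed

lemma iso_comp_local:
  assumes loc: "local_ring (End_ring C X)" "local_ring (End_ring C Y)"
    and f: "f \<in> mor C X Y" and g: "g \<in> mor C Y W" and iso: "iso_mor C X W (g \<cdot> f)"
  shows "iso_mor C X Y f"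
proof -
  obtain v where v: "v \<in> mor C W X" "v \<cdot> (g \<cdot> f) = ident C X"
    using iso by (rule iso_morE)
  have "(v \<cdot> g) \<cdot> f = ident C X" using comp_assoc[OF f g v(1)] v(2) by simp
  then show ?thesis by (rule split_mono_local_iso(1)[OF loc f comp_closed[OF g v(1)]])
qed

end

section \<open>Minimal generating sets of modules over a linear category\<close>

text \<open>A linear functor to vector spaces. The instances of interest are the representable functors
  \<open>Hom(T, -)\<close>, their shifts, and, over the opposite category, \<open>Hom(-, U)\<close>.\<close>

locale cat_module = linear_category K C
  for K :: "'k ring" and C :: "('k, 'o, 'm, 'z) linear_category_data_scheme" (structure) +
  fixes M :: "'o \<Rightarrow> ('k, 'v) module" and act :: "'m \<Rightarrow> 'v \<Rightarrow> 'v"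
  assumes M_vectorspace: "vectorspace K (M X)"
    and act_closed: "c \<in> mor C X Y \<Longrightarrow> x \<in> carrier (M X) \<Longrightarrow> act c x \<in> carrier (M Y)"
    and act_add_left: "c \<in> mor C X Y \<Longrightarrow> c' \<in> mor C X Y \<Longrightarrow> x \<in> carrier (M X) \<Longrightarrow>
      act (c \<oplus>\<^bsub>HOM C X Y\<^esub> c') x = act c x \<oplus>\<^bsub>M Y\<^esub> act c' x"
    and act_add_right: "c \<in> mor C X Y \<Longrightarrow> x \<in> carrier (M X) \<Longrightarrow> x' \<in> carrier (M X) \<Longrightarrow>
      act c (x \<oplus>\<^bsub>M X\<^esub> x') = act c x \<oplus>\<^bsub>M Y\<^esub> act c x'"
    and act_scalar: "k \<in> carrier K \<Longrightarrow> x \<in> carrier (M X) \<Longrightarrow>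
      act (k \<odot>\<^bsub>HOM C X X\<^esub> ident C X) x = k \<odot>\<^bsub>M X\<^esub> x"
    and act_comp: "c \<in> mor C X Y \<Longrightarrow> d \<in> mor C Y Z \<Longrightarrow> x \<in> carrier (M X) \<Longrightarrow>
      act (d \<cdot> c) x = act d (act c x)"
begin

lemma M_abelian_group: "abelian_group (M X)"
proof -
  interpret vectorspace K "M X" by (rule M_vectorspace)
  show ?thesis by unfold_locales
qed

sublocale M: abelian_group "M X" for X
  by (rule M_abelian_group)

lemma act_zero_left:
  assumes "x \<in> carrier (M X)" shows "act (zero_mor C X Y) x = \<zero>\<^bsub>M Y\<^esub>"
  using act_add_left[OF hom.zero_closed hom.zero_closed assms, of Y]
    act_closed[OF hom.zero_closed assms, of Y] by simp

lemma act_zero_right: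
  assumes "c \<in> mor C X Y" shows "act c \<zero>\<^bsub>M X\<^esub> = \<zero>\<^bsub>M Y\<^esub>"
  using act_add_right[OF assms M.zero_closed M.zero_closed]
    act_closed[OF assms M.zero_closed] by simp

text \<open>A generator is a pair of an object and an element of the module at that object. The set of
  generators then serves as the index set of a direct sum of their objects.\<close>

definition combination :: "('o \<times> 'v) set \<Rightarrow> 'o \<Rightarrow> ('o \<times> 'v \<Rightarrow> 'm) \<Rightarrow> 'v"
  where "combination G Y c = (\<Oplus>\<^bsub>M Y\<^esub> g\<in>G. act (c g) (snd g))"

definition coefficients :: "('o \<times> 'v) set \<Rightarrow> 'o \<Rightarrow> ('o \<times> 'v \<Rightarrow> 'm) \<Rightarrow> bool"
  where "coefficients G Y c \<longleftrightarrow> (\<forall>g\<in>G. c g \<in> mor C (fst g) Y)"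

definition generating :: "'o set \<Rightarrow> ('o \<times> 'v) set \<Rightarrow> bool"
  where "generating \<Y> G \<longleftrightarrow> finite G \<and> (\<forall>g\<in>G. fst g \<in> \<Y> \<and> snd g \<in> carrier (M (fst g))) \<and>
    (\<forall>Y\<in>\<Y>. \<forall>x\<in>carrier (M Y). \<exists>c. coefficients G Y c \<and> x = combination G Y c)"

lemma ex_generating:
  assumes fin: "finite \<Y>" and fd: "\<And>Y. Y \<in> \<Y> \<Longrightarrow> vectorspace.fin_dim K (M Y)"
  shows "\<exists>G. generating \<Y> G"
proof -
  have "\<exists>A. finite A \<and> A \<subseteq> carrier (M Y) \<and> module.span K (M Y) A = carrier (M Y)" if "Y \<in> \<Y>" for Y
    using fd[OF that] vectorspace.fin_dim_def[OF M_vectorspace] by blast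
  then obtain A where A: "\<And>Y. Y \<in> \<Y> \<Longrightarrow> finite (A Y)" "\<And>Y. Y \<in> \<Y> \<Longrightarrow> A Y \<subseteq> carrier (M Y)"
    "\<And>Y. Y \<in> \<Y> \<Longrightarrow> module.span K (M Y) (A Y) = carrier (M Y)" by metis
  define G where "G = Sigma \<Y> A"
  have finG: "finite G" unfolding G_def using fin A(1) by blast
  have G: "g \<in> G \<Longrightarrow> fst g \<in> \<Y> \<and> snd g \<in> carrier (M (fst g))" for g
    unfolding G_def using subsetD[OF A(2)] by (cases g) simp
  have "\<exists>c. coefficients G Y c \<and> x = combination G Y c" if Y: "Y \<in> \<Y>" and x: "x \<in> carrier (M Y)" for Y x
  proof -
    note V = vectorspace.axioms(1)[OF M_vectorspace[of Y]]
      and H = vectorspace.axioms(1)[OF hom_vectorspace[of Y Y]]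
    have "x \<in> module.span K (M Y) (A Y)" using x A(3)[OF Y] by simp
    then obtain a B where B: "finite B" "B \<subseteq> A Y" "a \<in> B \<rightarrow> carrier K"
      "x = module.lincomb (M Y) a B"
      unfolding module.span_def[OF V] by blast
    define c where "c g = (if fst g = Y \<and> snd g \<in> B then a (snd g) \<odot>\<^bsub>HOM C Y Y\<^esub> ident C Y
      else zero_mor C (fst g) Y)" for g
    have c: "coefficients G Y c"
      unfolding coefficients_def c_def using B(3) module.smult_closed[OF H _ ident_closed] by auto
    have "combination G Y c = (\<Oplus>\<^bsub>M Y\<^esub> g\<in>Pair Y ` B. act (c g) (snd g))"
      unfolding combination_def
    proof (rule M.add.finprod_mono_neutral_cong_right[OF finG])
      show "Pair Y ` B \<subseteq> G" unfolding G_def using Y B(2) by auto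
      show "act (c g) (snd g) = \<zero>\<^bsub>M Y\<^esub>" if "g \<in> G - Pair Y ` B" for g
      proof -
        have "\<not> (fst g = Y \<and> snd g \<in> B)" using that by (cases g) auto
        then show ?thesis using act_zero_left[of "snd g" "fst g" Y] G that by (auto simp: c_def)
      qed
      show "(\<lambda>g. act (c g) (snd g)) \<in> G \<rightarrow> carrier (M Y)"
        using c G unfolding coefficients_def by (auto intro!: act_closed)
    qed simp
    also have "\<dots> = (\<Oplus>\<^bsub>M Y\<^esub> v\<in>B. act (c (Y, v)) (snd (Y, v)))"
    proof (rule M.finsum_reindex)
      show "(\<lambda>g. act (c g) (snd g)) \<in> Pair Y ` B \<rightarrow> carrier (M Y)"
      proof
        fix g assume "g \<in> Pair Y ` B"
        then have "g \<in> G" unfolding G_def using Y B(2) by auto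
        then show "act (c g) (snd g) \<in> carrier (M Y)"
          using c G unfolding coefficients_def by (auto intro!: act_closed)
      qed
    qed (auto intro: inj_onI)
    also have "\<dots> = (\<Oplus>\<^bsub>M Y\<^esub> v\<in>B. a v \<odot>\<^bsub>M Y\<^esub> v)"
    proof (rule M.finsum_cong')
      fix v assume v: "v \<in> B"
      then have "v \<in> carrier (M Y)" "a v \<in> carrier K" using B A(2)[OF Y] by auto
      then show "act (c (Y, v)) (snd (Y, v)) = a v \<odot>\<^bsub>M Y\<^esub> v" using v act_scalar by (simp add: c_def)
    qed (use B A(2)[OF Y] in \<open>auto intro!: module.smult_closed[OF V]\<close>)
    also have "\<dots> = x" unfolding B(4) module.lincomb_def[OF V] ..
    finally show ?thesis using c by blast
  qed
  then show ?thesis using finG G unfolding generating_def by blast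
qed

text \<open>If an invertible coefficient occurs in a relation, its generator is redundant: subtracting a
  multiple of the relation removes it from any combination. So no such relation holds between
  generators whose number is minimal.\<close>

lemma ex_minimal_generating:
  assumes "finite \<Y>" "\<And>Y. Y \<in> \<Y> \<Longrightarrow> vectorspace.fin_dim K (M Y)"
  obtains G where "generating \<Y> G"
    "\<And>Y c g. coefficients G Y c \<Longrightarrow> combination G Y c = \<zero>\<^bsub>M Y\<^esub> \<Longrightarrow> g \<in> G \<Longrightarrow> \<not> iso_mor C (fst g) Y (c g)"
proof -
  obtain G where G: "generating \<Y> G" and min: "\<And>G'. generating \<Y> G' \<Longrightarrow> card G \<le> card G'"
    using ex_has_least_nat[of "generating \<Y>" _ card] ex_generating[OF assms] by auto
  have fin: "finite G" and elts: "\<And>g. g \<in> G \<Longrightarrow> fst g \<in> \<Y>" "\<And>g. g \<in> G \<Longrightarrow> snd g \<in> carrier (M (fst g))"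
    using G unfolding generating_def by auto
  have False if c: "coefficients G Y c" "combination G Y c = \<zero>\<^bsub>M Y\<^esub>" and h: "h \<in> G"
    and iso: "iso_mor C (fst h) Y (c h)" for Y c h
  proof -
    obtain u where u: "c h \<in> mor C (fst h) Y" "u \<in> mor C Y (fst h)" "u \<cdot> c h = ident C (fst h)"
      using iso by (rule iso_morE)
    have cg: "c g \<in> mor C (fst g) Y" if "g \<in> G" for g using c that unfolding coefficients_def by blast
    have "\<exists>d. coefficients (G - {h}) W d \<and> x = combination (G - {h}) W d"
      if W: "W \<in> \<Y>" and x: "x \<in> carrier (M W)" for W x
    proof -
      obtain d where d: "coefficients G W d" "x = combination G W d"
        using G W x unfolding generating_def by blast
      have dg: "d g \<in> mor C (fst g) W" if "g \<in> G" for g using d that unfolding coefficients_def by blast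
      (* t times the relation cancels the coefficient d h *)
      define t where "t = \<ominus>\<^bsub>HOM C Y W\<^esub> (d h \<cdot> u)"
      have t: "t \<in> mor C Y W" unfolding t_def using comp_closed[OF u(2) dg[OF h]] by simp
      define d' where "d' g = d g \<oplus>\<^bsub>HOM C (fst g) W\<^esub> t \<cdot> c g" for g
      have tc: "t \<cdot> c g \<in> mor C (fst g) W" if "g \<in> G" for g using comp_closed[OF cg[OF that] t] .
      have d'g: "d' g \<in> mor C (fst g) W" if "g \<in> G" for g unfolding d'_def using dg tc that by simp
      have "t \<cdot> c h = \<ominus>\<^bsub>HOM C (fst h) W\<^esub> ((d h \<cdot> u) \<cdot> c h)"
        unfolding t_def by (rule comp_minus_left[OF u(1) comp_closed[OF u(2) dg[OF h]]])
      also have "(d h \<cdot> u) \<cdot> c h = d h"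
        using comp_assoc[OF u(1,2) dg[OF h]] u(3) ident_right[OF dg[OF h]] by simp
      finally have d'h: "d' h = zero_mor C (fst h) W" unfolding d'_def using dg[OF h] by (simp add: hom.r_neg)
      have "act (d' g) (snd g) = act (d g) (snd g) \<oplus>\<^bsub>M W\<^esub> act t (act (c g) (snd g))" if "g \<in> G" for g
        unfolding d'_def using act_add_left[OF dg tc elts(2)] act_comp[OF cg t elts(2)] that by simp
      then have "combination G W d' = (\<Oplus>\<^bsub>M W\<^esub> g\<in>G. act (d g) (snd g) \<oplus>\<^bsub>M W\<^esub> act t (act (c g) (snd g)))"
        unfolding combination_def using act_closed[OF dg elts(2)] act_closed[OF t act_closed[OF cg elts(2)]]
        by (intro M.finsum_cong') auto
      also have "\<dots> = combination G W d \<oplus>\<^bsub>M W\<^esub> (\<Oplus>\<^bsub>M W\<^esub> g\<in>G. act t (act (c g) (snd g)))"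
        unfolding combination_def using act_closed[OF dg elts(2)] act_closed[OF t act_closed[OF cg elts(2)]]
        by (intro M.finsum_addf) auto
      also have "(\<Oplus>\<^bsub>M W\<^esub> g\<in>G. act t (act (c g) (snd g))) = act t (combination G Y c)"
        unfolding combination_def
        by (rule additive_map_finsum[symmetric, OF M_abelian_group M_abelian_group])
          (use act_closed[OF t] act_add_right[OF t] act_zero_right[OF t] act_closed[OF cg elts(2)] in auto)
      also have "\<dots> = \<zero>\<^bsub>M W\<^esub>" using c(2) act_zero_right[OF t] by simp
      finally have "x = combination G W d'" using d(2) x by simp
      also have "G = insert h (G - {h})" using h by blast
      then have "combination G W d' = combination (insert h (G - {h})) W d'" by simp
      also have "\<dots> = act (d' h) (snd h) \<oplus>\<^bsub>M W\<^esub> combination (G - {h}) W d'"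
        unfolding combination_def using fin act_closed[OF d'g elts(2)] h by (intro M.finsum_insert) auto
      also have "\<dots> = combination (G - {h}) W d'"
        unfolding d'h act_zero_left[OF elts(2)[OF h]] combination_def
        using act_closed[OF d'g elts(2)] by (intro M.l_zero M.finsum_closed) auto
      finally show ?thesis using d'g unfolding coefficients_def by blast
    qed
    then have "generating \<Y> (G - {h})"
      using fin elts unfolding generating_def by blast
    then have "card G \<le> card (G - {h})" by (rule min)
    then show False using fin h by (metis card_Diff1_less not_le)
  qed
  then show thesis using that[OF G] by blast
qed

end

section \<open>The opposite category\<close>

definition opposite :: "('k, 'o, 'm, 'z) linear_category_data_scheme \<Rightarrow> ('k, 'o, 'm) linear_category_data"
  where "opposite C = \<lparr>HOM = (\<lambda>X Y. HOM C Y X), comp = (\<lambda>g f. f \<cdot>\<^bsub>C\<^esub> g), ident = ident C\<rparr>"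

lemma opposite_simps [simp]:
  "HOM (opposite C) X Y = HOM C Y X" "comp (opposite C) g f = f \<cdot>\<^bsub>C\<^esub> g"
  "ident (opposite C) = ident C"
  by (simp_all add: opposite_def)

lemma iso_mor_opposite [simp]: "iso_mor (opposite C) X Y f \<longleftrightarrow> iso_mor C Y X f"
  unfolding iso_mor_def by auto

context linear_category
begin

lemma opposite_linear_category: "linear_category K (opposite C)"
proof (rule linear_category.intro)
  show "vectorspace K (HOM (opposite C) X Y)" for X Y by (simp add: hom_vectorspace)
  show "ident (opposite C) X \<in> mor (opposite C) X X" for X by (simp add: ident_closed)
  show "(\<lambda>g. comp (opposite C) g f) \<in> module_hom K (HOM (opposite C) Y Z) (HOM (opposite C) X Z)"
    if "f \<in> mor (opposite C) X Y" for f X Y Z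
    using that by (simp add: postcomp_linear)
  show "comp (opposite C) g \<in> module_hom K (HOM (opposite C) X Y) (HOM (opposite C) X Z)"
    if "g \<in> mor (opposite C) Y Z" for g X Y Z
    using that precomp_linear[of g Z Y X] by (simp add: opposite_def)
qed (simp_all add: ident_left ident_right comp_assoc)

lemma smult_ident_comp:
  assumes "k \<in> carrier K" "x \<in> mor C X Y"
  shows "(k \<odot>\<^bsub>HOM C Y Y\<^esub> ident C Y) \<cdot> x = k \<odot>\<^bsub>HOM C X Y\<^esub> x"
    "x \<cdot> (k \<odot>\<^bsub>HOM C X X\<^esub> ident C X) = k \<odot>\<^bsub>HOM C X Y\<^esub> x"
  using module_hom_smult[OF precomp_linear[OF assms(2)] assms(1) ident_closed]
    module_hom_smult[OF postcomp_linear[OF assms(2)] assms(1) ident_closed]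
    ident_left[OF assms(2)] ident_right[OF assms(2)] by simp_all

lemma covariant_Hom_module: "cat_module K C (HOM C T) (comp C)"
  by (intro cat_module.intro cat_module_axioms.intro linear_category_axioms hom_vectorspace)
    (simp_all add: comp_closed comp_add_left comp_add_right smult_ident_comp comp_assoc)

lemma contravariant_Hom_module: "cat_module K (opposite C) (\<lambda>X. HOM C X U) (\<lambda>c x. x \<cdot> c)"
  by (intro cat_module.intro cat_module_axioms.intro opposite_linear_category hom_vectorspace)
    (simp_all add: comp_closed comp_add_left comp_add_right smult_ident_comp comp_assoc)

end


section \<open>Approximations\<close>

context linear_category
begin

lemma sum_diagram_comp:
  assumes S: "sum_diagram C I X Z i p" and g: "g \<in> mor C X W" and f: "f \<in> mor C V X"
  shows "g \<cdot> f = (\<Oplus>\<^bsub>HOM C V W\<^esub> a\<in>I. (g \<cdot> i a) \<cdot> (p a \<cdot> f))"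
proof -
  note D = sum_diagramD[OF S]
  have "g \<cdot> f = (\<Oplus>\<^bsub>HOM C X W\<^esub> a\<in>I. (g \<cdot> i a) \<cdot> p a) \<cdot> f"
    using sum_diagram_expand_from[OF S g] by simp
  also have "\<dots> = (\<Oplus>\<^bsub>HOM C V W\<^esub> a\<in>I. ((g \<cdot> i a) \<cdot> p a) \<cdot> f)"
    by (rule comp_finsum_left[OF f comp_closed[OF D(3) comp_closed[OF D(2) g]]])
  also have "\<dots> = (\<Oplus>\<^bsub>HOM C V W\<^esub> a\<in>I. (g \<cdot> i a) \<cdot> (p a \<cdot> f))"
    using comp_assoc[OF f D(3) comp_closed[OF D(2) g]]
      comp_closed[OF comp_closed[OF f D(3)] comp_closed[OF D(2) g]]
    by (intro hom.finsum_cong') auto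
  finally show ?thesis .
qed

text \<open>The identity of the local object \<open>Y\<close> is a sum of endomorphisms factoring through the
  summands, so one of these endomorphisms is invertible.\<close>

lemma local_retract_of_sum:
  assumes S: "sum_diagram C I X Z i p" and Z: "\<And>a. a \<in> I \<Longrightarrow> local_ring (End_ring C (Z a))"
    and Y: "local_ring (End_ring C Y)" and ret: "retract C Y X"
  shows "\<exists>a\<in>I. isomorphic C Y (Z a)"
proof (rule ccontr)
  assume no: "\<not> (\<exists>a\<in>I. isomorphic C Y (Z a))"
  note D = sum_diagramD[OF S]
  obtain s r where sr: "s \<in> mor C Y X" "r \<in> mor C X Y" "r \<cdot> s = ident C Y"
    using ret by (rule retractE)
  have ri: "r \<cdot> i a \<in> mor C (Z a) Y" and ps: "p a \<cdot> s \<in> mor C Y (Z a)" if "a \<in> I" for a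
    using comp_closed[OF D(2)[OF that] sr(2)] comp_closed[OF sr(1) D(3)[OF that]] .
  have "\<not> iso_mor C Y Y (\<Oplus>\<^bsub>HOM C Y Y\<^esub> a\<in>I. (r \<cdot> i a) \<cdot> (p a \<cdot> s))"
  proof (rule local_noniso_finsum[OF Y])
    fix a assume a: "a \<in> I"
    show "(r \<cdot> i a) \<cdot> (p a \<cdot> s) \<in> mor C Y Y" by (rule comp_closed[OF ps[OF a] ri[OF a]])
    show "\<not> iso_mor C Y Y ((r \<cdot> i a) \<cdot> (p a \<cdot> s))"
      using iso_comp_local[OF Y Z[OF a] ps[OF a] ri[OF a]] no a unfolding isomorphic_def by blast
  qed
  then have "\<not> iso_mor C Y Y (ident C Y)" using sum_diagram_comp[OF S sr(2,1)] sr(3) by simp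
  then show False using iso_mor_ident by blast
qed

end

context additive_linear_category
begin

text \<open>The components of \<open>f\<close> are minimal generators of \<open>Hom(-, U)\<close>. A morphism killed by \<open>f\<close> is a
  relation between them, which gives the last conclusion, the right minimality of \<open>f\<close>.\<close>

lemma ex_minimal_right_approximation:
  assumes "finite \<Y>" "\<And>Y. Y \<in> \<Y> \<Longrightarrow> vectorspace.fin_dim K (HOM C Y U)"
  obtains G :: "('b \<times> 'c) set" and A i p f where "sum_diagram C G A fst i p" "fst ` G \<subseteq> \<Y>"
    "f \<in> mor C A U" "\<And>Y x. Y \<in> \<Y> \<Longrightarrow> x \<in> mor C Y U \<Longrightarrow> \<exists>y\<in>mor C Y A. x = f \<cdot> y"
    "\<And>Y r g. r \<in> mor C Y A \<Longrightarrow> f \<cdot> r = zero_mor C Y U \<Longrightarrow> g \<in> G \<Longrightarrow> \<not> iso_mor C Y (fst g) (p g \<cdot> r)"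
proof -
  note R = contravariant_Hom_module[of U]
  note defs = cat_module.coefficients_def[OF R] cat_module.combination_def[OF R]
    cat_module.generating_def[OF R]
  obtain G where G: "cat_module.generating (opposite C) (\<lambda>X. HOM C X U) (\<lambda>c x. x \<cdot> c) \<Y> G"
    and min: "\<And>Y c g. cat_module.coefficients (opposite C) G Y c \<Longrightarrow>
      cat_module.combination (\<lambda>X. HOM C X U) (\<lambda>c x. x \<cdot> c) G Y c = zero_mor C Y U \<Longrightarrow> g \<in> G \<Longrightarrow>
      \<not> iso_mor (opposite C) (fst g) Y (c g)"
    using cat_module.ex_minimal_generating[OF R assms] by blast
  have fin: "finite G" and G\<Y>: "fst ` G \<subseteq> \<Y>" and sg: "\<And>g. g \<in> G \<Longrightarrow> snd g \<in> mor C (fst g) U"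
    and gen: "\<And>Y x. Y \<in> \<Y> \<Longrightarrow> x \<in> mor C Y U \<Longrightarrow>
      \<exists>c. (\<forall>g\<in>G. c g \<in> mor C Y (fst g)) \<and> x = (\<Oplus>\<^bsub>HOM C Y U\<^esub> g\<in>G. snd g \<cdot> c g)"
    using G unfolding defs by auto
  obtain A i p where S: "sum_diagram C G A fst i p" using ex_sum[OF fin] by blast
  note D = sum_diagramD[OF S]
  obtain f where f: "f \<in> mor C A U" "\<And>g. g \<in> G \<Longrightarrow> f \<cdot> i g = snd g"
    using sum_diagram_copair[OF S sg] by blast
  have comp_f: "f \<cdot> y = (\<Oplus>\<^bsub>HOM C Y U\<^esub> g\<in>G. snd g \<cdot> (p g \<cdot> y))" if y: "y \<in> mor C Y A" for y Y
    unfolding sum_diagram_comp[OF S f(1) y]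
    using f(2) comp_closed[OF comp_closed[OF y D(3)] sg] by (intro hom.finsum_cong') auto
  have 1: "\<exists>y\<in>mor C Y A. x = f \<cdot> y" if Y: "Y \<in> \<Y>" and x: "x \<in> mor C Y U" for Y x
  proof -
    obtain c where c: "\<And>g. g \<in> G \<Longrightarrow> c g \<in> mor C Y (fst g)" "x = (\<Oplus>\<^bsub>HOM C Y U\<^esub> g\<in>G. snd g \<cdot> c g)"
      using gen[OF Y x] by blast
    obtain y where y: "y \<in> mor C Y A" "\<And>g. g \<in> G \<Longrightarrow> p g \<cdot> y = c g"
      using sum_diagram_pair[OF S c(1)] by blast
    have "f \<cdot> y = x" unfolding comp_f[OF y(1)] c(2)
      using y(2) comp_closed[OF c(1) sg] by (intro hom.finsum_cong') auto
    then show ?thesis using y(1) by blast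
  qed
  have 2: "\<not> iso_mor C Y (fst g) (p g \<cdot> r)"
    if "r \<in> mor C Y A" "f \<cdot> r = zero_mor C Y U" "g \<in> G" for Y r g
    using min[of Y "\<lambda>g. p g \<cdot> r" g] that comp_f[OF that(1)] comp_closed[OF that(1) D(3)]
    unfolding defs by simp
  show thesis by (rule that[OF S G\<Y> f(1) 1 2])
qed

lemma ex_left_approximation:
  assumes "finite \<Z>" "\<And>Z. Z \<in> \<Z> \<Longrightarrow> vectorspace.fin_dim K (HOM C T Z)"
  obtains G :: "('b \<times> 'c) set" and A i p f where "sum_diagram C G A fst i p" "fst ` G \<subseteq> \<Z>"
    "f \<in> mor C T A" "\<And>Z x. Z \<in> \<Z> \<Longrightarrow> x \<in> mor C T Z \<Longrightarrow> \<exists>y\<in>mor C A Z. x = y \<cdot> f"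
proof -
  note R = covariant_Hom_module[of T]
  note defs = cat_module.coefficients_def[OF R] cat_module.combination_def[OF R]
    cat_module.generating_def[OF R]
  obtain G where G: "cat_module.generating C (HOM C T) (comp C) \<Z> G"
    using cat_module.ex_generating[OF R assms] by blast
  have fin: "finite G" and G\<Z>: "fst ` G \<subseteq> \<Z>" and sg: "\<And>g. g \<in> G \<Longrightarrow> snd g \<in> mor C T (fst g)"
    and gen: "\<And>Z x. Z \<in> \<Z> \<Longrightarrow> x \<in> mor C T Z \<Longrightarrow>
      \<exists>c. (\<forall>g\<in>G. c g \<in> mor C (fst g) Z) \<and> x = (\<Oplus>\<^bsub>HOM C T Z\<^esub> g\<in>G. c g \<cdot> snd g)"
    using G unfolding defs by auto
  obtain A i p where S: "sum_diagram C G A fst i p" using ex_sum[OF fin] by blast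
  obtain f where f: "f \<in> mor C T A" "\<And>g. g \<in> G \<Longrightarrow> p g \<cdot> f = snd g"
    using sum_diagram_pair[OF S sg] by blast
  have "\<exists>y\<in>mor C A Z. x = y \<cdot> f" if Z: "Z \<in> \<Z>" and x: "x \<in> mor C T Z" for Z x
  proof -
    obtain c where c: "\<And>g. g \<in> G \<Longrightarrow> c g \<in> mor C (fst g) Z" "x = (\<Oplus>\<^bsub>HOM C T Z\<^esub> g\<in>G. c g \<cdot> snd g)"
      using gen[OF Z x] by blast
    obtain y where y: "y \<in> mor C A Z" "\<And>g. g \<in> G \<Longrightarrow> y \<cdot> i g = c g"
      using sum_diagram_copair[OF S c(1)] by blast
    have "y \<cdot> f = x" unfolding sum_diagram_comp[OF S y(1) f(1)] c(2)
      using y(2) f(2) comp_closed[OF sg c(1)] by (intro hom.finsum_cong') auto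
    then show ?thesis using y(1) by blast
  qed
  then show thesis by (rule that[OF S G\<Z> f(1)])
qed

end

section \<open>Basic objects\<close>

context linear_category
begin

lemma finsum_End_ring: "finsum (End_ring C X) f I = finsum (HOM C X X) f I"
  unfolding finsum_def finprod_def End_ring_simps by simp

lemma sum_diagram_idempotent:
  assumes S: "sum_diagram C I X Z i p" and a: "a \<in> I"
  shows "i a \<cdot> p a \<in> mor C X X" "(i a \<cdot> p a) \<cdot> i a = i a" "p a \<cdot> (i a \<cdot> p a) = p a"
    "(i a \<cdot> p a) \<cdot> (i a \<cdot> p a) = i a \<cdot> p a"
proof -
  note D = sum_diagramD[OF S]
  show e: "i a \<cdot> p a \<in> mor C X X" by (rule comp_closed[OF D(3,2)[OF a]])
  show 1: "(i a \<cdot> p a) \<cdot> i a = i a"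
    using comp_assoc[OF D(2)[OF a] D(3)[OF a] D(2)[OF a]] D(4)[OF a] ident_right[OF D(2)[OF a]] by simp
  show "p a \<cdot> (i a \<cdot> p a) = p a"
    using comp_assoc[OF D(3)[OF a] D(2)[OF a] D(3)[OF a]] D(4)[OF a] ident_left[OF D(3)[OF a]] by simp
  show "(i a \<cdot> p a) \<cdot> (i a \<cdot> p a) = i a \<cdot> p a"
    using comp_assoc[OF D(3)[OF a] D(2)[OF a] e] 1 by simp
qed

lemma sum_diagram_primitive:
  assumes S: "sum_diagram C I X Z i p" and a: "a \<in> I" and loc: "local_ring (End_ring C (Z a))"
  shows "primitive_idempotent (End_ring C X) (i a \<cdot> p a)"
proof -
  note D = sum_diagramD[OF S]
  note E = sum_diagram_idempotent[OF S a]
  define e where "e = i a \<cdot> p a"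
  note E = E[folded e_def]
  have nz: "e \<noteq> zero_mor C X X"
  proof
    assume "e = zero_mor C X X"
    then have "i a = zero_mor C (Z a) X" using E(2) comp_zero_left[OF D(2)[OF a]] by simp
    then have "ident C (Z a) = zero_mor C (Z a) (Z a)" using D(4)[OF a] comp_zero_right[OF D(3)[OF a]] by simp
    then show False using local_ident_nonzero[OF loc] by simp
  qed
  have "f = zero_mor C X X \<or> g = zero_mor C X X"
    if f: "f \<in> mor C X X" "f \<cdot> f = f" and g: "g \<in> mor C X X" "g \<cdot> g = g"
      and orth: "f \<cdot> g = zero_mor C X X" "g \<cdot> f = zero_mor C X X" and sum: "e = f \<oplus>\<^bsub>HOM C X X\<^esub> g" for f g
  proof -
    have ef: "e \<cdot> f = f" unfolding sum using comp_add_left[OF f(1) f(1) g(1)] f orth by simp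
    have fe: "f \<cdot> e = f" unfolding sum using comp_add_right[OF f(1) g(1) f(1)] f orth by simp
    define q where "q = p a \<cdot> (f \<cdot> i a)"
    have fi: "f \<cdot> i a \<in> mor C (Z a) X" by (rule comp_closed[OF D(2)[OF a] f(1)])
    have pf: "p a \<cdot> f \<in> mor C X (Z a)" by (rule comp_closed[OF f(1) D(3)[OF a]])
    have q: "q \<in> mor C (Z a) (Z a)" unfolding q_def by (rule comp_closed[OF fi D(3)[OF a]])
    have iq: "i a \<cdot> q = f \<cdot> i a"
      unfolding q_def using comp_assoc[OF fi D(3)[OF a] D(2)[OF a]] comp_assoc[OF D(2)[OF a] f(1) E(1)] ef
      by (simp add: e_def)
    have "q \<cdot> q = p a \<cdot> (f \<cdot> (i a \<cdot> q))"
      using comp_assoc[OF q fi D(3)[OF a]] comp_assoc[OF q D(2)[OF a] f(1)] by (simp add: q_def)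
    also have "f \<cdot> (i a \<cdot> q) = f \<cdot> i a" unfolding iq using comp_assoc[OF D(2)[OF a] f(1,1)] f(2) by simp
    finally have "q \<cdot> q = q" by (simp add: q_def)
    then have "q = ident C (Z a) \<or> q = zero_mor C (Z a) (Z a)" by (rule local_idempotent[OF loc q])
    moreover have qf: "(i a \<cdot> q) \<cdot> p a = f"
      unfolding iq using comp_assoc[OF D(3)[OF a] D(2)[OF a] f(1)] fe by (simp add: e_def)
    moreover have "g = zero_mor C X X" if "q = ident C (Z a)"
    proof -
      have "f = e" using qf that ident_right[OF D(2)[OF a]] by (simp add: e_def)
      then show ?thesis using sum f(1) g(1) by simp
    qed
    moreover have "f = zero_mor C X X" if "q = zero_mor C (Z a) (Z a)"
      using qf that comp_zero_right[OF D(2)[OF a]] comp_zero_left[OF D(3)[OF a]] by simp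
    ultimately show ?thesis by blast
  qed
  then show ?thesis
    unfolding primitive_idempotent_def idempotent_def orthogonal_elements_def End_ring_simps
    using E(1,4) nz unfolding e_def by simp
qed

text \<open>A homomorphism \<open>eA \<rightarrow> fA\<close> of right ideals generated by idempotents is left multiplication by
  an element of \<open>fAe\<close>, and for the endomorphism algebra of a direct sum \<open>fAe\<close> is a space of
  morphisms between summands.\<close>

lemma sum_diagram_ideals_isomorphic:
  assumes S: "sum_diagram C I X Z i p" and a: "a \<in> I" and b: "b \<in> I"
    and iso: "right_ideals_isomorphic (End_ring C X)
      (principal_right_ideal (End_ring C X) (i a \<cdot> p a)) (principal_right_ideal (End_ring C X) (i b \<cdot> p b))"
  shows "isomorphic C (Z a) (Z b)"
proof -
  note D = sum_diagramD[OF S]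
  define e where "e = i a \<cdot> p a"
  define f where "f = i b \<cdot> p b"
  note E = sum_diagram_idempotent[OF S a, folded e_def] and F = sum_diagram_idempotent[OF S b, folded f_def]
  define P Q where "P = {e \<cdot> x |x. x \<in> mor C X X}" and "Q = {f \<cdot> x |x. x \<in> mor C X X}"
  obtain \<phi> where \<phi>: "bij_betw \<phi> P Q" and lin: "\<And>x y. x \<in> P \<Longrightarrow> y \<in> mor C X X \<Longrightarrow> \<phi> (x \<cdot> y) = \<phi> x \<cdot> y"
    using iso unfolding right_ideals_isomorphic_def principal_right_ideal_def End_ring_simps P_def Q_def e_def f_def
    by blast
  have P: "x \<in> mor C X X" "e \<cdot> x = x" if xP: "x \<in> P" for x
  proof -
    obtain y where y: "x = e \<cdot> y" "y \<in> mor C X X" using xP unfolding P_def by blast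
    show "x \<in> mor C X X" unfolding y(1) by (rule comp_closed[OF y(2) E(1)])
    show "e \<cdot> x = x" unfolding y(1) using comp_assoc[OF y(2) E(1,1)] E(4) by simp
  qed
  have Q: "x \<in> mor C X X" "f \<cdot> x = x" if xQ: "x \<in> Q" for x
  proof -
    obtain y where y: "x = f \<cdot> y" "y \<in> mor C X X" using xQ unfolding Q_def by blast
    show "x \<in> mor C X X" unfolding y(1) by (rule comp_closed[OF y(2) F(1)])
    show "f \<cdot> x = x" unfolding y(1) using comp_assoc[OF y(2) F(1,1)] F(4) by simp
  qed
  have eP: "e \<in> P" unfolding P_def using E(1,4) by force
  have fQ: "f \<in> Q" unfolding Q_def using F(1,4) by force
  define u where "u = \<phi> e"
  have uQ: "u \<in> Q" unfolding u_def using \<phi> eP unfolding bij_betw_def by blast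
  obtain v where vP: "v \<in> P" and v: "\<phi> v = f" using \<phi> fQ unfolding bij_betw_def by blast
  note u' = Q[OF uQ] and v' = P[OF vP]
  have vuP: "v \<cdot> u \<in> P" using comp_assoc[OF u'(1) v'(1) E(1)] v'(2) comp_closed[OF u'(1) v'(1)]
    unfolding P_def by force
  have "\<phi> (v \<cdot> u) = \<phi> e" using lin[OF vP u'(1)] v u'(2) by (simp add: u_def)
  then have vu: "v \<cdot> u = e" using \<phi> vuP eP unfolding bij_betw_def inj_on_def by blast
  have uv: "u \<cdot> v = f" using lin[OF eP v'(1)] v'(2) v by (simp add: u_def)
  have half: "(p c \<cdot> (y \<cdot> i d)) \<cdot> (p d \<cdot> (x \<cdot> i c)) = ident C (Z c)"
    if c: "c \<in> I" and d: "d \<in> I" and x: "x \<in> mor C X X" and y: "y \<in> mor C X X"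
      and dx: "(i d \<cdot> p d) \<cdot> x = x" and yx: "y \<cdot> x = i c \<cdot> p c" for c d x y
  proof -
    have cd: "i c \<in> mor C (Z c) X" "p c \<in> mor C X (Z c)" "i d \<in> mor C (Z d) X" "p d \<in> mor C X (Z d)"
      "p c \<cdot> i c = ident C (Z c)" "(i c \<cdot> p c) \<cdot> i c = i c"
      using D c d sum_diagram_idempotent(2)[OF S c] by simp_all
    have xi: "x \<cdot> i c \<in> mor C (Z c) X" by (rule comp_closed[OF cd(1) x])
    have pxi: "p d \<cdot> (x \<cdot> i c) \<in> mor C (Z c) (Z d)" by (rule comp_closed[OF xi cd(4)])
    have "(p c \<cdot> (y \<cdot> i d)) \<cdot> (p d \<cdot> (x \<cdot> i c)) = p c \<cdot> (y \<cdot> (i d \<cdot> (p d \<cdot> (x \<cdot> i c))))"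
      using comp_assoc[OF pxi comp_closed[OF cd(3) y] cd(2)] comp_assoc[OF pxi cd(3) y] by simp
    also have "i d \<cdot> (p d \<cdot> (x \<cdot> i c)) = x \<cdot> i c"
      using comp_assoc[OF xi cd(4,3)] comp_assoc[OF cd(1) x comp_closed[OF cd(4,3)]] dx by simp
    also have "y \<cdot> (x \<cdot> i c) = i c"
      using comp_assoc[OF cd(1) x y] yx cd(6) by simp
    finally show ?thesis using cd(5) by simp
  qed
  show ?thesis unfolding isomorphic_def iso_mor_def
    using half[OF a b, of u v] half[OF b a, of v u] u' v' uv vu
      comp_closed[OF comp_closed[OF D(2)[OF a] u'(1)] D(3)[OF b]]
      comp_closed[OF comp_closed[OF D(2)[OF b] v'(1)] D(3)[OF a]]
    unfolding e_def f_def by auto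
qed

lemma sum_diagram_basic:
  assumes S: "sum_diagram C I X Z i p" and loc: "\<And>a. a \<in> I \<Longrightarrow> local_ring (End_ring C (Z a))"
    and noniso: "\<And>a b. a \<in> I \<Longrightarrow> b \<in> I \<Longrightarrow> isomorphic C (Z a) (Z b) \<Longrightarrow> a = b"
  shows "basic C X"
proof -
  note D = sum_diagramD[OF S]
  obtain h n where h: "bij_betw h {..<n::nat} I"
    using ex_bij_betw_nat_finite[OF D(1)] unfolding atLeast0LessThan by blast
  have hI: "h k \<in> I" if "k < n" for k using h that unfolding bij_betw_def by blast
  have hinj: "h k = h l \<Longrightarrow> k = l" if "k < n" "l < n" for k l
    using h that unfolding bij_betw_def inj_on_def by blast
  define e where "e k = i (h k) \<cdot> p (h k)" for k
  have ip: "i a \<cdot> p a \<in> mor C X X" if "a \<in> I" for a by (rule comp_closed[OF D(3,2)[OF that]])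
  have orth: "e k \<cdot> e l = zero_mor C X X" if "k < n" "l < n" "k \<noteq> l" for k l
  proof -
    have kl: "h k \<noteq> h l" using hinj that by blast
    have "p (h k) \<cdot> (i (h l) \<cdot> p (h l)) = zero_mor C X (Z (h k))"
      using comp_assoc[OF D(3)[OF hI[OF that(2)]] D(2)[OF hI[OF that(2)]] D(3)[OF hI[OF that(1)]]]
        D(5)[OF hI[OF that(1)] hI[OF that(2)] kl] comp_zero_left[OF D(3)[OF hI[OF that(2)]]] by simp
    then show ?thesis
      using comp_assoc[OF ip[OF hI[OF that(2)]] D(3)[OF hI[OF that(1)]] D(2)[OF hI[OF that(1)]]]
        comp_zero_right[OF D(2)[OF hI[OF that(1)]]] by (simp add: e_def)
  qed
  have "(\<Oplus>\<^bsub>HOM C X X\<^esub> k\<in>{..<n}. e k) = (\<Oplus>\<^bsub>HOM C X X\<^esub> a\<in>h ` {..<n}. i a \<cdot> p a)"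
    unfolding e_def
  proof (rule hom.finsum_reindex[symmetric])
    show "(\<lambda>a. i a \<cdot> p a) \<in> h ` {..<n} \<rightarrow> mor C X X" using ip hI by blast
    show "inj_on h {..<n}" using h unfolding bij_betw_def by blast
  qed
  also have "h ` {..<n} = I" using h unfolding bij_betw_def by blast
  finally have "(\<Oplus>\<^bsub>End_ring C X\<^esub> k\<in>{..<n}. e k) = ident C X"
    unfolding finsum_End_ring using D(6) by simp
  then have "complete_primitive_orthogonal_idempotents (End_ring C X) e n"
    unfolding complete_primitive_orthogonal_idempotents_def orthogonal_elements_def End_ring_simps
    using orth sum_diagram_primitive[OF S hI loc[OF hI]] unfolding e_def by blast
  moreover have "\<not> right_ideals_isomorphic (End_ring C X)
      (principal_right_ideal (End_ring C X) (e k)) (principal_right_ideal (End_ring C X) (e l))"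
    if "k < n" "l < n" "k \<noteq> l" for k l
    using sum_diagram_ideals_isomorphic[OF S hI[OF that(1)] hI[OF that(2)]] noniso[OF hI[OF that(1)] hI[OF that(2)]]
      hinj[OF that(1,2)] that(3) unfolding e_def by blast
  ultimately show ?thesis unfolding basic_def basic_algebra_def by blast
qed

end


section \<open>The shift\<close>

context triangulated_category
begin

abbreviation shiftO :: "nat \<Rightarrow> 'o \<Rightarrow> 'o" where "shiftO n \<equiv> shift_ob C ^^ n"

abbreviation shiftM :: "nat \<Rightarrow> 'm \<Rightarrow> 'm" where "shiftM n \<equiv> shift_mor C ^^ n"

lemma shiftO_shift: "shiftO n (shift_ob C X) = shiftO (Suc n) X"
  by (simp add: funpow_swap1)

lemma shiftM_linear: "shiftM n \<in> module_hom K (HOM C X Y) (HOM C (shiftO n X) (shiftO n Y))"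
proof (induction n)
  case 0
  show ?case by (simp add: module_hom_def)
next
  case (Suc n)
  note L = shift_linear[of "shiftO n X" "shiftO n Y"]
  show ?case
    using module_hom_closed[OF Suc] module_hom_add[OF Suc] module_hom_smult[OF Suc]
      module_hom_closed[OF L] module_hom_add[OF L] module_hom_smult[OF L]
    unfolding module_hom_def by (auto simp: Pi_iff)
qed

lemma shiftM_closed: "f \<in> mor C X Y \<Longrightarrow> shiftM n f \<in> mor C (shiftO n X) (shiftO n Y)"
  using module_hom_closed[OF shiftM_linear] by blast

lemma shiftM_add:
  "f \<in> mor C X Y \<Longrightarrow> g \<in> mor C X Y \<Longrightarrow>
    shiftM n (f \<oplus>\<^bsub>HOM C X Y\<^esub> g) = shiftM n f \<oplus>\<^bsub>HOM C (shiftO n X) (shiftO n Y)\<^esub> shiftM n g"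
  by (rule module_hom_add[OF shiftM_linear])

lemma shiftM_zero: "shiftM n (zero_mor C X Y) = zero_mor C (shiftO n X) (shiftO n Y)"
  using shiftM_add[OF hom.zero_closed hom.zero_closed, of n X Y]
    shiftM_closed[OF hom.zero_closed, of n X Y] by simp

lemma shiftM_minus:
  assumes "f \<in> mor C X Y"
  shows "shiftM n (\<ominus>\<^bsub>HOM C X Y\<^esub> f) = \<ominus>\<^bsub>HOM C (shiftO n X) (shiftO n Y)\<^esub> shiftM n f"
proof -
  have "shiftM n (\<ominus>\<^bsub>HOM C X Y\<^esub> f) \<oplus>\<^bsub>HOM C (shiftO n X) (shiftO n Y)\<^esub> shiftM n f
      = zero_mor C (shiftO n X) (shiftO n Y)"
    using shiftM_add[of "\<ominus>\<^bsub>HOM C X Y\<^esub> f" X Y f n] assms by (simp add: hom.l_neg shiftM_zero)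
  then show ?thesis
    using hom.minus_equality shiftM_closed[OF assms, of n] shiftM_closed[of "\<ominus>\<^bsub>HOM C X Y\<^esub> f" X Y n] assms
    by simp
qed

lemma shiftM_ident: "shiftM n (ident C X) = ident C (shiftO n X)"
  by (induction n) (simp_all add: shift_ident)

lemma shiftM_comp:
  assumes "f \<in> mor C X Y" "g \<in> mor C Y Z" shows "shiftM n (g \<cdot> f) = shiftM n g \<cdot> shiftM n f"
  by (induction n) (simp_all add: shift_comp[OF shiftM_closed[OF assms(1)] shiftM_closed[OF assms(2)]])

lemma shiftM_bij: "bij_betw (shiftM n) (mor C X Y) (mor C (shiftO n X) (shiftO n Y))"
proof (induction n)
  case 0
  then show ?case by (simp add: bij_betw_def)
next
  case (Suc n)
  then show ?case using bij_betw_trans[OF Suc shift_fully_faithful] by (simp add: o_def)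
qed

lemma shiftM_full:
  assumes "f \<in> mor C (shiftO n X) (shiftO n Y)"
  obtains g where "g \<in> mor C X Y" "f = shiftM n g"
  using assms shiftM_bij[of n X Y] unfolding bij_betw_def by blast

lemma shiftM_inject:
  "f \<in> mor C X Y \<Longrightarrow> g \<in> mor C X Y \<Longrightarrow> shiftM n f = shiftM n g \<Longrightarrow> f = g"
  using shiftM_bij[of n X Y] unfolding bij_betw_def inj_on_def by blast

lemma Hom_zero_shift: "Hom_zero C (shiftO n X) (shiftO n Y) \<longleftrightarrow> Hom_zero C X Y"
proof
  assume *: "Hom_zero C (shiftO n X) (shiftO n Y)"
  show "Hom_zero C X Y"
  proof (rule Hom_zeroI)
    fix f assume f: "f \<in> mor C X Y"
    have "shiftM n f = shiftM n (zero_mor C X Y)"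
      unfolding shiftM_zero by (rule Hom_zeroD[OF * shiftM_closed[OF f]])
    then show "f = zero_mor C X Y" by (rule shiftM_inject[OF f hom.zero_closed])
  qed
next
  assume *: "Hom_zero C X Y"
  show "Hom_zero C (shiftO n X) (shiftO n Y)"
  proof (rule Hom_zeroI)
    fix f assume "f \<in> mor C (shiftO n X) (shiftO n Y)"
    then obtain g where g: "g \<in> mor C X Y" "f = shiftM n g" by (rule shiftM_full)
    then show "f = zero_mor C (shiftO n X) (shiftO n Y)" using Hom_zeroD[OF * g(1)] shiftM_zero by simp
  qed
qed

lemma retract_shift:
  assumes "retract C Y X" shows "retract C (shiftO n Y) (shiftO n X)"
proof -
  obtain s r where sr: "s \<in> mor C Y X" "r \<in> mor C X Y" "r \<cdot> s = ident C Y"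
    using assms by (rule retractE)
  have "shiftM n r \<cdot> shiftM n s = ident C (shiftO n Y)"
    using shiftM_comp[OF sr(1,2), of n] sr(3) shiftM_ident by simp
  then show ?thesis unfolding retract_def using shiftM_closed sr(1,2) by blast
qed

lemma sum_diagram_shift:
  assumes "sum_diagram C I X Z i p"
  shows "sum_diagram C I (shiftO n X) (\<lambda>a. shiftO n (Z a)) (\<lambda>a. shiftM n (i a)) (\<lambda>a. shiftM n (p a))"
proof -
  note D = sum_diagramD[OF assms]
  have ip: "i a \<cdot> p a \<in> mor C X X" if "a \<in> I" for a by (rule comp_closed[OF D(3,2)[OF that]])
  have "(\<Oplus>\<^bsub>HOM C (shiftO n X) (shiftO n X)\<^esub> a\<in>I. shiftM n (i a) \<cdot> shiftM n (p a))
      = (\<Oplus>\<^bsub>HOM C (shiftO n X) (shiftO n X)\<^esub> a\<in>I. shiftM n (i a \<cdot> p a))"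
    using shiftM_comp[OF D(3,2)] shiftM_closed[OF ip] by (intro hom.finsum_cong') auto
  also have "\<dots> = shiftM n (\<Oplus>\<^bsub>HOM C X X\<^esub> a\<in>I. i a \<cdot> p a)"
    by (rule additive_map_finsum[symmetric, OF hom_abelian_group hom_abelian_group])
      (use shiftM_closed shiftM_add shiftM_zero ip in auto)
  also have "\<dots> = ident C (shiftO n X)" using D(6) shiftM_ident by simp
  finally have sum: "(\<Oplus>\<^bsub>HOM C (shiftO n X) (shiftO n X)\<^esub> a\<in>I. shiftM n (i a) \<cdot> shiftM n (p a))
      = ident C (shiftO n X)" .
  have "shiftM n (p a) \<cdot> shiftM n (i b) = (if a = b then ident C (shiftO n (Z a))
      else zero_mor C (shiftO n (Z b)) (shiftO n (Z a)))" if "a \<in> I" "b \<in> I" for a b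
    using shiftM_comp[OF D(2)[OF that(2)] D(3)[OF that(1)], of n] D(4)[OF that(1)] D(5)[OF that]
      shiftM_ident shiftM_zero by auto
  then show ?thesis using D(1) shiftM_closed[OF D(2)] shiftM_closed[OF D(3)] sum
    unfolding sum_diagram_def by blast
qed

lemma zero_objectI: "ident C Z = zero_mor C Z Z \<Longrightarrow> zero_object C Z"
  unfolding zero_object_def Hom_zero_def[symmetric]
  by (metis Hom_zeroI comp_zero_left comp_zero_right ident_left ident_right)

lemma zero_object_shift: "zero_object C Z \<Longrightarrow> zero_object C (shiftO n Z)"
  using ident_closed[of Z] zero_objectI[of "shiftO n Z"] shiftM_ident[of n Z] shiftM_zero[of n Z Z]
  unfolding zero_object_def by auto

lemma shifted_Hom_module:
  "cat_module K C (\<lambda>Z. HOM C U (shiftO n Z)) (\<lambda>c x. shiftM n c \<cdot> x)"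
  by (intro cat_module.intro cat_module_axioms.intro linear_category_axioms hom_vectorspace)
    (simp_all add: comp_closed[OF _ shiftM_closed] comp_add_left[OF _ shiftM_closed shiftM_closed] shiftM_add
      comp_add_right[OF _ _ shiftM_closed] module_hom_smult[OF shiftM_linear _ ident_closed] shiftM_ident
      smult_ident_comp shiftM_comp comp_assoc[OF _ shiftM_closed shiftM_closed])

end

section \<open>Exactness of distinguished triangles\<close>

context triangulated_category
begin

lemma dtri_mor:
  assumes "dtri C X Y Z f g h"
  shows "f \<in> mor C X Y" "g \<in> mor C Y Z" "h \<in> mor C Z (shift_ob C X)"
  using dtri_closed[OF assms] by auto

lemma dtri_rotate:
  assumes "dtri C X Y Z f g h"
  shows "dtri C Y Z (shift_ob C X) g h (\<ominus>\<^bsub>HOM C (shift_ob C X) (shift_ob C Y)\<^esub> shift_mor C f)"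
  using TR2[OF dtri_mor[OF assms]] assms by simp

lemma dtri_comp_zero:
  assumes "dtri C X Y Z f g h" shows "g \<cdot> f = zero_mor C X Z"
proof -
  obtain N where N: "zero_object C N" using ex_zero_object by blast
  note m = dtri_mor[OF assms]
  obtain w where w: "w \<in> mor C N Z" "w \<cdot> zero_mor C X N = g \<cdot> f"
    using TR3[OF TR1_ident[OF N, of X] assms ident_closed m(1)] by blast
  then show ?thesis using comp_zero_right[OF w(1)] by simp
qed

lemma dtri_exact_covariant_unshifted:
  assumes tri: "dtri C X Y Z f g h" and u: "u \<in> mor C A Y" "g \<cdot> u = zero_mor C A Z"
  obtains v where "v \<in> mor C A X" "u = f \<cdot> v"
proof -
  obtain N where N: "zero_object C N" using ex_zero_object by blast
  note m = dtri_mor[OF tri]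
  let ?S = "shift_ob C"
  have "zero_mor C N Z \<cdot> zero_mor C A N = g \<cdot> u"
    using u(2) comp_zero_right[OF hom.zero_closed, of N Z A] by simp
  from TR3[OF dtri_rotate[OF TR1_ident[OF N, of A]] dtri_rotate[OF tri] u(1) hom.zero_closed this]
  obtain w where w: "w \<in> mor C (?S A) (?S X)"
    "shift_mor C u \<cdot> (\<ominus>\<^bsub>HOM C (?S A) (?S A)\<^esub> shift_mor C (ident C A))
      = (\<ominus>\<^bsub>HOM C (?S X) (?S Y)\<^esub> shift_mor C f) \<cdot> w" by blast
  have Su: "shift_mor C u \<in> mor C (?S A) (?S Y)" and Sf: "shift_mor C f \<in> mor C (?S X) (?S Y)"
    using shiftM_closed[OF u(1), of 1] shiftM_closed[OF m(1), of 1] by simp_all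
  have "\<ominus>\<^bsub>HOM C (?S A) (?S Y)\<^esub> shift_mor C u = \<ominus>\<^bsub>HOM C (?S A) (?S Y)\<^esub> (shift_mor C f \<cdot> w)"
    using w(2) comp_minus_right[OF ident_closed Su] comp_minus_left[OF w(1) Sf]
    by (simp add: shift_ident ident_right[OF Su])
  then have "shift_mor C u = shift_mor C f \<cdot> w"
    using Su comp_closed[OF w(1) Sf] by (metis hom.minus_minus)
  moreover obtain v where v: "v \<in> mor C A X" "w = shift_mor C v"
    using w(1) shiftM_full[of w 1 A X] by auto
  ultimately have "shiftM 1 u = shiftM 1 (f \<cdot> v)" using shift_comp[OF v(1) m(1)] by simp
  then have "u = f \<cdot> v" by (rule shiftM_inject[OF u(1) comp_closed[OF v(1) m(1)]])
  then show thesis using v(1) that by blast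
qed

lemma dtri_from_zero:
  assumes N: "zero_object C N"
  shows "dtri C N A A (zero_mor C N A) (ident C A) (zero_mor C A (shift_ob C N))"
proof -
  have SO: "zero_object C (shift_ob C N)" using zero_object_shift[OF N, of 1] by simp
  have "\<ominus>\<^bsub>HOM C (shift_ob C N) (shift_ob C A)\<^esub> shift_mor C (zero_mor C N A)
      = zero_mor C (shift_ob C N) (shift_ob C A)"
    using shiftM_zero[of 1 N A] by simp
  then show ?thesis using TR2[OF hom.zero_closed ident_closed hom.zero_closed] TR1_ident[OF SO, of A] by simp
qed

lemma dtri_exact_contravariant:
  assumes tri: "dtri C X Y Z f g h" and u: "u \<in> mor C Y A" "u \<cdot> f = zero_mor C X A"
  obtains v where "v \<in> mor C Z A" "u = v \<cdot> g"
proof -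
  obtain N where N: "zero_object C N" using ex_zero_object by blast
  have "u \<cdot> f = zero_mor C N A \<cdot> zero_mor C X N"
    using u(2) comp_zero_right[OF hom.zero_closed, of N A X] by simp
  from TR3[OF tri dtri_from_zero[OF N] hom.zero_closed u(1) this]
  obtain w where w: "w \<in> mor C Z A" "w \<cdot> g = ident C A \<cdot> u" by blast
  then show thesis using ident_left[OF u(1)] that by simp
qed

text \<open>A sign change of two of the three morphisms makes the triple rotation of a triangle its shift
  up to the sign of the last morphism.\<close>

lemma dtri_shift1:
  assumes tri: "dtri C X Y Z f g h"
  shows "\<exists>h'. dtri C (shift_ob C X) (shift_ob C Y) (shift_ob C Z) (shift_mor C f) (shift_mor C g) h'"
proof -
  let ?S = "shift_ob C" and ?s = "shift_mor C"
  note m = dtri_mor[OF tri]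
  have s: "?s f \<in> mor C (?S X) (?S Y)" "?s g \<in> mor C (?S Y) (?S Z)" "?s h \<in> mor C (?S Z) (?S (?S X))"
    using shiftM_closed[of f X Y 1] shiftM_closed[of g Y Z 1] shiftM_closed[of h Z "?S X" 1] m by simp_all
  have neg: "iso_mor C W W (\<ominus>\<^bsub>HOM C W W\<^esub> ident C W)" for W
    unfolding iso_mor_def using ident_closed[of W]
      comp_minus_left[OF hom.a_inv_closed[OF ident_closed] ident_closed, of W]
      ident_left[OF hom.a_inv_closed[OF ident_closed], of W]
      hom.minus_minus[OF ident_closed]
    by (intro conjI bexI[of _ "\<ominus>\<^bsub>HOM C W W\<^esub> ident C W"]) simp_all
  note rot = dtri_rotate[OF dtri_rotate[OF dtri_rotate[OF tri]]]
  have n1: "ident C (?S Y) \<cdot> (\<ominus>\<^bsub>HOM C (?S X) (?S Y)\<^esub> ?s f)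
      = ?s f \<cdot> (\<ominus>\<^bsub>HOM C (?S X) (?S X)\<^esub> ident C (?S X))"
    using comp_minus_right[OF ident_closed s(1)] ident_right[OF s(1)] ident_left[OF hom.a_inv_closed[OF s(1)]]
    by simp
  have n2: "(\<ominus>\<^bsub>HOM C (?S Z) (?S Z)\<^esub> ident C (?S Z)) \<cdot> (\<ominus>\<^bsub>HOM C (?S Y) (?S Z)\<^esub> ?s g)
      = ?s g \<cdot> ident C (?S Y)"
    using comp_minus_left[OF hom.a_inv_closed[OF s(2)] ident_closed] ident_left[OF hom.a_inv_closed[OF s(2)]]
      hom.minus_minus[OF s(2)] ident_right[OF s(2)]
    by simp
  have n3: "?s (\<ominus>\<^bsub>HOM C (?S X) (?S X)\<^esub> ident C (?S X)) \<cdot> (\<ominus>\<^bsub>HOM C (?S Z) (?S (?S X))\<^esub> ?s h)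
      = (\<ominus>\<^bsub>HOM C (?S Z) (?S (?S X))\<^esub> ?s h) \<cdot> (\<ominus>\<^bsub>HOM C (?S Z) (?S Z)\<^esub> ident C (?S Z))"
    using comp_minus_left[OF hom.a_inv_closed[OF s(3)] ident_closed] ident_left[OF hom.a_inv_closed[OF s(3)]]
      comp_minus_right[OF ident_closed hom.a_inv_closed[OF s(3)]] ident_right[OF hom.a_inv_closed[OF s(3)]]
      shiftM_minus[OF ident_closed, of 1 "?S X"]
    by (simp add: shift_ident)
  from TR1_iso[OF rot s(1,2) hom.a_inv_closed[OF s(3)] neg iso_mor_ident neg n1 n2 n3]
  show ?thesis by blast
qed

lemma dtri_shift:
  assumes tri: "dtri C X Y Z f g h"
  shows "\<exists>h'. dtri C (shiftO n X) (shiftO n Y) (shiftO n Z) (shiftM n f) (shiftM n g) h'"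
proof (induction n)
  case 0
  then show ?case using tri by auto
next
  case (Suc n)
  then show ?case using dtri_shift1 by auto
qed

lemma dtri_exact_covariant:
  assumes tri: "dtri C X Y Z f g h"
    and u: "u \<in> mor C A (shiftO n Y)" "shiftM n g \<cdot> u = zero_mor C A (shiftO n Z)"
  obtains v where "v \<in> mor C A (shiftO n X)" "u = shiftM n f \<cdot> v"
  using dtri_shift[OF tri] dtri_exact_covariant_unshifted[OF _ u] by blast

lemma Hom_zero_third:
  assumes tri: "dtri C X Y Z f g h"
    and "Hom_zero C A (shiftO n Y)" "Hom_zero C A (shiftO (Suc n) X)"
  shows "Hom_zero C A (shiftO n Z)"
proof (rule Hom_zeroI)
  fix u assume u: "u \<in> mor C A (shiftO n Z)"
  note m = dtri_mor[OF tri]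
  have "shiftM n h \<cdot> u = zero_mor C A (shiftO n (shift_ob C X))"
    using Hom_zeroD[OF assms(3)] comp_closed[OF u shiftM_closed[OF m(3)]] unfolding shiftO_shift by blast
  then obtain v where v: "v \<in> mor C A (shiftO n Y)" "u = shiftM n g \<cdot> v"
    using dtri_exact_covariant[OF dtri_rotate[OF tri] u] by blast
  then show "u = zero_mor C A (shiftO n Z)"
    using Hom_zeroD[OF assms(2) v(1)] comp_zero_right[OF shiftM_closed[OF m(2)]] by simp
qed

lemma ex_cocone:
  assumes f: "f \<in> mor C Y Z" obtains X e h where "dtri C X Y Z e f h"
proof -
  let ?S = "shift_ob C"
  obtain W g h where tri: "dtri C Y Z W f g h" using TR1_cone[OF f] by blast
  note m = dtri_mor[OF tri]
  obtain X where "isomorphic C W (?S X)" using shift_essentially_surjective isomorphic_sym by blast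
  then obtain w where iso: "iso_mor C W (?S X) w" unfolding isomorphic_def by blast
  then obtain w' where w: "w \<in> mor C W (?S X)" "w' \<in> mor C (?S X) W" "w' \<cdot> w = ident C W"
    by (rule iso_morE)
  define g' where "g' = w \<cdot> g"
  define h' where "h' = h \<cdot> w'"
  have g': "g' \<in> mor C Z (?S X)" unfolding g'_def by (rule comp_closed[OF m(2) w(1)])
  have h': "h' \<in> mor C (?S X) (?S Y)" unfolding h'_def by (rule comp_closed[OF w(2) m(3)])
  have "shift_mor C (ident C Y) \<cdot> h = h' \<cdot> w"
    unfolding h'_def using comp_assoc[OF w(1,2) m(3)] w(3) ident_right[OF m(3)] ident_left[OF m(3)]
    by (simp add: shift_ident)
  then have tri': "dtri C Y Z (?S X) f g' h'"
    using TR1_iso[OF tri f g' h' iso_mor_ident iso_mor_ident iso] ident_left[OF f] ident_right[OF f]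
      ident_right[OF g'] by (simp add: g'_def)
  obtain e where e: "e \<in> mor C X Y" "\<ominus>\<^bsub>HOM C (?S X) (?S Y)\<^esub> h' = shift_mor C e"
    using shiftM_full[of "\<ominus>\<^bsub>HOM C (?S X) (?S Y)\<^esub> h'" 1 X Y] h' by auto
  have "h' = \<ominus>\<^bsub>HOM C (?S X) (?S Y)\<^esub> shift_mor C e" using e(2) hom.minus_minus[OF h'] by simp
  then have "dtri C X Y Z e f g'" using TR2[OF e(1) f g'] tri' by simp
  then show thesis by (rule that)
qed

end

section \<open>Thick subcategories\<close>

context triangulated_category
begin

lemma thick_subcategoryD:
  assumes "thick_subcategory C S"
  shows "zero_object C Z \<Longrightarrow> Z \<in> S" "X \<in> S \<Longrightarrow> isomorphic C X Y \<Longrightarrow> Y \<in> S"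
    "shift_ob C X \<in> S \<longleftrightarrow> X \<in> S" "dtri C X Y Z f g h \<Longrightarrow> X \<in> S \<Longrightarrow> Y \<in> S \<Longrightarrow> Z \<in> S"
    "X \<in> S \<Longrightarrow> direct_summand C Y X \<Longrightarrow> Y \<in> S"
  using assms unfolding thick_subcategory_def by blast+

lemma thick_first:
  assumes S: "thick_subcategory C S" and tri: "dtri C X Y Z f g h" and "Y \<in> S" "Z \<in> S"
  shows "X \<in> S"
  using thick_subcategoryD(4)[OF S dtri_rotate[OF tri]] thick_subcategoryD(3)[OF S] assms by blast

lemma thick_second:
  assumes S: "thick_subcategory C S" and tri: "dtri C X Y Z f g h" and "X \<in> S" "Z \<in> S"
  shows "Y \<in> S"
  using thick_subcategoryD(4)[OF S dtri_rotate[OF dtri_rotate[OF tri]]] thick_subcategoryD(3)[OF S] assms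
  by blast

text \<open>The cone of a split monomorphism is the complement.\<close>

lemma biproduct_cone:
  assumes "biproduct C X Y Z"
  obtains Z' f g h where "dtri C Y X Z' f g h" "isomorphic C Z Z'"
proof -
  obtain i j p q where *: "i \<in> mor C Y X" "j \<in> mor C Z X" "p \<in> mor C X Y" "q \<in> mor C X Z"
    "p \<cdot> i = ident C Y" "q \<cdot> j = ident C Z" "q \<cdot> i = zero_mor C Y Z"
    "(i \<cdot> p) \<oplus>\<^bsub>HOM C X X\<^esub> (j \<cdot> q) = ident C X"
    using assms unfolding biproduct_def by blast
  obtain Z' g h where tri: "dtri C Y X Z' i g h" using TR1_cone[OF *(1)] by blast
  note m = dtri_mor[OF tri]
  have gi: "g \<cdot> i = zero_mor C Y Z'" by (rule dtri_comp_zero[OF tri])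
  have "shift_mor C i \<cdot> h = zero_mor C Z' (shift_ob C X)"
  proof -
    have Si: "shift_mor C i \<in> mor C (shift_ob C Y) (shift_ob C X)" using shiftM_closed[OF *(1), of 1] by simp
    have "shift_mor C i \<cdot> h = \<ominus>\<^bsub>HOM C Z' (shift_ob C X)\<^esub> (\<ominus>\<^bsub>HOM C Z' (shift_ob C X)\<^esub> (shift_mor C i \<cdot> h))"
      using hom.minus_minus[OF comp_closed[OF m(3) Si]] by simp
    also have "\<ominus>\<^bsub>HOM C Z' (shift_ob C X)\<^esub> (shift_mor C i \<cdot> h) = zero_mor C Z' (shift_ob C X)"
      using dtri_comp_zero[OF dtri_rotate[OF dtri_rotate[OF tri]]] comp_minus_left[OF m(3) Si] by simp
    finally show ?thesis by simp
  qed
  moreover have "shift_mor C p \<cdot> (shift_mor C i \<cdot> h) = h"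
    using comp_assoc[OF m(3) shiftM_closed[OF *(1), of 1, simplified] shiftM_closed[OF *(3), of 1, simplified]]
      shift_comp[OF *(1,3)] *(5) shift_ident ident_left[OF m(3)] by simp
  ultimately have h: "h = zero_mor C Z' (shift_ob C Y)"
    using comp_zero_right[OF shiftM_closed[OF *(3), of 1, simplified]] by simp
  obtain s where s: "s \<in> mor C Z' X" "ident C Z' = g \<cdot> s"
    using dtri_exact_covariant_unshifted[OF dtri_rotate[OF tri] ident_closed trans[OF ident_right[OF m(3)] h]]
    by blast
  obtain w where w: "w \<in> mor C Z' Z" "q = w \<cdot> g"
    using dtri_exact_contravariant[OF tri *(4,7)] by blast
  have gj: "g \<cdot> j \<in> mor C Z Z'" by (rule comp_closed[OF *(2) m(2)])
  have "w \<cdot> (g \<cdot> j) = ident C Z" using comp_assoc[OF *(2) m(2) w(1)] w(2) *(6) by simp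
  moreover have "(g \<cdot> j) \<cdot> w = ident C Z'"
  proof -
    have ip: "i \<cdot> p \<in> mor C X X" and jq: "j \<cdot> q \<in> mor C X X"
      using comp_closed[OF *(3,1)] comp_closed[OF *(4,2)] .
    have "g = g \<cdot> ((i \<cdot> p) \<oplus>\<^bsub>HOM C X X\<^esub> (j \<cdot> q))" using *(8) ident_right[OF m(2)] by simp
    also have "\<dots> = g \<cdot> (i \<cdot> p) \<oplus>\<^bsub>HOM C X Z'\<^esub> g \<cdot> (j \<cdot> q)" by (rule comp_add_right[OF ip jq m(2)])
    also have "g \<cdot> (i \<cdot> p) = zero_mor C X Z'"
      using comp_assoc[OF *(3,1) m(2)] gi comp_zero_left[OF *(3)] by simp
    finally have "g = g \<cdot> (j \<cdot> q)" using comp_closed[OF jq m(2)] by simp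
    then have g: "g = (g \<cdot> j) \<cdot> (w \<cdot> g)" using comp_assoc[OF *(4,2) m(2)] w(2) by simp
    have "(g \<cdot> j) \<cdot> w = ((g \<cdot> j) \<cdot> w) \<cdot> (g \<cdot> s)" using s(2) ident_right[OF comp_closed[OF w(1) gj]] by simp
    also have "\<dots> = ((g \<cdot> j) \<cdot> (w \<cdot> g)) \<cdot> s"
      using comp_assoc[OF s(1) m(2) comp_closed[OF w(1) gj]] comp_assoc[OF m(2) w(1) gj] by simp
    also have "\<dots> = ident C Z'" using g s(2) by simp
    finally show ?thesis .
  qed
  ultimately have "isomorphic C Z Z'" unfolding isomorphic_def iso_mor_def using gj w(1) by blast
  then show thesis using tri that by blast
qed

lemma thick_biproduct:
  assumes S: "thick_subcategory C S" and "biproduct C X Y Z" "Y \<in> S" "Z \<in> S" shows "X \<in> S"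
proof -
  obtain Z' f g h where "dtri C Y X Z' f g h" "isomorphic C Z Z'"
    using assms(2) by (rule biproduct_cone)
  then show ?thesis using thick_second[OF S] thick_subcategoryD(2)[OF S] assms by blast
qed

lemma thick_sum:
  assumes S: "thick_subcategory C S" and sum: "sum_diagram C I X Z i p" and Z: "\<And>a. a \<in> I \<Longrightarrow> Z a \<in> S"
  shows "X \<in> S"
proof -
  obtain X' i' p' where X': "X' \<in> S" "sum_diagram C I X' Z i' p'"
    using ex_sum_diagram[OF sum_diagramD(1)[OF sum], of S Z] thick_subcategoryD(1)[OF S]
      thick_biproduct[OF S] Z by blast
  then show ?thesis using thick_subcategoryD(2)[OF S X'(1)] sum_diagram_unique[OF X'(2) sum] by blast
qed

lemma thick_summand:
  assumes S: "thick_subcategory C S" and sum: "sum_diagram C I X Z i p" and a: "a \<in> I" and X: "X \<in> S"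
  shows "Z a \<in> S"
  using sum_diagram_direct_summand[OF sum a] thick_subcategoryD(2)[OF S X] thick_subcategoryD(5)[OF S]
  by metis

lemma thick_eq_UNIV:
  assumes "thick C T = UNIV" "\<And>S. thick_subcategory C S \<Longrightarrow> V \<in> S \<Longrightarrow> T \<in> S"
  shows "thick C V = UNIV"
  using assms unfolding thick_def by blast

end


section \<open>The order on objects\<close>

definition below :: "('k, 'o, 'm, 'z) triangulated_data_scheme \<Rightarrow> 'o \<Rightarrow> 'o set"
  where "below C V = {Z. silting_ge C V Z}"

context triangulated_category
begin

lemma silting_ge_iff: "silting_ge C M N \<longleftrightarrow> (\<forall>i>0. Hom_zero C M (shiftO i N))"
  unfolding silting_ge_def Hom_zero_def ..

lemma presilting_iff: "presilting C T \<longleftrightarrow> silting_ge C T T"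
  unfolding presilting_def silting_ge_def ..

lemma silting_ge_retract_left: "retract C Y X \<Longrightarrow> silting_ge C X Z \<Longrightarrow> silting_ge C Y Z"
  unfolding silting_ge_iff using Hom_zero_retract_left by blast

lemma silting_ge_retract_right: "retract C Y X \<Longrightarrow> silting_ge C Z X \<Longrightarrow> silting_ge C Z Y"
  unfolding silting_ge_iff using Hom_zero_retract_right[OF retract_shift] by blast

lemma silting_ge_sum_left:
  "sum_diagram C I X Z i p \<Longrightarrow> silting_ge C X W \<longleftrightarrow> (\<forall>a\<in>I. silting_ge C (Z a) W)"
  using silting_ge_retract_left[OF sum_diagram_retract] Hom_zero_sum_left
  unfolding silting_ge_iff by metis

lemma silting_ge_sum_right:
  "sum_diagram C I X Z i p \<Longrightarrow> silting_ge C W X \<longleftrightarrow> (\<forall>a\<in>I. silting_ge C W (Z a))"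
  using silting_ge_retract_right[OF sum_diagram_retract] Hom_zero_sum_right[OF sum_diagram_shift]
  unfolding silting_ge_iff by metis

lemma biproduct_shift:
  assumes "biproduct C X Y Z" shows "biproduct C (shiftO n X) (shiftO n Y) (shiftO n Z)"
proof -
  obtain i j p q where *: "i \<in> mor C Y X" "j \<in> mor C Z X" "p \<in> mor C X Y" "q \<in> mor C X Z"
    "p \<cdot> i = ident C Y" "q \<cdot> j = ident C Z" "q \<cdot> i = zero_mor C Y Z" "p \<cdot> j = zero_mor C Z Y"
    "(i \<cdot> p) \<oplus>\<^bsub>HOM C X X\<^esub> (j \<cdot> q) = ident C X"
    using assms unfolding biproduct_def by blast
  have "shiftM n i \<cdot> shiftM n p \<oplus>\<^bsub>HOM C (shiftO n X) (shiftO n X)\<^esub> shiftM n j \<cdot> shiftM n q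
      = ident C (shiftO n X)"
    using shiftM_add[OF comp_closed[OF *(3,1)] comp_closed[OF *(4,2)], of n] *(9)
      shiftM_comp[OF *(3,1)] shiftM_comp[OF *(4,2)] shiftM_ident by simp
  moreover have "shiftM n p \<cdot> shiftM n i = ident C (shiftO n Y)" "shiftM n q \<cdot> shiftM n j = ident C (shiftO n Z)"
    "shiftM n q \<cdot> shiftM n i = zero_mor C (shiftO n Y) (shiftO n Z)"
    "shiftM n p \<cdot> shiftM n j = zero_mor C (shiftO n Z) (shiftO n Y)"
    using shiftM_comp[OF *(1,3), of n] shiftM_comp[OF *(2,4), of n] shiftM_comp[OF *(1,4), of n]
      shiftM_comp[OF *(2,3), of n] *(5-8) shiftM_ident shiftM_zero by simp_all
  ultimately show ?thesis unfolding biproduct_def using shiftM_closed *(1-4) by blast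
qed

lemma silting_ge_biproduct_left:
  assumes "biproduct C X Y Z" shows "silting_ge C X W \<longleftrightarrow> silting_ge C Y W \<and> silting_ge C Z W"
  using silting_ge_retract_left[OF biproduct_retract(1)[OF assms]]
    silting_ge_retract_left[OF biproduct_retract(2)[OF assms]] Hom_zero_biproduct_left[OF assms]
  unfolding silting_ge_iff by blast

lemma silting_ge_biproduct_right:
  assumes "biproduct C X Y Z" shows "silting_ge C W X \<longleftrightarrow> silting_ge C W Y \<and> silting_ge C W Z"
  using silting_ge_retract_right[OF biproduct_retract(1)[OF assms]]
    silting_ge_retract_right[OF biproduct_retract(2)[OF assms]]
    Hom_zero_biproduct_right[OF biproduct_shift[OF assms]]
  unfolding silting_ge_iff by blast

lemma Hom_zero_third_left:
  assumes tri: "dtri C X Y Z f g h" and "Hom_zero C Y A" "Hom_zero C (shift_ob C X) A"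
  shows "Hom_zero C Z A"
proof (rule Hom_zeroI)
  fix u assume u: "u \<in> mor C Z A"
  note m = dtri_mor[OF tri]
  have "u \<cdot> g = zero_mor C Y A" by (rule Hom_zeroD[OF assms(2) comp_closed[OF m(2) u]])
  then obtain v where v: "v \<in> mor C (shift_ob C X) A" "u = v \<cdot> h"
    using dtri_exact_contravariant[OF dtri_rotate[OF tri] u] by blast
  then show "u = zero_mor C Z A" using Hom_zeroD[OF assms(3) v(1)] comp_zero_left[OF m(3)] by simp
qed

text \<open>The objects \<open>X\<close> for which such an \<open>N\<close> exists form a thick subcategory containing \<open>T\<close>.\<close>

lemma silting_bounded:
  assumes "thick C T = UNIV"
  shows "\<exists>N. \<forall>Z\<in>below C T. \<forall>i>N. Hom_zero C X (shiftO i Z)"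
proof -
  define B where "B X N \<longleftrightarrow> (\<forall>Z\<in>below C T. \<forall>i>N. Hom_zero C X (shiftO i Z))" for X and N :: nat
  define S where "S = {X. \<exists>N. B X N}"
  have retr: "B Y N" if "retract C Y X" "B X N" for X Y N
    using that Hom_zero_retract_left unfolding B_def by blast
  have up: "B (shift_ob C X) (Suc N)" if B: "B X N" for X N
    unfolding B_def
  proof (intro ballI allI impI)
    fix Z i assume Z: "Z \<in> below C T" and i: "Suc N < i"
    then obtain k where k: "i = Suc k" "k > N" by (cases i) auto
    then have "Hom_zero C X (shiftO k Z)" using B Z unfolding B_def by blast
    then show "Hom_zero C (shift_ob C X) (shiftO i Z)" using Hom_zero_shift[of 1 X "shiftO k Z"] k(1) by simp
  qed
  have down: "B X N" if B: "B (shift_ob C X) N" for X N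
    unfolding B_def
  proof (intro ballI allI impI)
    fix Z i assume Z: "Z \<in> below C T" and i: "N < i"
    then have "Hom_zero C (shift_ob C X) (shiftO (Suc i) Z)" using B Z unfolding B_def by (meson less_SucI)
    then show "Hom_zero C X (shiftO i Z)" using Hom_zero_shift[of 1 X "shiftO i Z"] by simp
  qed
  have "thick_subcategory C S"
    unfolding thick_subcategory_def
  proof (intro conjI allI impI; (elim conjE)?)
    show "Z \<in> S" if "zero_object C Z" for Z
      using that unfolding S_def B_def zero_object_def Hom_zero_def by blast
    show "Y \<in> S" if "X \<in> S" "isomorphic C X Y" for X Y
      using that retr[OF isomorphic_retract[OF isomorphic_sym]] unfolding S_def by blast
    show "shift_ob C X \<in> S \<longleftrightarrow> X \<in> S" for X
      using up down unfolding S_def by blast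
    show "Y \<in> S" if "X \<in> S" "direct_summand C Y X" for X Y
      using that retr[OF biproduct_retract(1)] unfolding S_def direct_summand_def by blast
    show "Z \<in> S" if tri: "dtri C X Y Z f g h" and "X \<in> S" "Y \<in> S" for X Y Z f g h
    proof -
      obtain M N where "B X M" and N: "B Y N" using \<open>X \<in> S\<close> \<open>Y \<in> S\<close> unfolding S_def by blast
      have M: "B (shift_ob C X) (Suc M)" by (rule up[OF \<open>B X M\<close>])
      have "B Z (max (Suc M) N)"
        unfolding B_def
      proof (intro ballI allI impI)
        fix W i assume W: "W \<in> below C T" and i: "max (Suc M) N < i"
        have "Hom_zero C Y (shiftO i W)" "Hom_zero C (shift_ob C X) (shiftO i W)"
          using M N W i unfolding B_def by simp_all
        then show "Hom_zero C Z (shiftO i W)" by (rule Hom_zero_third_left[OF tri])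
      qed
      then show ?thesis unfolding S_def by blast
    qed
  qed
  moreover have "T \<in> S" unfolding S_def B_def below_def silting_ge_iff by blast
  ultimately have "X \<in> S" using assms unfolding thick_def by blast
  then show ?thesis unfolding S_def B_def by blast
qed

end

section \<open>Approximation triangles of a decomposed silting object\<close>

locale decomposed_silting = triangulated_category K C
  for K :: "'k ring" and C :: "('k, 'o, 'm, 'z) triangulated_data_scheme" (structure) +
  fixes T :: 'o and I :: "'i set" and Y :: "'i \<Rightarrow> 'o" and \<iota> \<pi> :: "'i \<Rightarrow> 'm"
  assumes finite_dimensional: "hom_finite K C"
    and T_silting: "silting C T"
    and decomposition: "sum_diagram C I T Y \<iota> \<pi>"
    and summand_local: "a \<in> I \<Longrightarrow> local_ring (End_ring C (Y a))"
begin

lemma finite_summands: "finite (Y ` I)"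
  using sum_diagramD(1)[OF decomposition] by simp

lemma fin_dim: "vectorspace.fin_dim K (HOM C X Z)"
  using finite_dimensional unfolding hom_finite_def by blast

lemma local: "Z \<in> Y ` I \<Longrightarrow> local_ring (End_ring C Z)"
  using summand_local by blast

lemma T_ge_T: "silting_ge C T T"
  using T_silting unfolding silting_def presilting_iff by blast

lemma summand_ge: "Z \<in> Y ` I \<Longrightarrow> silting_ge C T W \<Longrightarrow> silting_ge C Z W"
  using silting_ge_sum_left[OF decomposition] by blast

lemma ge_summand: "Z \<in> Y ` I \<Longrightarrow> silting_ge C W T \<Longrightarrow> silting_ge C W Z"
  using silting_ge_sum_right[OF decomposition] by blast

definition minimal_approximation ::
    "'o \<Rightarrow> ('o \<times> 'm) set \<Rightarrow> 'o \<Rightarrow> ('o \<times> 'm \<Rightarrow> 'm) \<Rightarrow> ('o \<times> 'm \<Rightarrow> 'm) \<Rightarrow> 'm \<Rightarrow> bool"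
  where "minimal_approximation U G A i p f \<longleftrightarrow> sum_diagram C G A fst i p \<and> fst ` G \<subseteq> Y ` I \<and>
    f \<in> mor C A U \<and> (\<forall>Z\<in>Y ` I. \<forall>x\<in>mor C Z U. \<exists>y\<in>mor C Z A. x = f \<cdot> y) \<and>
    (\<forall>Z r g. r \<in> mor C Z A \<and> f \<cdot> r = zero_mor C Z U \<and> g \<in> G \<longrightarrow> \<not> iso_mor C Z (fst g) (p g \<cdot> r))"

lemma minimal_approximationD:
  assumes "minimal_approximation U G A i p f"
  shows "sum_diagram C G A fst i p" "fst ` G \<subseteq> Y ` I" "f \<in> mor C A U"
    "Z \<in> Y ` I \<Longrightarrow> x \<in> mor C Z U \<Longrightarrow> \<exists>y\<in>mor C Z A. x = f \<cdot> y"
    "r \<in> mor C Z A \<Longrightarrow> f \<cdot> r = zero_mor C Z U \<Longrightarrow> g \<in> G \<Longrightarrow> \<not> iso_mor C Z (fst g) (p g \<cdot> r)"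
  using assms unfolding minimal_approximation_def by blast+

lemma ex_minimal_approximation: "\<exists>G A i p f. minimal_approximation U G A i p f"
proof -
  obtain G :: "('o \<times> 'm) set" and A i p f where "sum_diagram C G A fst i p" "fst ` G \<subseteq> Y ` I"
    "f \<in> mor C A U" "\<And>Z x. Z \<in> Y ` I \<Longrightarrow> x \<in> mor C Z U \<Longrightarrow> \<exists>y\<in>mor C Z A. x = f \<cdot> y"
    "\<And>Z r g. r \<in> mor C Z A \<Longrightarrow> f \<cdot> r = zero_mor C Z U \<Longrightarrow> g \<in> G \<Longrightarrow> \<not> iso_mor C Z (fst g) (p g \<cdot> r)"
    using ex_minimal_right_approximation[OF finite_summands fin_dim, of U] by blast
  then have "minimal_approximation U G A i p f" unfolding minimal_approximation_def by blast
  then show ?thesis by blast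
qed

text \<open>A morphism \<open>Y \<rightarrow> U'[1]\<close> comes from a morphism \<open>Y \<rightarrow> U\<close>, and that one factors through the
  approximation.\<close>

lemma approximation_cocone_below:
  assumes approx: "minimal_approximation U G A i p f" and tri: "dtri C U' A U e f h"
    and U: "silting_ge C T U"
  shows "silting_ge C T U'"
  unfolding silting_ge_sum_left[OF decomposition]
proof
  fix a assume "a \<in> I"
  then have Y: "Y a \<in> Y ` I" by blast
  note ap = minimal_approximationD[OF approx] and m = dtri_mor[OF tri]
  note rot = dtri_rotate[OF tri]
  have "silting_ge C (Y a) (fst g)" if "g \<in> G" for g
    using summand_ge[OF Y ge_summand[OF _ T_ge_T]] ap(2) that by blast
  then have YA: "silting_ge C (Y a) A" unfolding silting_ge_sum_right[OF ap(1)] by blast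
  have YU: "silting_ge C (Y a) U" by (rule summand_ge[OF Y U])
  show "silting_ge C (Y a) U'"
    unfolding silting_ge_iff
  proof (intro allI impI)
    fix l :: nat assume "0 < l"
    then obtain k where k: "l = Suc k" by (cases l) auto
    have A0: "Hom_zero C (Y a) (shiftO (Suc k) A)" using YA unfolding silting_ge_iff by blast
    have "Hom_zero C (Y a) (shiftO k (shift_ob C U'))"
    proof (cases "k = 0")
      case False
      then have "Hom_zero C (Y a) (shiftO k U)" using YU unfolding silting_ge_iff by blast
      then show ?thesis by (rule Hom_zero_third[OF rot _ A0])
    next
      case True
      show ?thesis
      proof (rule Hom_zeroI)
        fix u assume "u \<in> mor C (Y a) (shiftO k (shift_ob C U'))"
        then have u: "u \<in> mor C (Y a) (shift_ob C U')" using True by simp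
        note m' = dtri_mor[OF dtri_rotate[OF rot]]
        have "(\<ominus>\<^bsub>HOM C (shift_ob C U') (shift_ob C A)\<^esub> shift_mor C e) \<cdot> u = zero_mor C (Y a) (shift_ob C A)"
          using Hom_zeroD[OF A0] True comp_closed[OF u m'(2)] by simp
        then obtain v where v: "v \<in> mor C (Y a) U" "u = h \<cdot> v"
          using dtri_exact_covariant_unshifted[OF dtri_rotate[OF rot] u] by blast
        then obtain w where w: "w \<in> mor C (Y a) A" "v = f \<cdot> w" using ap(4)[OF Y] by blast
        have "u = (h \<cdot> f) \<cdot> w" using v(2) w(2) comp_assoc[OF w(1) m(2,3)] by simp
        then show "u = zero_mor C (Y a) (shiftO k (shift_ob C U'))"
          using dtri_comp_zero[OF rot] comp_zero_left[OF w(1)] True by simp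
      qed
    qed
    then show "Hom_zero C (Y a) (shiftO l U')" unfolding shiftO_shift k .
  qed
qed

lemma ex_approximation_triangle:
  assumes U: "silting_ge C T U"
  obtains G A i p f U' e h where "minimal_approximation U G A i p f" "dtri C U' A U e f h"
    "silting_ge C T U'"
proof -
  obtain G A i p f where approx: "minimal_approximation U G A i p f" using ex_minimal_approximation by blast
  obtain U' e h where "dtri C U' A U e f h" using ex_cocone[OF minimal_approximationD(3)[OF approx]] by blast
  then show thesis using that[OF approx] approximation_cocone_below[OF approx _ U] by blast
qed

lemma approximation_lift:
  assumes tri: "dtri C Z' A Z e f h" and Z': "Hom_zero C U (shiftO (Suc n) Z')"
    and u: "u \<in> mor C U (shiftO n Z)"
  obtains v where "v \<in> mor C U (shiftO n A)" "u = shiftM n f \<cdot> v"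
proof -
  note m = dtri_mor[OF tri]
  have "shiftM n h \<cdot> u = zero_mor C U (shiftO n (shift_ob C Z'))"
    using Hom_zeroD[OF Z'] comp_closed[OF u shiftM_closed[OF m(3)]] unfolding shiftO_shift by blast
  then show thesis using dtri_exact_covariant[OF dtri_rotate[OF tri] u] that by blast
qed

end


section \<open>The radical argument\<close>

context decomposed_silting
begin

text \<open>Write \<open>U' \<rightarrow> A \<rightarrow> U\<close> for the approximation triangle. A morphism \<open>U \<rightarrow> Z[n]\<close> into a summand
  \<open>Z\<close> of \<open>A\<close> dies in \<open>U[n]\<close> because \<open>U\<close> is presilting, so it comes from \<open>U \<rightarrow> U'[n]\<close>, which lifts
  to an approximation of \<open>U'\<close>. Minimality makes the comparison map between the two
  approximations radical.\<close>

lemma radical_factorization: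
  assumes approx: "minimal_approximation U G A i p f" and tri: "dtri C U' A U e f h"
    and U': "silting_ge C T U'" and UU: "Hom_zero C U (shiftO n U)"
    and van: "\<And>Z. silting_ge C T Z \<Longrightarrow> Hom_zero C U (shiftO (Suc n) Z)"
    and b: "b \<in> G" "isomorphic C Z (fst b)" and u: "u \<in> mor C U (shiftO n Z)"
  obtains G' :: "('o \<times> 'm) set" and A' j q t w
  where "sum_diagram C G' A' fst j q" "fst ` G' \<subseteq> Y ` I" "t \<in> mor C A' Z"
    "w \<in> mor C U (shiftO n A')" "u = shiftM n t \<cdot> w"
    "\<And>g. g \<in> G' \<Longrightarrow> \<not> iso_mor C (fst g) Z (t \<cdot> j g)"
proof -
  note ap = minimal_approximationD[OF approx] and m = dtri_mor[OF tri]
  note D = sum_diagramD[OF ap(1)]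
  obtain \<psi> where iso: "iso_mor C Z (fst b) \<psi>" using b(2) unfolding isomorphic_def by blast
  then obtain \<psi>' where \<psi>: "\<psi> \<in> mor C Z (fst b)" "\<psi>' \<in> mor C (fst b) Z" "\<psi>' \<cdot> \<psi> = ident C Z"
    "\<psi> \<cdot> \<psi>' = ident C (fst b)" by (rule iso_morE)
  define s where "s = i b \<cdot> \<psi>"
  define k where "k = \<psi>' \<cdot> p b"
  have s: "s \<in> mor C Z A" unfolding s_def by (rule comp_closed[OF \<psi>(1) D(2)[OF b(1)]])
  have k: "k \<in> mor C A Z" unfolding k_def by (rule comp_closed[OF D(3)[OF b(1)] \<psi>(2)])
  have ks: "k \<cdot> s = ident C Z"
    unfolding k_def s_def
    using comp_cancel_middle[OF \<psi>(1) D(2)[OF b(1)] D(3)[OF b(1)] \<psi>(2) D(4)[OF b(1)]] \<psi>(3) by simp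
  have su: "shiftM n s \<cdot> u \<in> mor C U (shiftO n A)" by (rule comp_closed[OF u shiftM_closed[OF s]])
  have "shiftM n f \<cdot> (shiftM n s \<cdot> u) = zero_mor C U (shiftO n U)"
    by (rule Hom_zeroD[OF UU comp_closed[OF su shiftM_closed[OF m(2)]]])
  then obtain v where v: "v \<in> mor C U (shiftO n U')" "shiftM n s \<cdot> u = shiftM n e \<cdot> v"
    using dtri_exact_covariant[OF tri su] by blast
  obtain G' A' j q f' U'' e' h' where approx': "minimal_approximation U' G' A' j q f'"
    and tri': "dtri C U'' A' U' e' f' h'" and U'': "silting_ge C T U''"
    using ex_approximation_triangle[OF U'] by blast
  note ap' = minimal_approximationD[OF approx'] and m' = dtri_mor[OF tri']
  obtain w where w: "w \<in> mor C U (shiftO n A')" "v = shiftM n f' \<cdot> w"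
    by (rule approximation_lift[OF tri' van[OF U''] v(1)])
  define x where "x = e \<cdot> f'"
  have x: "x \<in> mor C A' A" unfolding x_def by (rule comp_closed[OF m'(2) m(1)])
  have fx: "f \<cdot> x = zero_mor C A' U"
    unfolding x_def using comp_assoc[OF m'(2) m(1,2)] dtri_comp_zero[OF tri] comp_zero_left[OF m'(2)] by simp
  have xw: "shiftM n x \<cdot> w = shiftM n s \<cdot> u"
    unfolding x_def using shiftM_comp[OF m'(2) m(1)] v(2) w(2)
      comp_assoc[OF w(1) shiftM_closed[OF m'(2)] shiftM_closed[OF m(1)]] by simp
  have kx: "k \<cdot> x \<in> mor C A' Z" by (rule comp_closed[OF x k])
  have "shiftM n (k \<cdot> x) \<cdot> w = shiftM n k \<cdot> (shiftM n s \<cdot> u)"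
    using shiftM_comp[OF x k] comp_assoc[OF w(1) shiftM_closed[OF x] shiftM_closed[OF k]] xw by simp
  also have "\<dots> = u"
    using comp_assoc[OF u shiftM_closed[OF s] shiftM_closed[OF k]] shiftM_comp[OF s k] ks shiftM_ident
      ident_left[OF u] by simp
  finally have uw: "u = shiftM n (k \<cdot> x) \<cdot> w" by simp
  have "\<not> iso_mor C (fst g) Z ((k \<cdot> x) \<cdot> j g)" if g: "g \<in> G'" for g
  proof
    assume iso': "iso_mor C (fst g) Z ((k \<cdot> x) \<cdot> j g)"
    have jg: "j g \<in> mor C (fst g) A'" by (rule sum_diagramD(2)[OF ap'(1) g])
    have xj: "x \<cdot> j g \<in> mor C (fst g) A" by (rule comp_closed[OF jg x])
    have "f \<cdot> (x \<cdot> j g) = zero_mor C (fst g) U"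
      using comp_assoc[OF jg x m(2)] fx comp_zero_left[OF jg] by simp
    then have "\<not> iso_mor C (fst g) (fst b) (p b \<cdot> (x \<cdot> j g))" by (rule ap(5)[OF xj _ b(1)])
    moreover have "\<psi> \<cdot> ((k \<cdot> x) \<cdot> j g) = p b \<cdot> (x \<cdot> j g)"
    proof -
      have pxj: "p b \<cdot> (x \<cdot> j g) \<in> mor C (fst g) (fst b)" by (rule comp_closed[OF xj D(3)[OF b(1)]])
      have "(k \<cdot> x) \<cdot> j g = \<psi>' \<cdot> (p b \<cdot> (x \<cdot> j g))"
        unfolding k_def
        using comp_assoc[OF jg x comp_closed[OF D(3)[OF b(1)] \<psi>(2)]] comp_assoc[OF xj D(3)[OF b(1)] \<psi>(2)] by simp
      then show ?thesis using comp_assoc[OF pxj \<psi>(2,1)] \<psi>(4) ident_left[OF pxj] by simp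
    qed
    ultimately show False using iso_mor_comp[OF iso' iso] by simp
  qed
  then show thesis using that[OF ap'(1,2) kx w(1) uw] by blast
qed

text \<open>Nakayama's lemma for the functor \<open>Hom(U, -[n])\<close> on the summands of \<open>T\<close>: a functor that equals
  its own radical vanishes. In terms of a minimal generating set, expressing a generator by radical
  multiples of all generators is a relation in which that generator has an invertible coefficient.\<close>

lemma nakayama:
  assumes rad: "\<And>Z u. Z \<in> Y ` I \<Longrightarrow> u \<in> mor C U (shiftO n Z) \<Longrightarrow>
      \<exists>(G' :: ('o \<times> 'm) set) A' j q t w. sum_diagram C G' A' fst j q \<and> fst ` G' \<subseteq> Y ` I \<and> t \<in> mor C A' Z \<and>
        w \<in> mor C U (shiftO n A') \<and> u = shiftM n t \<cdot> w \<and>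
        (\<forall>g\<in>G'. \<not> iso_mor C (fst g) Z (t \<cdot> j g))"
    and Z: "Z \<in> Y ` I"
  shows "Hom_zero C U (shiftO n Z)"
proof -
  note R = shifted_Hom_module[of U n]
  note defs = cat_module.coefficients_def[OF R] cat_module.combination_def[OF R]
    cat_module.generating_def[OF R]
  obtain G where G: "cat_module.generating C (\<lambda>Z. HOM C U (shiftO n Z)) (\<lambda>c x. shiftM n c \<cdot> x) (Y ` I) G"
    and min: "\<And>Z c g. cat_module.coefficients C G Z c \<Longrightarrow>
      cat_module.combination (\<lambda>Z. HOM C U (shiftO n Z)) (\<lambda>c x. shiftM n c \<cdot> x) G Z c = zero_mor C U (shiftO n Z) \<Longrightarrow>
      g \<in> G \<Longrightarrow> \<not> iso_mor C (fst g) Z (c g)"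
    using cat_module.ex_minimal_generating[OF R finite_summands fin_dim] by blast
  have fin: "finite G" and GY: "\<And>g. g \<in> G \<Longrightarrow> fst g \<in> Y ` I"
    and sg: "\<And>g. g \<in> G \<Longrightarrow> snd g \<in> mor C U (shiftO n (fst g))"
    and gen: "\<And>Z x. Z \<in> Y ` I \<Longrightarrow> x \<in> mor C U (shiftO n Z) \<Longrightarrow>
      \<exists>c. (\<forall>g\<in>G. c g \<in> mor C (fst g) Z) \<and> x = (\<Oplus>\<^bsub>HOM C U (shiftO n Z)\<^esub> g\<in>G. shiftM n (c g) \<cdot> snd g)"
    using G unfolding defs by auto
  \<comment> \<open>The generators are the components of one morphism \<open>y\<close> through which everything factors.\<close>
  obtain B i p where S: "sum_diagram C G B fst i p" using ex_sum[OF fin] by blast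
  note D = sum_diagramD[OF S] and Sn = sum_diagram_shift[OF S, of n]
  obtain y where y: "y \<in> mor C U (shiftO n B)" "\<And>g. g \<in> G \<Longrightarrow> shiftM n (p g) \<cdot> y = snd g"
    using sum_diagram_pair[OF Sn sg] by blast
  have expand: "shiftM n c \<cdot> y = (\<Oplus>\<^bsub>HOM C U (shiftO n W)\<^esub> g\<in>G. shiftM n (c \<cdot> i g) \<cdot> snd g)"
    if c: "c \<in> mor C B W" for c W
    unfolding sum_diagram_comp[OF Sn shiftM_closed[OF c] y(1)]
  proof (rule hom.finsum_cong'[OF refl])
    show "(\<lambda>g. shiftM n (c \<cdot> i g) \<cdot> snd g) \<in> G \<rightarrow> mor C U (shiftO n W)"
      using comp_closed[OF sg shiftM_closed[OF comp_closed[OF D(2) c]]] by blast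
    show "(shiftM n c \<cdot> shiftM n (i g)) \<cdot> (shiftM n (p g) \<cdot> y) = shiftM n (c \<cdot> i g) \<cdot> snd g"
      if g: "g \<in> G" for g
      unfolding shiftM_comp[OF D(2)[OF g] c] y(2)[OF g] ..
  qed
  have factor: "\<exists>c\<in>mor C B W. x = shiftM n c \<cdot> y" if W: "W \<in> Y ` I" and x: "x \<in> mor C U (shiftO n W)" for W x
  proof -
    obtain c where c: "\<And>g. g \<in> G \<Longrightarrow> c g \<in> mor C (fst g) W"
      "x = (\<Oplus>\<^bsub>HOM C U (shiftO n W)\<^esub> g\<in>G. shiftM n (c g) \<cdot> snd g)" using gen[OF W x] by blast
    obtain d where d: "d \<in> mor C B W" "\<And>g. g \<in> G \<Longrightarrow> d \<cdot> i g = c g"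
      using sum_diagram_copair[OF S c(1)] by blast
    have "x = shiftM n d \<cdot> y" unfolding expand[OF d(1)] c(2)
      using d(2) comp_closed[OF sg shiftM_closed[OF c(1)]] by (intro hom.finsum_cong') auto
    then show ?thesis using d(1) by blast
  qed
  have "G = {}"
  proof (rule ccontr)
    assume "G \<noteq> {}"
    then obtain a where a: "a \<in> G" by blast
    note loc = local[OF GY[OF a]]
    obtain G' :: "('o \<times> 'm) set" and A' j q t w where S': "sum_diagram C G' A' fst j q"
      and G'Y: "fst ` G' \<subseteq> Y ` I" and t: "t \<in> mor C A' (fst a)" and w: "w \<in> mor C U (shiftO n A')"
      and aw: "snd a = shiftM n t \<cdot> w" and noniso: "\<And>g. g \<in> G' \<Longrightarrow> \<not> iso_mor C (fst g) (fst a) (t \<cdot> j g)"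
      using rad[OF GY[OF a] sg[OF a]] by (elim exE conjE) (rule that, assumption+, blast)
    note D' = sum_diagramD[OF S'] and S'n = sum_diagram_shift[OF S', of n]
    have "\<exists>c\<in>mor C B (fst g). shiftM n (q g) \<cdot> w = shiftM n c \<cdot> y" if g: "g \<in> G'" for g
      using factor[of "fst g" "shiftM n (q g) \<cdot> w"] G'Y g comp_closed[OF w shiftM_closed[OF D'(3)[OF g]]] by blast
    then obtain c where c: "\<And>g. g \<in> G' \<Longrightarrow> c g \<in> mor C B (fst g)"
      "\<And>g. g \<in> G' \<Longrightarrow> shiftM n (q g) \<cdot> w = shiftM n (c g) \<cdot> y" by metis
    obtain d where d: "d \<in> mor C B A'" "\<And>g. g \<in> G' \<Longrightarrow> q g \<cdot> d = c g"
      using sum_diagram_pair[OF S' c(1)] by blast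
    have wd: "w = shiftM n d \<cdot> y"
    proof (rule sum_diagram_eq_to[OF S'n w comp_closed[OF y(1) shiftM_closed[OF d(1)]]])
      fix g assume g: "g \<in> G'"
      have "shiftM n (q g) \<cdot> (shiftM n d \<cdot> y) = shiftM n (c g) \<cdot> y"
        using comp_assoc[OF y(1) shiftM_closed[OF d(1)] shiftM_closed[OF D'(3)[OF g]]]
          shiftM_comp[OF d(1) D'(3)[OF g]] d(2)[OF g] by simp
      then show "shiftM n (q g) \<cdot> w = shiftM n (q g) \<cdot> (shiftM n d \<cdot> y)" using c(2)[OF g] by simp
    qed
    have td: "t \<cdot> d \<in> mor C B (fst a)" by (rule comp_closed[OF d(1) t])
    \<comment> \<open>The relation: the generator at \<open>a\<close> minus its expression by radical multiples.\<close>
    define k where "k = p a \<oplus>\<^bsub>HOM C B (fst a)\<^esub> (\<ominus>\<^bsub>HOM C B (fst a)\<^esub> (t \<cdot> d))"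
    have ntd: "\<ominus>\<^bsub>HOM C B (fst a)\<^esub> (t \<cdot> d) \<in> mor C B (fst a)" by (rule hom.a_inv_closed[OF td])
    have k: "k \<in> mor C B (fst a)" unfolding k_def using D(3)[OF a] ntd by simp
    have "shiftM n (t \<cdot> d) \<cdot> y = snd a"
      unfolding aw wd using comp_assoc[OF y(1) shiftM_closed[OF d(1)] shiftM_closed[OF t]] shiftM_comp[OF d(1) t] by simp
    then have "shiftM n k \<cdot> y = snd a \<oplus>\<^bsub>HOM C U (shiftO n (fst a))\<^esub> (\<ominus>\<^bsub>HOM C U (shiftO n (fst a))\<^esub> snd a)"
      unfolding k_def shiftM_add[OF D(3)[OF a] ntd] shiftM_minus[OF td]
      using comp_add_left[OF y(1) shiftM_closed[OF D(3)[OF a]] hom.a_inv_closed[OF shiftM_closed[OF td]]]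
        comp_minus_left[OF y(1) shiftM_closed[OF td]] y(2)[OF a] by simp
    then have "shiftM n k \<cdot> y = zero_mor C U (shiftO n (fst a))" using sg[OF a] by (simp add: hom.r_neg)
    then have ka: "\<not> iso_mor C (fst a) (fst a) (k \<cdot> i a)"
      using min[of "fst a" "\<lambda>g. k \<cdot> i g" a] a comp_closed[OF D(2) k] expand[OF k] unfolding defs by simp
    have tdi: "(t \<cdot> d) \<cdot> i a \<in> mor C (fst a) (fst a)" by (rule comp_closed[OF D(2)[OF a] td])
    have "(t \<cdot> d) \<cdot> i a = t \<cdot> (d \<cdot> i a)" by (rule comp_assoc[OF D(2)[OF a] d(1) t])
    also have "\<dots> = (\<Oplus>\<^bsub>HOM C (fst a) (fst a)\<^esub> g\<in>G'. (t \<cdot> j g) \<cdot> (q g \<cdot> (d \<cdot> i a)))"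
      by (rule sum_diagram_comp[OF S' t comp_closed[OF D(2)[OF a] d(1)]])
    finally have sum: "(t \<cdot> d) \<cdot> i a = \<dots>" .
    have tda: "\<not> iso_mor C (fst a) (fst a) ((t \<cdot> d) \<cdot> i a)"
      unfolding sum
    proof (rule local_noniso_finsum[OF loc])
      fix g assume g: "g \<in> G'"
      have tj: "t \<cdot> j g \<in> mor C (fst g) (fst a)" by (rule comp_closed[OF D'(2)[OF g] t])
      have qd: "q g \<cdot> (d \<cdot> i a) \<in> mor C (fst a) (fst g)"
        by (rule comp_closed[OF comp_closed[OF D(2)[OF a] d(1)] D'(3)[OF g]])
      show "(t \<cdot> j g) \<cdot> (q g \<cdot> (d \<cdot> i a)) \<in> mor C (fst a) (fst a)" by (rule comp_closed[OF qd tj])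
      show "\<not> iso_mor C (fst a) (fst a) ((t \<cdot> j g) \<cdot> (q g \<cdot> (d \<cdot> i a)))"
      proof
        assume *: "iso_mor C (fst a) (fst a) ((t \<cdot> j g) \<cdot> (q g \<cdot> (d \<cdot> i a)))"
        have locg: "local_ring (End_ring C (fst g))" using local G'Y g by blast
        obtain v where v: "v \<in> mor C (fst a) (fst a)" "((t \<cdot> j g) \<cdot> (q g \<cdot> (d \<cdot> i a))) \<cdot> v = ident C (fst a)"
          using * by (rule iso_morE)
        have "(t \<cdot> j g) \<cdot> ((q g \<cdot> (d \<cdot> i a)) \<cdot> v) = ident C (fst a)"
          using comp_assoc[OF v(1) qd tj] v(2) by simp
        then have "iso_mor C (fst g) (fst a) (t \<cdot> j g)"
          by (rule split_mono_local_iso(2)[OF loc locg comp_closed[OF v(1) qd] tj])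
        then show False using noniso[OF g] by blast
      qed
    qed
    have ki: "k \<cdot> i a = ident C (fst a) \<oplus>\<^bsub>HOM C (fst a) (fst a)\<^esub> (\<ominus>\<^bsub>HOM C (fst a) (fst a)\<^esub> ((t \<cdot> d) \<cdot> i a))"
      unfolding k_def using comp_add_left[OF D(2)[OF a] D(3)[OF a] ntd] comp_minus_left[OF D(2)[OF a] td] D(4)[OF a]
      by simp
    have "k \<cdot> i a \<oplus>\<^bsub>HOM C (fst a) (fst a)\<^esub> (t \<cdot> d) \<cdot> i a = ident C (fst a)"
      unfolding ki using tdi ident_closed[of "fst a"] by (simp add: hom.a_assoc hom.l_neg)
    then show False
      using local_noniso_add[OF loc comp_closed[OF D(2)[OF a] k] tdi ka tda] iso_mor_ident[of "fst a"] by simp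
  qed
  then show ?thesis using gen[OF Z] by (intro Hom_zeroI) auto
qed

text \<open>For some \<open>N\<close> there are no morphisms \<open>U \<rightarrow> Z[i]\<close> with \<open>Z\<close> below \<open>T\<close> and \<open>i > N\<close>. The two previous
  lemmas lower \<open>N\<close> to \<open>0\<close>.\<close>

lemma ge_T_if_all_summands_occur:
  assumes U: "presilting C U" and TU: "silting_ge C T U"
    and approx: "minimal_approximation U G A i p f"
    and all: "\<And>Z. Z \<in> Y ` I \<Longrightarrow> \<exists>g\<in>G. isomorphic C Z (fst g)"
  shows "silting_ge C U T"
proof -
  obtain U' e h where tri: "dtri C U' A U e f h" using ex_cocone[OF minimal_approximationD(3)[OF approx]] by blast
  have U': "silting_ge C T U'" by (rule approximation_cocone_below[OF approx tri TU])
  have step: "Hom_zero C U (shiftO n Z)"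
    if n: "n > 0" and van: "\<And>Z. silting_ge C T Z \<Longrightarrow> Hom_zero C U (shiftO (Suc n) Z)" and Z: "silting_ge C T Z"
    for n Z
  proof -
    have UU: "Hom_zero C U (shiftO n U)" using U n unfolding presilting_iff silting_ge_iff by blast
    have summands: "Hom_zero C U (shiftO n W)" if "W \<in> Y ` I" for W
    proof (rule nakayama[OF _ that])
      fix W u assume W: "W \<in> Y ` I" and u: "u \<in> mor C U (shiftO n W)"
      obtain b where b: "b \<in> G" "isomorphic C W (fst b)" using all[OF W] by blast
      show "\<exists>(G' :: ('o \<times> 'm) set) A' j q t w. sum_diagram C G' A' fst j q \<and> fst ` G' \<subseteq> Y ` I \<and> t \<in> mor C A' W \<and>
        w \<in> mor C U (shiftO n A') \<and> u = shiftM n t \<cdot> w \<and>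
        (\<forall>g\<in>G'. \<not> iso_mor C (fst g) W (t \<cdot> j g))"
        by (rule radical_factorization[OF approx tri U' UU van b u]) blast+
    qed
    obtain G1 A1 i1 p1 f1 Z1 e1 h1 where approx1: "minimal_approximation Z G1 A1 i1 p1 f1"
      and tri1: "dtri C Z1 A1 Z e1 f1 h1" and Z1: "silting_ge C T Z1"
      using ex_approximation_triangle[OF Z] by blast
    note ap1 = minimal_approximationD[OF approx1] and m1 = dtri_mor[OF tri1]
    have A1: "Hom_zero C U (shiftO n A1)"
      by (rule Hom_zero_sum_right[OF sum_diagram_shift[OF ap1(1)]]) (use summands ap1(2) in blast)
    show ?thesis
    proof (rule Hom_zeroI)
      fix u assume u: "u \<in> mor C U (shiftO n Z)"
      obtain v where v: "v \<in> mor C U (shiftO n A1)" "u = shiftM n f1 \<cdot> v"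
        by (rule approximation_lift[OF tri1 van[OF Z1] u])
      then show "u = zero_mor C U (shiftO n Z)"
        using Hom_zeroD[OF A1 v(1)] comp_zero_right[OF shiftM_closed[OF m1(2)]] by simp
    qed
  qed
  obtain N where N: "\<forall>Z\<in>below C T. \<forall>i>N. Hom_zero C U (shiftO i Z)"
    using silting_bounded T_silting unfolding silting_def by blast
  have "\<forall>Z\<in>below C T. \<forall>i>0. Hom_zero C U (shiftO i Z)"
    using N
  proof (induction N)
    case (Suc N)
    have "Hom_zero C U (shiftO i Z)" if Z: "Z \<in> below C T" and i: "i > N" for Z i
    proof (cases "i = Suc N")
      case True
      have "Hom_zero C U (shiftO (Suc (Suc N)) W)" if "silting_ge C T W" for W
        using Suc.prems that unfolding below_def by blast
      then show ?thesis using step[OF zero_less_Suc] Z True unfolding below_def by blast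
    next
      case False
      then show ?thesis using Suc.prems Z i by simp
    qed
    then show ?case using Suc.IH by blast
  qed
  then show ?thesis using T_ge_T unfolding silting_ge_iff[of U] below_def by blast
qed

end

section \<open>Mutation\<close>

context triangulated_category
begin

lemma silting_ge_shift: "silting_ge C M N \<Longrightarrow> Hom_zero C M (shift_ob C N)"
  unfolding silting_ge_iff by (elim allE[of _ 1]) simp

lemma Hom_zero_second_left:
  assumes tri: "dtri C X Y Z f g h" and "Hom_zero C X A" "Hom_zero C Z A"
  shows "Hom_zero C Y A"
proof (rule Hom_zeroI)
  fix u assume u: "u \<in> mor C Y A"
  note m = dtri_mor[OF tri]
  have "u \<cdot> f = zero_mor C X A" by (rule Hom_zeroD[OF assms(2) comp_closed[OF m(1) u]])
  then obtain v where v: "v \<in> mor C Z A" "u = v \<cdot> g"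
    using dtri_exact_contravariant[OF tri u] by blast
  then show "u = zero_mor C Y A" using Hom_zeroD[OF assms(3) v(1)] comp_zero_left[OF m(2)] by simp
qed

lemma retract_trans:
  assumes "retract C X Y" "retract C Y Z" shows "retract C X Z"
proof -
  obtain s r where sr: "s \<in> mor C X Y" "r \<in> mor C Y X" "r \<cdot> s = ident C X"
    using assms(1) by (rule retractE)
  obtain s' r' where sr': "s' \<in> mor C Y Z" "r' \<in> mor C Z Y" "r' \<cdot> s' = ident C Y"
    using assms(2) by (rule retractE)
  have "(r \<cdot> r') \<cdot> (s' \<cdot> s) = ident C X" using comp_cancel_middle[OF sr(1) sr'(1,2) sr(2) sr'(3)] sr(3) by simp
  then show ?thesis unfolding retract_def using comp_closed[OF sr(1) sr'(1)] comp_closed[OF sr'(2) sr(2)] by blast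
qed

text \<open>A morphism \<open>E \<rightarrow> W[1]\<close> comes from a morphism \<open>T \<rightarrow> W\<close>, and it vanishes if that one extends
  along \<open>l\<close>.\<close>

lemma silting_ge_cone:
  assumes tri: "dtri C T B E l g h" and TW: "silting_ge C T W" and BW: "silting_ge C B W"
    and extend: "\<And>w. w \<in> mor C T W \<Longrightarrow> \<exists>y\<in>mor C B W. w = y \<cdot> l"
  shows "silting_ge C E W"
  unfolding silting_ge_iff
proof (intro allI impI)
  fix n :: nat assume "0 < n"
  then obtain k where k: "n = Suc k" by (cases n) auto
  have B0: "Hom_zero C B (shiftO n W)" using BW \<open>0 < n\<close> unfolding silting_ge_iff by blast
  note m = dtri_mor[OF tri]
  show "Hom_zero C E (shiftO n W)"
  proof (cases "k = 0")
    case False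
    then have "Hom_zero C T (shiftO k W)" using TW unfolding silting_ge_iff by blast
    then have "Hom_zero C (shift_ob C T) (shiftO n W)" using Hom_zero_shift[of 1 T "shiftO k W"] k by simp
    then show ?thesis by (rule Hom_zero_third_left[OF tri B0])
  next
    case True
    then have n: "shiftO n W = shift_ob C W" using k by simp
    show ?thesis
      unfolding n
    proof (rule Hom_zeroI)
      fix u assume u: "u \<in> mor C E (shift_ob C W)"
      have "u \<cdot> g = zero_mor C B (shift_ob C W)" by (rule Hom_zeroD[OF B0[unfolded n] comp_closed[OF m(2) u]])
      then obtain v where v: "v \<in> mor C (shift_ob C T) (shift_ob C W)" "u = v \<cdot> h"
        using dtri_exact_contravariant[OF dtri_rotate[OF tri] u] by blast
      obtain w where w: "w \<in> mor C T W" "v = shift_mor C w" using shiftM_full[of v 1 T W] v(1) by auto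
      obtain y where y: "y \<in> mor C B W" "w = y \<cdot> l" using extend[OF w(1)] by blast
      let ?nl = "\<ominus>\<^bsub>HOM C (shift_ob C T) (shift_ob C B)\<^esub> shift_mor C l"
      have Sl: "shift_mor C l \<in> mor C (shift_ob C T) (shift_ob C B)" and Sy: "shift_mor C y \<in> mor C (shift_ob C B) (shift_ob C W)"
        using shiftM_closed[OF m(1), of 1] shiftM_closed[OF y(1), of 1] by simp_all
      have "?nl \<cdot> h = zero_mor C E (shift_ob C B)" by (rule dtri_comp_zero[OF dtri_rotate[OF dtri_rotate[OF tri]]])
      moreover have "?nl \<cdot> h = \<ominus>\<^bsub>HOM C E (shift_ob C B)\<^esub> (shift_mor C l \<cdot> h)" by (rule comp_minus_left[OF m(3) Sl])
      moreover have "shift_mor C l \<cdot> h = \<ominus>\<^bsub>HOM C E (shift_ob C B)\<^esub> (\<ominus>\<^bsub>HOM C E (shift_ob C B)\<^esub> (shift_mor C l \<cdot> h))"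
        by (rule hom.minus_minus[OF comp_closed[OF m(3) Sl], symmetric])
      ultimately have "shift_mor C l \<cdot> h = \<ominus>\<^bsub>HOM C E (shift_ob C B)\<^esub> zero_mor C E (shift_ob C B)" by simp
      then have lh: "shift_mor C l \<cdot> h = zero_mor C E (shift_ob C B)" by simp
      have "u = (shift_mor C y \<cdot> shift_mor C l) \<cdot> h" using v(2) w(2) y(2) shift_comp[OF m(1) y(1)] by simp
      also have "\<dots> = shift_mor C y \<cdot> (shift_mor C l \<cdot> h)" by (rule comp_assoc[OF m(3) Sl Sy])
      also have "\<dots> = zero_mor C E (shift_ob C W)" unfolding lh by (rule comp_zero_right[OF Sy])
      finally show "u = zero_mor C E (shift_ob C W)" .
    qed
  qed
qed

end

context decomposed_silting
begin

text \<open>The silting mutation of \<open>T\<close> at the summands that do not occur in the approximation of \<open>U\<close>: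
  \<open>A\<close> is kept, and \<open>T\<close> is replaced by the cone \<open>E\<close> of its left approximation \<open>B\<close> by the summands
  of \<open>A\<close>. Keeping \<open>A\<close> is what makes the result stay above \<open>U\<close>.\<close>

lemma mutation:
  assumes approx: "minimal_approximation U G A i p f" and TU: "silting_ge C T U"
  obtains V where "silting C V" "below C V \<subseteq> below C T" "silting_ge C V U"
    "\<And>Z. silting_ge C V T \<Longrightarrow> Z \<in> Y ` I \<Longrightarrow> \<exists>g\<in>G. isomorphic C Z (fst g)"
proof -
  note ap = minimal_approximationD[OF approx]
  note D = sum_diagramD[OF ap(1)] and DT = sum_diagramD[OF decomposition]
  have finG: "finite (fst ` G)" using D(1) by simp
  obtain H :: "('o \<times> 'm) set" and B j q l where SB: "sum_diagram C H B fst j q" and HG: "fst ` H \<subseteq> fst ` G"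
    and l: "l \<in> mor C T B" and ext: "\<And>Z x. Z \<in> fst ` G \<Longrightarrow> x \<in> mor C T Z \<Longrightarrow> \<exists>y\<in>mor C B Z. x = y \<cdot> l"
    using ex_left_approximation[OF finG fin_dim, of T] by blast
  obtain E g h where tri: "dtri C T B E l g h" using TR1_cone[OF l] by blast
  obtain V where V: "biproduct C V A E" using ex_biproduct by blast
  have GY: "Z \<in> Y ` I" if "Z \<in> fst ` G" for Z using that ap(2) by blast
  have geA: "silting_ge C W A" if "\<And>Z. Z \<in> fst ` G \<Longrightarrow> silting_ge C W Z" for W
    using that unfolding silting_ge_sum_right[OF ap(1)] by blast
  have geB: "silting_ge C W B" if "\<And>Z. Z \<in> fst ` G \<Longrightarrow> silting_ge C W Z" for W
    using that HG unfolding silting_ge_sum_right[OF SB] by blast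
  have Age: "silting_ge C A W" if "\<And>Z. Z \<in> fst ` G \<Longrightarrow> silting_ge C Z W" for W
    using that unfolding silting_ge_sum_left[OF ap(1)] by blast
  have Bge: "silting_ge C B W" if "\<And>Z. Z \<in> fst ` G \<Longrightarrow> silting_ge C Z W" for W
    using that HG unfolding silting_ge_sum_left[OF SB] by blast
  have TZ: "silting_ge C T Z" if "Z \<in> fst ` G" for Z by (rule ge_summand[OF GY[OF that] T_ge_T])
  have TA: "silting_ge C T A" and TB: "silting_ge C T B" using geA geB TZ by blast+
  have A_T: "silting_ge C A W" and B_T: "silting_ge C B W" if "silting_ge C T W" for W
    using Age Bge summand_ge[OF GY that] by blast+
  have EZ: "silting_ge C E Z" if "Z \<in> fst ` G" for Z
    by (rule silting_ge_cone[OF tri TZ[OF that] B_T[OF TZ[OF that]] ext[OF that]])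
  have EA: "silting_ge C E A" and EB: "silting_ge C E B" using geA geB EZ by blast+
  have AE: "silting_ge C A E"
    unfolding silting_ge_iff
  proof (intro allI impI)
    fix n :: nat assume "0 < n"
    then show "Hom_zero C A (shiftO n E)"
      using Hom_zero_third[OF tri, of A n] A_T[OF TB] A_T[OF T_ge_T] unfolding silting_ge_iff by blast
  qed
  have EE: "silting_ge C E E"
    unfolding silting_ge_iff
  proof (intro allI impI)
    fix n :: nat assume n: "0 < n"
    have "Hom_zero C (shift_ob C T) (shiftO (Suc n) T)"
      using Hom_zero_shift[of 1 T "shiftO n T"] T_ge_T n unfolding silting_ge_iff by simp
    then have "Hom_zero C E (shiftO (Suc n) T)"
      using Hom_zero_third_left[OF tri] B_T[OF T_ge_T] unfolding silting_ge_iff by blast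
    then show "Hom_zero C E (shiftO n E)"
      using Hom_zero_third[OF tri, of E n] EB n unfolding silting_ge_iff by blast
  qed
  have EU: "silting_ge C E U"
  proof (rule silting_ge_cone[OF tri TU B_T[OF TU]])
    fix w assume w: "w \<in> mor C T U"
    have "\<exists>y\<in>mor C (Y a) A. w \<cdot> \<iota> a = f \<cdot> y" if a: "a \<in> I" for a
      using ap(4)[of "Y a" "w \<cdot> \<iota> a"] a comp_closed[OF DT(2)[OF a] w] by blast
    then obtain y where y: "\<And>a. a \<in> I \<Longrightarrow> y a \<in> mor C (Y a) A" "\<And>a. a \<in> I \<Longrightarrow> w \<cdot> \<iota> a = f \<cdot> y a" by metis
    obtain x where x: "x \<in> mor C T A" "\<And>a. a \<in> I \<Longrightarrow> x \<cdot> \<iota> a = y a"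
      using sum_diagram_copair[OF decomposition y(1)] by blast
    have wx: "w = f \<cdot> x"
      by (rule sum_diagram_eq_from[OF decomposition w comp_closed[OF x(1) ap(3)]])
        (use y(2) x(2) comp_assoc[OF DT(2) x(1) ap(3)] in simp)
    have "\<exists>y\<in>mor C B (fst g). p g \<cdot> x = y \<cdot> l" if g: "g \<in> G" for g
      using ext[of "fst g" "p g \<cdot> x"] g comp_closed[OF x(1) D(3)[OF g]] by blast
    then obtain z where z: "\<And>g. g \<in> G \<Longrightarrow> z g \<in> mor C B (fst g)" "\<And>g. g \<in> G \<Longrightarrow> p g \<cdot> x = z g \<cdot> l" by metis
    obtain z' where z': "z' \<in> mor C B A" "\<And>g. g \<in> G \<Longrightarrow> p g \<cdot> z' = z g"
      using sum_diagram_pair[OF ap(1) z(1)] by blast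
    have "x = z' \<cdot> l"
      by (rule sum_diagram_eq_to[OF ap(1) x(1) comp_closed[OF l z'(1)]])
        (use z(2) z'(2) comp_assoc[OF l z'(1) D(3)] in simp)
    then have "w = (f \<cdot> z') \<cdot> l" using wx comp_assoc[OF l z'(1) ap(3)] by simp
    then show "\<exists>y\<in>mor C B U. w = y \<cdot> l" using comp_closed[OF z'(1) ap(3)] by blast
  qed
  have V_ge: "silting_ge C V W \<longleftrightarrow> silting_ge C A W \<and> silting_ge C E W" for W
    by (rule silting_ge_biproduct_left[OF V])
  have "presilting C V"
    unfolding presilting_iff V_ge unfolding silting_ge_biproduct_right[OF V]
    using A_T[OF TA] AE EA EE by blast
  moreover have "thick C V = UNIV"
  proof (rule thick_eq_UNIV)
    show "thick C T = UNIV" using T_silting unfolding silting_def by blast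
    fix S assume S: "thick_subcategory C S" and VS: "V \<in> S"
    have A: "A \<in> S" and E: "E \<in> S"
      using thick_subcategoryD(5)[OF S VS] V biproduct_commute[OF V] unfolding direct_summand_def by auto
    have "fst g \<in> S" if "g \<in> G" for g by (rule thick_summand[OF S ap(1) that A])
    then have "fst b \<in> S" if "b \<in> H" for b using HG that by auto
    then have "B \<in> S" by (rule thick_sum[OF S SB])
    then show "T \<in> S" by (rule thick_first[OF S tri _ E])
  qed
  ultimately have silt: "silting C V" unfolding silting_def by blast
  have sub: "below C V \<subseteq> below C T"
  proof
    fix W assume "W \<in> below C V"
    then have AW: "silting_ge C A W" and EW: "silting_ge C E W" unfolding below_def V_ge by blast+
    have "silting_ge C Z W" if "Z \<in> fst ` G" for Z
      using AW that unfolding silting_ge_sum_left[OF ap(1)] by blast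
    then have BW: "silting_ge C B W" by (rule Bge)
    have "silting_ge C T W"
      unfolding silting_ge_iff
    proof (intro allI impI)
      fix n :: nat assume n: "0 < n"
      have "Hom_zero C (shift_ob C B) (shiftO (Suc n) W)"
        using Hom_zero_shift[of 1 B "shiftO n W"] BW n unfolding silting_ge_iff by simp
      moreover have "Hom_zero C E (shiftO (Suc n) W)" using EW unfolding silting_ge_iff by blast
      ultimately have "Hom_zero C (shift_ob C T) (shiftO (Suc n) W)"
        using Hom_zero_second_left[OF dtri_rotate[OF dtri_rotate[OF tri]]] by blast
      then show "Hom_zero C T (shiftO n W)" using Hom_zero_shift[of 1 T "shiftO n W"] by simp
    qed
    then show "W \<in> below C T" unfolding below_def by blast
  qed
  have VU: "silting_ge C V U" unfolding V_ge using A_T[OF TU] EU by blast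
  have occur: "\<exists>g\<in>G. isomorphic C Z (fst g)" if VT: "silting_ge C V T" and Z: "Z \<in> Y ` I" for Z
  proof -
    let ?S = "shift_ob C"
    have "silting_ge C E T" using VT unfolding V_ge by blast
    then have "Hom_zero C E (?S T)" by (rule silting_ge_shift)
    then have h0: "h = zero_mor C E (?S T)" using Hom_zeroD[of E "?S T" h] dtri_mor(3)[OF tri] by simp
    have "ident C (?S T) \<cdot> h = zero_mor C E (?S T)" using ident_left[OF dtri_mor(3)[OF tri]] h0 by simp
    then obtain w where w: "w \<in> mor C (?S B) (?S T)"
      "ident C (?S T) = w \<cdot> (\<ominus>\<^bsub>HOM C (?S T) (?S B)\<^esub> shift_mor C l)"
      using dtri_exact_contravariant[OF dtri_rotate[OF dtri_rotate[OF tri]] ident_closed] by blast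
    obtain w' where w': "w' \<in> mor C B T" "w = shiftM 1 w'" using shiftM_full[of w 1 B T] w(1) by auto
    let ?l = "\<ominus>\<^bsub>HOM C T B\<^esub> l"
    have nl: "?l \<in> mor C T B" by (rule hom.a_inv_closed[OF l])
    have "shiftM 1 (ident C T) = shiftM 1 (w' \<cdot> ?l)"
      unfolding shiftM_ident shiftM_comp[OF nl w'(1)] shiftM_minus[OF l] using w(2) w'(2) by simp
    then have "ident C T = w' \<cdot> ?l" by (rule shiftM_inject[OF ident_closed comp_closed[OF nl w'(1)]])
    then have "retract C T B" unfolding retract_def using nl w'(1) by metis
    moreover obtain a where a: "a \<in> I" "Z = Y a" using Z by blast
    ultimately have ZB: "retract C Z B" using retract_trans[OF sum_diagram_retract[OF decomposition]] by blast
    have loc: "local_ring (End_ring C (fst b))" if "b \<in> H" for b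
      by (rule local[OF GY]) (use HG that in auto)
    obtain b where b: "b \<in> H" "isomorphic C Z (fst b)"
      using local_retract_of_sum[OF SB loc local[OF Z] ZB] by blast
    then obtain g where "g \<in> G" "fst b = fst g" using HG by blast
    then show ?thesis using b(2) by auto
  qed
  show thesis by (rule that[OF silt sub VU occur])
qed

text \<open>If the mutation were still above \<open>T\<close>, every summand of \<open>T\<close> would occur in the approximation of
  \<open>U\<close>, and then \<open>U \<ge> T\<close>.\<close>

lemma strict_mutation:
  assumes U: "presilting C U" and TU: "silting_ge C T U" and UT: "\<not> silting_ge C U T"
  obtains V where "silting C V" "below C V \<subset> below C T" "silting_ge C V U"
proof -
  obtain G A i p f where approx: "minimal_approximation U G A i p f" using ex_minimal_approximation by blast
  obtain V where V: "silting C V" "below C V \<subseteq> below C T" "silting_ge C V U"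
    "\<And>Z. silting_ge C V T \<Longrightarrow> Z \<in> Y ` I \<Longrightarrow> \<exists>g\<in>G. isomorphic C Z (fst g)"
    using mutation[OF approx TU] by blast
  have "\<not> silting_ge C V T" using ge_T_if_all_summands_occur[OF U TU approx] V(4) UT by blast
  then have "below C V \<noteq> below C T" using T_ge_T unfolding below_def by blast
  then show thesis using that[OF V(1) _ V(3)] V(2) by blast
qed

end


section \<open>Passing to basic silting objects\<close>

context triangulated_category
begin

lemma krull_schmidt_decomposition:
  assumes "krull_schmidt C"
  obtains n Y i p where "sum_diagram C {..<n::nat} X Y i p" "\<And>a. a < n \<Longrightarrow> local_ring (End_ring C (Y a))"
proof -
  obtain n Y where *: "direct_sum C X Y n" "\<forall>a<n. local_ring (End_ring C (Y a))"
    using assms unfolding krull_schmidt_def by blast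
  show thesis
    by (rule direct_sum_diagram[OF *(1)]) (use *(2) that in blast)
qed

text \<open>Keeping one summand of each isomorphism class changes neither the order nor the thick closure.\<close>

lemma ex_basic_silting:
  assumes ks: "krull_schmidt C" and V: "silting C V"
  shows "\<exists>W. silting C W \<and> basic C W \<and> below C W = below C V"
proof -
  obtain n Y i p where S: "sum_diagram C {..<n::nat} V Y i p"
    and loc: "\<And>a. a < n \<Longrightarrow> local_ring (End_ring C (Y a))"
    using krull_schmidt_decomposition[OF ks] by blast
  define rep where "rep X = (SOME X'. X' \<in> Y ` {..<n} \<and> isomorphic C X X')" for X
  have rep: "rep X \<in> Y ` {..<n}" "isomorphic C X (rep X)" if "X \<in> Y ` {..<n}" for X
    using someI[of "\<lambda>X'. X' \<in> Y ` {..<n} \<and> isomorphic C X X'" X] that isomorphic_refl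
    unfolding rep_def by blast+
  have rep_eq: "rep X = rep X'" if XX': "isomorphic C X X'" for X X'
  proof -
    have "isomorphic C X Z \<longleftrightarrow> isomorphic C X' Z" for Z
      using isomorphic_trans[OF XX'] isomorphic_trans[OF isomorphic_sym[OF XX']] by blast
    then show ?thesis unfolding rep_def by simp
  qed
  define R where "R = rep ` Y ` {..<n}"
  have R: "R \<subseteq> Y ` {..<n}" unfolding R_def using rep(1) by blast
  obtain W j q where S': "sum_diagram C R W (\<lambda>X. X) j q"
    using ex_sum[of R "\<lambda>X. X"] unfolding R_def by auto
  have Rloc: "local_ring (End_ring C X)" if "X \<in> R" for X using that R loc by auto
  have Riso: "X = X'" if X: "X \<in> R" "X' \<in> R" and iso: "isomorphic C X X'" for X X'
  proof -
    have "rep X = X" if "X \<in> R" for X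
      using that rep_eq[OF rep(2)] unfolding R_def by auto
    then show ?thesis using X rep_eq[OF iso] by metis
  qed
  have basic: "basic C W" by (rule sum_diagram_basic[OF S' Rloc Riso])
  have repR: "rep (Y a) \<in> R" "isomorphic C (Y a) (rep (Y a))" if "a < n" for a
    using that rep(2)[of "Y a"] unfolding R_def by auto
  have left: "silting_ge C W Z \<longleftrightarrow> silting_ge C V Z" for Z
  proof
    assume "silting_ge C W Z"
    then have "silting_ge C X Z" if "X \<in> R" for X using that unfolding silting_ge_sum_left[OF S'] by blast
    then have "silting_ge C (Y a) Z" if "a < n" for a
      using silting_ge_retract_left[OF isomorphic_retract] repR[OF that] by blast
    then show "silting_ge C V Z" unfolding silting_ge_sum_left[OF S] by simp
  next
    assume "silting_ge C V Z"
    then show "silting_ge C W Z" using R unfolding silting_ge_sum_left[OF S'] silting_ge_sum_left[OF S] by blast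
  qed
  have right: "silting_ge C Z W \<longleftrightarrow> silting_ge C Z V" for Z
  proof
    assume "silting_ge C Z W"
    then have "silting_ge C Z X" if "X \<in> R" for X using that unfolding silting_ge_sum_right[OF S'] by blast
    then have "silting_ge C Z (Y a)" if "a < n" for a
      using silting_ge_retract_right[OF isomorphic_retract] repR[OF that] by blast
    then show "silting_ge C Z V" unfolding silting_ge_sum_right[OF S] by simp
  next
    assume "silting_ge C Z V"
    then show "silting_ge C Z W" using R unfolding silting_ge_sum_right[OF S'] silting_ge_sum_right[OF S] by blast
  qed
  have "presilting C W" using V left right unfolding silting_def presilting_iff by blast
  moreover have "thick C W = UNIV"
  proof (rule thick_eq_UNIV)
    show "thick C V = UNIV" using V unfolding silting_def by blast
    fix S'' assume T: "thick_subcategory C S''" and W: "W \<in> S''"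
    have "Y a \<in> S''" if "a \<in> {..<n}" for a
    proof -
      have a: "a < n" using that by simp
      have "rep (Y a) \<in> S''" by (rule thick_summand[OF T S' repR(1)[OF a] W])
      then show ?thesis by (rule thick_subcategoryD(2)[OF T _ isomorphic_sym[OF repR(2)[OF a]]])
    qed
    then show "V \<in> S''" by (rule thick_sum[OF T S])
  qed
  ultimately have "silting C W" unfolding silting_def by blast
  then show ?thesis using basic left unfolding below_def by auto
qed

lemma below_isomorphic:
  assumes "isomorphic C V W" shows "below C V = below C W"
  using silting_ge_retract_left[OF isomorphic_retract[OF assms]]
    silting_ge_retract_left[OF isomorphic_retract[OF isomorphic_sym[OF assms]]]
  unfolding below_def by blast

lemma finite_below:
  assumes "finite (iso_class C ` \<S>)" shows "finite (below C ` \<S>)"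
proof -
  have "below C V = below C (SOME W. W \<in> iso_class C V)" for V
  proof -
    have "(SOME W. W \<in> iso_class C V) \<in> iso_class C V"
      by (rule someI[of _ V]) (simp add: iso_class_def isomorphic_refl)
    then show ?thesis unfolding iso_class_def by (simp add: below_isomorphic)
  qed
  then have "below C ` \<S> = (\<lambda>c. below C (SOME W. W \<in> c)) ` iso_class C ` \<S>" by (simp add: image_image)
  then show ?thesis using assms by simp
qed

lemma silting_mutation:
  assumes hf: "hom_finite K C" and ks: "krull_schmidt C" and V: "silting C V" and U: "presilting C U"
    and VU: "silting_ge C V U" and UV: "\<not> silting_ge C U V"
  obtains W where "silting C W" "basic C W" "below C W \<subset> below C V" "silting_ge C W U"
proof -
  obtain n Y i p where S: "sum_diagram C {..<n::nat} V Y i p"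
    and loc: "\<And>a. a < n \<Longrightarrow> local_ring (End_ring C (Y a))"
    using krull_schmidt_decomposition[OF ks] by blast
  have dec: "decomposed_silting K C V {..<n} Y i p"
    by (intro decomposed_silting.intro decomposed_silting_axioms.intro triangulated_category_axioms
        hf V S) (simp add: loc)
  obtain V' where V': "silting C V'" "below C V' \<subset> below C V" "silting_ge C V' U"
    by (rule decomposed_silting.strict_mutation[OF dec U VU UV])
  obtain W where W: "silting C W" "basic C W" "below C W = below C V'"
    using ex_basic_silting[OF ks V'(1)] by blast
  moreover have "silting_ge C W U" using W(3) V'(3) unfolding below_def by blast
  ultimately show thesis using that V'(2) by simp
qed

text \<open>The hypotheses are exactly what makes \<open>V \<oplus> U\<close> presilting.\<close>

lemma partial_siltingI:
  assumes V: "silting C V" and U: "presilting C U" and VU: "silting_ge C V U" and UV: "silting_ge C U V"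
  shows "partial_silting C U"
proof -
  obtain X where X: "biproduct C X V U" using ex_biproduct by blast
  have "presilting C X"
    using V U VU UV
    unfolding silting_def presilting_iff silting_ge_biproduct_left[OF X] silting_ge_biproduct_right[OF X] by blast
  moreover have "thick C X = UNIV"
  proof (rule thick_eq_UNIV)
    show "thick C V = UNIV" using V unfolding silting_def by blast
    show "V \<in> S" if "thick_subcategory C S" "X \<in> S" for S
      using thick_subcategoryD(5)[OF that] X unfolding direct_summand_def by blast
  qed
  ultimately show ?thesis
    unfolding partial_silting_def silting_def direct_summand_def using biproduct_commute[OF X] by blast
qed

end

section \<open>Finitely many silting objects between two objects\<close>

theorem theorem2p17:
  fixes K :: "'k ring" and \<T> :: "('k, 'o, 'm) triangulated_data" and T U :: 'o
  assumes "field K"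
    and "triangulated_category K \<T>"
    and "hom_finite K \<T>"
    and "krull_schmidt \<T>"
    and "silting \<T> T" and "basic \<T> T"
    and "presilting \<T> U"
    and "silting_ge \<T> T U"
    and "finite (iso_class \<T> `
      {V. silting \<T> V \<and> basic \<T> V \<and> silting_ge \<T> T V \<and> silting_ge \<T> V U})"
  shows "partial_silting \<T> U"
proof -
  interpret triangulated_category K \<T> by fact
  define \<S> where "\<S> = {V. silting \<T> V \<and> basic \<T> V \<and> below \<T> V \<subseteq> below \<T> T \<and> silting_ge \<T> V U}"
  have T: "T \<in> \<S>" unfolding \<S>_def using assms by blast
  have "silting_ge \<T> T V" if "V \<in> \<S>" for V
    using that unfolding \<S>_def below_def silting_def presilting_iff by blast
  then have "\<S> \<subseteq> {V. silting \<T> V \<and> basic \<T> V \<and> silting_ge \<T> T V \<and> silting_ge \<T> V U}"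
    unfolding \<S>_def by blast
  then have "finite (iso_class \<T> ` \<S>)" using assms(9) by (meson finite_subset image_mono)
  then have "finite (below \<T> ` \<S>)" by (rule finite_below)
  then obtain B where "B \<in> below \<T> ` \<S>" and min': "\<forall>B'\<in>below \<T> ` \<S>. B' \<subseteq> B \<longrightarrow> B = B'"
    using finite_has_minimal[of "below \<T> ` \<S>"] T by blast
  then obtain V where V: "V \<in> \<S>" and B: "B = below \<T> V" by blast
  have min: "\<not> below \<T> W \<subset> below \<T> V" if "W \<in> \<S>" for W using min' that unfolding B by blast
  have "silting_ge \<T> U V"
  proof (rule ccontr)
    assume "\<not> silting_ge \<T> U V"
    then obtain W where W: "silting \<T> W" "basic \<T> W" "below \<T> W \<subset> below \<T> V" "silting_ge \<T> W U"
      using silting_mutation[OF assms(3,4) _ assms(7), of V] V unfolding \<S>_def by blast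
    then have "W \<in> \<S>" using V unfolding \<S>_def by blast
    then show False using min W(3) by blast
  qed
  then show ?thesis using partial_siltingI[OF _ assms(7)] V unfolding \<S>_def by blast
qed

end
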